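(* Let $A(z)$ be a holomorphic function in $\mathbb{C}_+$ with values in $\mathcal{T}_1$ such that, for some constant $C>0$, $$\|A(z)\|_1\le C(1+|z|),\qquad z\in\mathbb{C}_+.$$ Assume that $I+A(x)$ is unitary for $x\in\mathbb{R}$ and suppose that for $0<\mathrm{Im}\, z<1$ the operator $I+A(z)$ is invertible. Then for every $\varepsilon>0$ there is a constant $C_\varepsilon>0$ such that $$\|(I+A(x+i/2))^{-1}\|\le C_\varepsilon e^{\varepsilon|x|^2},\qquad x\in\mathbb{R}.$$
   Context: $\mathbb{C}_+=\{z\in\mathbb{C}:\mathrm{Im}\, z>0\}$ is the open upper half-plane. $H$ is a Hilbert space, and $\mathcal{T}_1$ denotes the space of trace class operators in $H$ with the trace norm $\|\cdot\|_1$; $\|\cdot\|$ is the operator norm on bounded linear operators on $H$, and $I$ is the identity operator on $H$.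
   Formalization: A(x) for real x is undefined in the statement, since A is given only on the open upper half-plane; the formal version assumes that A extends to the closed half-plane with values in trace class, continuously in the trace norm, and takes A(x) to be the values of this extension. *)

theory Defs
  imports "HOL-Analysis.Analysis"
begin

text \<open>
  A complex Hilbert space is presented over its underlying real Hilbert space: the real
  inner product, the norm and the topology are those induced by the complex inner product,
  which is linear in its first argument.  Nonnegativity, definiteness and
  \<open>norm x = sqrt (Re (cinner x x))\<close> are inherited through \<open>Re_cinner\<close>.
\<close>

class chilbert_space = real_inner + complete_space +
  fixes scaleC :: "complex \<Rightarrow> 'a \<Rightarrow> 'a" (infixr \<open>*\<^sub>C\<close> 75)
    and cinner :: "'a \<Rightarrow> 'a \<Rightarrow> complex"
  assumes scaleC_add_right: "a *\<^sub>C (x + y) = a *\<^sub>C x + a *\<^sub>C y"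
    and scaleC_add_left: "(a + b) *\<^sub>C x = a *\<^sub>C x + b *\<^sub>C x"
    and scaleC_scaleC: "a *\<^sub>C b *\<^sub>C x = (a * b) *\<^sub>C x"
    and scaleC_of_real: "complex_of_real r *\<^sub>C x = r *\<^sub>R x"
    and cinner_commute: "cinner x y = cnj (cinner y x)"
    and cinner_add_left: "cinner (x + y) z = cinner x z + cinner y z"
    and cinner_scaleC_left: "cinner (a *\<^sub>C x) y = a * cinner x y"
    and Re_cinner: "Re (cinner x y) = inner x y"

lemma norm_scaleC: "norm (a *\<^sub>C x) = cmod a * norm (x :: 'a::chilbert_space)"
proof -
  have "cinner (a *\<^sub>C x) (a *\<^sub>C x) = a * cnj a * cinner x x"
    by (metis cinner_commute cinner_scaleC_left complex_cnj_mult mult.assoc)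
  also have "\<dots> = complex_of_real ((cmod a)\<^sup>2) * cinner x x"
    by (simp only: complex_norm_square)
  finally have "inner (a *\<^sub>C x) (a *\<^sub>C x) = (cmod a)\<^sup>2 * inner x x"
    by (simp flip: Re_cinner)
  then show ?thesis
    by (simp add: norm_eq_sqrt_inner real_sqrt_mult)
qed

lemma bounded_linear_scaleC: "bounded_linear (\<lambda>x :: 'a::chilbert_space. a *\<^sub>C x)"
proof (rule bounded_linear_intro[where K = "cmod a"])
  show "a *\<^sub>C (r *\<^sub>R x) = r *\<^sub>R (a *\<^sub>C x)" for r and x :: 'a
    by (metis mult.commute scaleC_of_real scaleC_scaleC)
qed (simp_all add: scaleC_add_right norm_scaleC mult.commute)

text \<open>
  The library type \<open>'a \<Rightarrow>\<^sub>L 'a\<close> consists of the bounded \<^emph>\<open>real\<close>-linear operators, with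
  the operator norm; the bounded operators of the complex space are those satisfying
  the following predicate.
\<close>

definition clinear_op :: "('a::chilbert_space \<Rightarrow>\<^sub>L 'a) \<Rightarrow> bool" where
  "clinear_op T \<longleftrightarrow> (\<forall>c x. blinfun_apply T (c *\<^sub>C x) = c *\<^sub>C blinfun_apply T x)"

lift_definition scaleC_op :: "complex \<Rightarrow> ('a::chilbert_space \<Rightarrow>\<^sub>L 'a) \<Rightarrow> ('a \<Rightarrow>\<^sub>L 'a)"
  is "\<lambda>c T x. c *\<^sub>C T x"
  by (rule bounded_linear_compose[OF bounded_linear_scaleC])

definition cadjoint :: "('a::chilbert_space \<Rightarrow>\<^sub>L 'a) \<Rightarrow> ('a \<Rightarrow>\<^sub>L 'a)" where
  "cadjoint T = (THE S. \<forall>x y. cinner (blinfun_apply T x) y = cinner x (blinfun_apply S y))"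

definition unitary_op :: "('a::chilbert_space \<Rightarrow>\<^sub>L 'a) \<Rightarrow> bool" where
  "unitary_op U \<longleftrightarrow>
    clinear_op U \<and> cadjoint U o\<^sub>L U = id_blinfun \<and> U o\<^sub>L cadjoint U = id_blinfun"

definition is_inverse_op :: "('a::chilbert_space \<Rightarrow>\<^sub>L 'a) \<Rightarrow> ('a \<Rightarrow>\<^sub>L 'a) \<Rightarrow> bool" where
  "is_inverse_op T S \<longleftrightarrow> T o\<^sub>L S = id_blinfun \<and> S o\<^sub>L T = id_blinfun"

definition invertible_op :: "('a::chilbert_space \<Rightarrow>\<^sub>L 'a) \<Rightarrow> bool" where
  "invertible_op T \<longleftrightarrow> (\<exists>S. is_inverse_op T S)"

definition inverse_op :: "('a::chilbert_space \<Rightarrow>\<^sub>L 'a) \<Rightarrow> ('a \<Rightarrow>\<^sub>L 'a)" where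
  "inverse_op T = (THE S. is_inverse_op T S)"

definition positive_op :: "('a::chilbert_space \<Rightarrow>\<^sub>L 'a) \<Rightarrow> bool" where
  "positive_op T \<longleftrightarrow> clinear_op T \<and> (\<forall>x. cinner (blinfun_apply T x) x \<in> \<real>\<^sub>\<ge>\<^sub>0)"

definition abs_op :: "('a::chilbert_space \<Rightarrow>\<^sub>L 'a) \<Rightarrow> ('a \<Rightarrow>\<^sub>L 'a)" where
  "abs_op T = (THE S. positive_op S \<and> S o\<^sub>L S = cadjoint T o\<^sub>L T)"

definition orthonormal_basis :: "'a::chilbert_space set \<Rightarrow> bool" where
  "orthonormal_basis E \<longleftrightarrow>
    (\<forall>e\<in>E. \<forall>f\<in>E. cinner e f = (if e = f then 1 else 0)) \<and>
    (\<forall>x. (\<forall>e\<in>E. cinner x e = 0) \<longrightarrow> x = 0)"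

text \<open>
  Trace class operators and \<open>\<parallel>T\<parallel>\<^sub>1 = tr \<bar>T\<bar>\<close>.  Neither notion depends on the
  orthonormal basis.  The terms of the sum are real because \<open>\<bar>T\<bar>\<close> is positive.  The value
  of \<open>trace_norm\<close> is only meaningful on trace class operators.
\<close>

definition trace_class :: "('a::chilbert_space \<Rightarrow>\<^sub>L 'a) \<Rightarrow> bool" where
  "trace_class T \<longleftrightarrow> clinear_op T \<and>
    (\<exists>E. orthonormal_basis E \<and> (\<lambda>e. Re (cinner (blinfun_apply (abs_op T) e) e)) summable_on E)"

definition trace_norm :: "('a::chilbert_space \<Rightarrow>\<^sub>L 'a) \<Rightarrow> real" where
  "trace_norm T =
    (\<Sum>\<^sub>\<infinity>e\<in>(SOME E. orthonormal_basis E). Re (cinner (blinfun_apply (abs_op T) e) e))"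

text \<open>
  Continuity and holomorphy of functions with values in the Banach space of trace class
  operators, that is, with respect to the trace norm.
\<close>

definition trace_continuous_on :: "complex set \<Rightarrow> (complex \<Rightarrow> ('a::chilbert_space \<Rightarrow>\<^sub>L 'a)) \<Rightarrow> bool" where
  "trace_continuous_on S A \<longleftrightarrow>
    (\<forall>z\<in>S. trace_class (A z)) \<and>
    (\<forall>z\<in>S. ((\<lambda>w. trace_norm (A w - A z)) \<longlongrightarrow> 0) (at z within S))"

definition trace_holomorphic_on :: "complex set \<Rightarrow> (complex \<Rightarrow> ('a::chilbert_space \<Rightarrow>\<^sub>L 'a)) \<Rightarrow> bool" where
  "trace_holomorphic_on S A \<longleftrightarrow>
    (\<forall>z\<in>S. trace_class (A z)) \<and>
    (\<forall>z\<in>S. \<exists>D. trace_class D \<and>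
      ((\<lambda>w. trace_norm (scaleC_op (inverse (w - z)) (A w - A z) - D)) \<longlongrightarrow> 0) (at z within S))"

end

theory Submission
  imports Defs "HOL-Complex_Analysis.Complex_Analysis" "Jordan_Normal_Form.Schur_Decomposition"
begin

text \<open>
  By a Phragmen-Lindelof argument, \<open>S(z) = I + A(z)\<close> is a contraction in the upper half-plane.
  If the estimate fails for \<open>\<epsilon>\<close>, there are \<open>n\<close> arbitrarily sparse points \<open>x\<^sub>k\<close> and unit
  vectors \<open>g\<^sub>k\<close> such that \<open>S(x\<^sub>k + i/2) g\<^sub>k\<close> has norm at most \<open>exp (- \<epsilon> x\<^sub>k\<^sup>2)\<close>.
  Instead of the Fredholm determinant of \<open>S\<close>, consider the determinant \<open>d(z)\<close> of the compression
  of \<open>S(z)\<close> to a finite-dimensional space that contains the \<open>g\<^sub>k\<close> and nearly contains the range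
  of \<open>A(z)\<close>, for \<open>z\<close> in discs about the points \<open>x\<^sub>k + i/2\<close> and for \<open>z = i/2\<close>.
  Then \<open>\<bar>d\<bar> \<le> 1\<close>, \<open>d\<close> has no zeros in the discs, and \<open>d(x\<^sub>k + i/2)\<close> is of order
  \<open>exp (- \<epsilon> x\<^sub>k\<^sup>2)\<close>.  As \<open>- ln \<bar>d\<bar>\<close> is positive and superharmonic in the half-plane and
  harmonic in the discs, each disc contributes a fixed multiple of \<open>\<epsilon>\<close> to \<open>- ln \<bar>d(i/2)\<bar>\<close>.
  On the other hand, \<open>- ln \<bar>d(i/2)\<bar>\<close> is bounded in terms of the trace norm of \<open>A(i/2)\<close> and the
  norm of \<open>S(i/2)\<^sup>-\<^sup>1\<close>, which is absurd for large \<open>n\<close>.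
\<close>

section \<open>Hilbert spaces and positive square roots\<close>

text \<open>The quadratic rate is the critical one: seen from \<open>\<i> / 2\<close>, a disc of
  fixed size about a point \<open>x + \<i> / 2\<close> has harmonic measure of order
  \<open>1 / x^2\<close>, which exactly balances the exponent \<open>\<epsilon> * x^2\<close>, so
  finitely many bad points exceed any prescribed budget. The discs are there because smallness of
  \<open>d\<close> at a single point could be caused by a zero nearby and would then carry little
  weight; in a zero-free disc Harnack's inequality spreads it over a whole circle. What makes
  compressions usable is uniformity in the dimension: neither the upper bound 1 nor the lower bound
  at \<open>\<i> / 2\<close> may deteriorate as the space grows, since the space can be chosen only
  after the points, and the number of points only after the lower bound at \<open>\<i> / 2\<close>.
  A compression of an invertible operator may be singular; the space has to capture the range of
  \<open>A(z)\<close> up to a small error, so that \<open>S(z)\<close> nearly preserves it and the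
  compression keeps half of the lower bound. This is where compactness of the operators
  \<open>A(z)\<close> and of the discs enters.\<close>

instance chilbert_space \<subseteq> banach ..

lemma cinner_add_right: "cinner x (y + z) = cinner x y + cinner x (z::'a::chilbert_space)"
  by (metis cinner_add_left cinner_commute complex_cnj_add)

lemma cinner_scaleC_right: "cinner x (a *\<^sub>C y) = cnj a * cinner x (y::'a::chilbert_space)"
  by (metis cinner_commute cinner_scaleC_left complex_cnj_mult)

lemma cinner_zero_left [simp]: "cinner 0 (y::'a::chilbert_space) = 0"
  using cinner_add_left[of 0 0 y] by simp

lemma cinner_zero_right [simp]: "cinner (y::'a::chilbert_space) 0 = 0"
  using cinner_add_right[of y 0 0] by simp

lemma cinner_minus_left [simp]: "cinner (- x) y = - cinner x (y::'a::chilbert_space)"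
  using cinner_add_left[of x "- x" y] by (simp add: add_eq_0_iff)

lemma cinner_minus_right [simp]: "cinner x (- y) = - cinner x (y::'a::chilbert_space)"
  using cinner_add_right[of x y "- y"] by (simp add: add_eq_0_iff)

lemma cinner_diff_left: "cinner (x - y) z = cinner x z - cinner y (z::'a::chilbert_space)"
  using cinner_add_left[of x "- y" z] by simp

lemma cinner_diff_right: "cinner x (y - z) = cinner x y - cinner x (z::'a::chilbert_space)"
  using cinner_add_right[of x y "- z"] by simp

lemma cinner_scaleR_left: "cinner (r *\<^sub>R x) y = of_real r * cinner x (y::'a::chilbert_space)"
  by (metis cinner_scaleC_left scaleC_of_real)

lemma cinner_scaleR_right: "cinner x (r *\<^sub>R y) = of_real r * cinner x (y::'a::chilbert_space)"
  by (metis cinner_scaleC_right complex_cnj_complex_of_real scaleC_of_real)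

lemma cinner_sum_left: "cinner (\<Sum>i\<in>I. f i) y = (\<Sum>i\<in>I. cinner (f i) (y::'a::chilbert_space))"
  by (induction I rule: infinite_finite_induct) (simp_all add: cinner_add_left)

lemma cinner_sum_right: "cinner y (\<Sum>i\<in>I. f i) = (\<Sum>i\<in>I. cinner (y::'a::chilbert_space) (f i))"
  by (induction I rule: infinite_finite_induct) (simp_all add: cinner_add_right)

lemmas cinner_simps = cinner_add_left cinner_add_right cinner_diff_left cinner_diff_right
  cinner_scaleC_left cinner_scaleC_right cinner_scaleR_left cinner_scaleR_right

lemma cinner_self: "cinner x x = of_real ((norm (x::'a::chilbert_space))\<^sup>2)"
proof (rule complex_eqI)
  show "Re (cinner x x) = Re (of_real ((norm x)\<^sup>2))"
    by (simp add: Re_cinner power2_norm_eq_inner)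
  have "Im (cinner x x) = - Im (cinner x x)"
    using cinner_commute[of x x] by (metis cnj.simps(2))
  then show "Im (cinner x x) = Im (of_real ((norm x)\<^sup>2))"
    by simp
qed

lemma scaleC_zero_right [simp]: "a *\<^sub>C (0::'a::chilbert_space) = 0"
  using scaleC_add_right[of a 0 "0::'a"] by simp

lemma scaleC_zero_left [simp]: "0 *\<^sub>C (x::'a::chilbert_space) = 0"
  using scaleC_of_real[of 0 x] by simp

lemma scaleC_one [simp]: "1 *\<^sub>C (x::'a::chilbert_space) = x"
  using scaleC_of_real[of 1 x] by simp

lemma scaleC_minus_right: "a *\<^sub>C (- x) = - (a *\<^sub>C (x::'a::chilbert_space))"
  using scaleC_add_right[of a x "- x"] by (simp add: eq_neg_iff_add_eq_0 add.commute)

lemma scaleC_diff_right: "a *\<^sub>C (x - y) = a *\<^sub>C x - a *\<^sub>C (y::'a::chilbert_space)"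
  using scaleC_add_right[of a x "- y"] by (simp add: scaleC_minus_right)

lemma scaleC_diff_left: "(a - b) *\<^sub>C x = a *\<^sub>C x - b *\<^sub>C (x::'a::chilbert_space)"
  using scaleC_add_left[of "a - b" b x] by simp

lemma scaleC_scaleR_commute: "a *\<^sub>C (r *\<^sub>R x) = r *\<^sub>R (a *\<^sub>C (x::'a::chilbert_space))"
  by (metis mult.commute scaleC_of_real scaleC_scaleC)

lemma scaleC_sum_right: "a *\<^sub>C (\<Sum>i\<in>I. f i) = (\<Sum>i\<in>I. a *\<^sub>C (f i::'a::chilbert_space))"
  by (induction I rule: infinite_finite_induct) (simp_all add: scaleC_add_right)

lemma Im_cinner: "Im (cinner x y) = - inner (\<i> *\<^sub>C x) (y::'a::chilbert_space)"
  by (simp flip: Re_cinner add: cinner_scaleC_left)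

lemma cmod_cinner_le: "cmod (cinner x y) \<le> norm x * norm (y::'a::chilbert_space)"
proof (cases "cinner x y = 0")
  case False
  define c where "c = cnj (cinner x y) / of_real (cmod (cinner x y))"
  have c: "cmod c = 1"
    using False by (simp add: c_def norm_divide)
  have "c * cinner x y = of_real (cmod (cinner x y))"
    using False by (simp add: c_def complex_norm_square[symmetric] mult.commute power2_eq_square field_simps)
  then have "cmod (cinner x y) = Re (cinner (c *\<^sub>C x) y)"
    by (simp add: cinner_scaleC_left)
  also have "\<dots> \<le> norm (c *\<^sub>C x) * norm y"
    unfolding Re_cinner by (rule norm_cauchy_schwarz)
  finally show ?thesis
    by (simp add: norm_scaleC c)
qed simp

lemma cinner_ext: "(\<And>z. cinner z x = cinner z (y::'a::chilbert_space)) \<Longrightarrow> x = y"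
proof -
  assume *: "\<And>z. cinner z x = cinner z y"
  have "cinner (x - y) (x - y) = 0"
    using * by (simp add: cinner_diff_right)
  then show "x = y"
    by (simp add: cinner_self)
qed

lemma bounded_bilinear_cinner: "bounded_bilinear (cinner :: 'a::chilbert_space \<Rightarrow> 'a \<Rightarrow> complex)"
proof (rule bounded_bilinear.intro)
  show "\<exists>K. \<forall>a b::'a. norm (cinner a b) \<le> norm a * norm b * K"
    by (rule exI[of _ 1]) (simp add: cmod_cinner_le)
qed (simp_all add: cinner_simps scaleR_conv_of_real)

lemmas tendsto_cinner = bounded_bilinear.tendsto[OF bounded_bilinear_cinner]

section \<open>First-order conditions, Riesz representation and adjoints\<close>

lemma quadratic_nonneg_imp_zero:
  fixes a b :: real
  assumes "b \<ge> 0" and "\<And>t. 2 * t * a + t\<^sup>2 * b \<ge> 0"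
  shows "a = 0"
proof (rule ccontr)
  assume "a \<noteq> 0"
  define c where "c = 1 / (b + 1)"
  have c: "c > 0" "c * b < 1"
    using assms(1) by (simp_all add: c_def)
  have "c * a\<^sup>2 * (2 - c * b) > 0"
    using c \<open>a \<noteq> 0\<close> by (intro mult_pos_pos) auto
  moreover have "2 * (- c * a) * a + (- c * a)\<^sup>2 * b = - (c * a\<^sup>2 * (2 - c * b))"
    by (simp add: power2_eq_square algebra_simps)
  ultimately show False
    using assms(2)[of "- c * a"] by linarith
qed

text \<open>The representing vector minimises \<open>(norm x)^2 - 2 * \<phi> x\<close>: by the
  parallelogram law minimising sequences are Cauchy, and the first-order condition at the minimum is
  the representation formula.\<close>

lemma riesz_representation:
  fixes \<phi> :: "'a::{real_inner,complete_space} \<Rightarrow> real"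
  assumes "bounded_linear \<phi>"
  obtains y where "\<And>x. \<phi> x = inner x y"
proof -
  interpret \<phi>: bounded_linear \<phi> by fact
  obtain K where K: "\<And>x. norm (\<phi> x) \<le> norm x * K"
    using \<phi>.bounded by blast
  define J where "J x = (norm x)\<^sup>2 - 2 * \<phi> x" for x
  have "J x \<ge> - K\<^sup>2" for x
  proof -
    have "\<phi> x \<le> norm x * K"
      using K[of x] by simp
    moreover have "(norm x - K)\<^sup>2 \<ge> 0" by simp
    ultimately show ?thesis
      unfolding J_def power2_diff by (simp add: algebra_simps)
  qed
  then have bdd: "bdd_below (range J)"
    by (intro bdd_belowI[where m = "- K\<^sup>2"]) auto
  define m where "m = Inf (range J)"
  have m: "m \<le> J x" for x
    unfolding m_def by (rule cInf_lower[OF _ bdd]) simp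
  have "\<exists>x. J x < m + 1 / real (Suc n)" for n
    using cInf_lessD[of "range J" "m + 1 / real (Suc n)"] unfolding m_def by fastforce
  then obtain X where X: "\<And>n. J (X n) < m + 1 / real (Suc n)"
    by metis
  have par: "(norm (x - y))\<^sup>2 = 2 * J x + 2 * J y - 4 * J ((1/2) *\<^sub>R (x + y))" for x y
    unfolding J_def power2_norm_eq_inner \<phi>.scaleR \<phi>.add
    by (simp add: inner_add_left inner_add_right inner_diff_left inner_diff_right
        inner_commute[of y x] algebra_simps)
  have dist: "(norm (X i - X j))\<^sup>2 \<le> 2 / real (Suc i) + 2 / real (Suc j)" for i j
    unfolding par[of "X i" "X j"] using X[of i] X[of j] m[of "(1/2) *\<^sub>R (X i + X j)"] by simp
  have "Cauchy X"
  proof (rule CauchyI)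
    fix e :: real assume "e > 0"
    then obtain N where N: "inverse (real (Suc N)) < e\<^sup>2 / 4"
      using reals_Archimedean[of "e\<^sup>2 / 4"] by auto
    have "norm (X i - X j) < e" if "i \<ge> N" "j \<ge> N" for i j
    proof -
      have "2 / real (Suc i) \<le> 2 / real (Suc N)" "2 / real (Suc j) \<le> 2 / real (Suc N)"
        using that by (simp_all add: frac_le)
      then have "(norm (X i - X j))\<^sup>2 < e\<^sup>2"
        using dist[of i j] N unfolding inverse_eq_divide by linarith
      then show ?thesis
        using \<open>e > 0\<close> power2_less_imp_less less_imp_le by blast
    qed
    then show "\<exists>M. \<forall>i\<ge>M. \<forall>j\<ge>M. norm (X i - X j) < e" by blast
  qed
  then obtain y where y: "X \<longlonglongrightarrow> y"
    by (auto simp: Cauchy_convergent_iff convergent_def)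
  have "(\<lambda>n. J (X n)) \<longlonglongrightarrow> J y"
    unfolding J_def by (intro tendsto_intros y \<phi>.tendsto)
  moreover have "(\<lambda>n. m + 1 / real (Suc n)) \<longlonglongrightarrow> m"
    using LIMSEQ_inverse_real_of_nat_add[of m] unfolding inverse_eq_divide .
  ultimately have "J y \<le> m"
    by (rule LIMSEQ_le) (intro exI[of _ 0] allI impI less_imp_le X)
  have "\<phi> x = inner x y" for x
  proof -
    have "inner x y - \<phi> x = 0"
    proof (rule quadratic_nonneg_imp_zero)
      show "(norm x)\<^sup>2 \<ge> 0" by simp
      fix t :: real
      have "J (y + t *\<^sub>R x) - J y = 2 * t * (inner x y - \<phi> x) + t\<^sup>2 * (norm x)\<^sup>2"
        unfolding J_def power2_norm_eq_inner \<phi>.add \<phi>.scaleR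
        by (simp add: inner_add_left inner_add_right inner_commute[of y x] algebra_simps power2_eq_square)
      then show "0 \<le> 2 * t * (inner x y - \<phi> x) + t\<^sup>2 * (norm x)\<^sup>2"
        using m[of "y + t *\<^sub>R x"] \<open>J y \<le> m\<close> by linarith
    qed
    then show ?thesis by simp
  qed
  then show ?thesis
    using that by blast
qed

text \<open>The Riesz theorem is applied to the real inner product. Complex linearity of
  \<open>T\<close> then gives agreement of imaginary parts as well, because
  \<open>Im (cinner x y)\<close> is minus the real inner product of \<open>\<i> *\<^sub>C x\<close>
  and \<open>y\<close>.\<close>

lemma cadjoint_exists:
  fixes T :: "'a::chilbert_space \<Rightarrow>\<^sub>L 'a"
  assumes "clinear_op T"
  shows "\<exists>S :: 'a \<Rightarrow>\<^sub>L 'a. \<forall>x y. cinner (T x) y = cinner x (S y)"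
proof -
  have "\<exists>z. \<forall>x. inner (T x) y = inner x z" for y
  proof -
    have "bounded_linear (\<lambda>x. inner (T x) y)"
      by (intro bounded_linear_intros)
    then show ?thesis
      by (rule riesz_representation) blast
  qed
  then obtain S where S: "\<And>x y. inner (T x) y = inner x (S y)"
    by metis
  have cS: "cinner (T x) y = cinner x (S y)" for x y
  proof (rule complex_eqI)
    show "Re (cinner (T x) y) = Re (cinner x (S y))"
      by (simp add: Re_cinner S)
    show "Im (cinner (T x) y) = Im (cinner x (S y))"
      using assms unfolding Im_cinner clinear_op_def by (metis S)
  qed
  have "bounded_linear S"
  proof (rule bounded_linear_intro[where K = "norm T"])
    show "S (x + y) = S x + S y" for x y
      by (rule cinner_ext) (simp add: cinner_simps flip: cS)
    show "S (r *\<^sub>R x) = r *\<^sub>R S x" for r x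
      by (rule cinner_ext) (simp add: cinner_simps flip: cS)
    show "norm (S x) \<le> norm x * norm T" for x
    proof -
      have "(norm (S x))\<^sup>2 = inner (T (S x)) x"
        by (simp add: S power2_norm_eq_inner)
      also have "\<dots> \<le> norm (T (S x)) * norm x"
        by (rule norm_cauchy_schwarz)
      also have "\<dots> \<le> norm T * norm (S x) * norm x"
        by (intro mult_right_mono norm_blinfun) simp
      finally show ?thesis
        by (cases "norm (S x) = 0") (simp_all add: power2_eq_square mult_ac)
    qed
  qed
  then have "cinner (T x) y = cinner x (Blinfun S y)" for x y
    by (simp add: bounded_linear_Blinfun_apply cS)
  then show ?thesis by blast
qed

lemma cinner_cadjoint:
  fixes T :: "'a::chilbert_space \<Rightarrow>\<^sub>L 'a"
  assumes "clinear_op T"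
  shows "cinner (T x) y = cinner x (cadjoint T y)"
proof -
  have "\<exists>!S :: 'a \<Rightarrow>\<^sub>L 'a. \<forall>x y. cinner (T x) y = cinner x (S y)"
  proof (rule ex_ex1I[OF cadjoint_exists[OF assms]])
    fix S S' :: "'a \<Rightarrow>\<^sub>L 'a"
    assume "\<forall>x y. cinner (T x) y = cinner x (S y)" "\<forall>x y. cinner (T x) y = cinner x (S' y)"
    then show "S = S'"
      by (intro blinfun_eqI cinner_ext) metis
  qed
  from theI'[OF this] show ?thesis
    unfolding cadjoint_def by blast
qed

lemma cinner_cadjoint':
  fixes T :: "'a::chilbert_space \<Rightarrow>\<^sub>L 'a"
  assumes "clinear_op T"
  shows "cinner (cadjoint T x) y = cinner x (T y)"
  by (metis assms cinner_cadjoint cinner_commute)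

lemma clinear_op_cadjoint: "clinear_op T \<Longrightarrow> clinear_op (cadjoint T)"
  unfolding clinear_op_def[of "cadjoint T"]
  by (intro allI cinner_ext) (simp add: cinner_scaleC_right flip: cinner_cadjoint)

lemma norm_cadjoint_le: "clinear_op T \<Longrightarrow> norm (cadjoint T) \<le> norm (T::'a::chilbert_space \<Rightarrow>\<^sub>L 'a)"
proof (rule norm_blinfun_bound)
  assume T: "clinear_op T"
  fix x :: 'a
  have "(norm (cadjoint T x))\<^sup>2 = Re (cinner (T (cadjoint T x)) x)"
    by (simp add: cinner_cadjoint[OF T] cinner_self)
  also have "\<dots> \<le> norm (T (cadjoint T x)) * norm x"
    using complex_Re_le_cmod cmod_cinner_le order_trans by blast
  also have "\<dots> \<le> norm T * norm (cadjoint T x) * norm x"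
    by (intro mult_right_mono norm_blinfun) simp
  finally show "norm (cadjoint T x) \<le> norm T * norm x"
    by (cases "norm (cadjoint T x) = 0") (simp_all add: power2_eq_square mult_ac)
qed simp

section \<open>Complex-linear bounded operators\<close>

lemma clinear_opD: "clinear_op T \<Longrightarrow> T (c *\<^sub>C x) = c *\<^sub>C T x"
  by (simp add: clinear_op_def)

lemma clinear_op_sum:
  "clinear_op T \<Longrightarrow> T (\<Sum>i\<in>I. c i *\<^sub>C f i) = (\<Sum>i\<in>I. c i *\<^sub>C T (f i))"
  by (simp add: blinfun.sum_right clinear_opD)

lemma clinear_op_compose: "clinear_op T \<Longrightarrow> clinear_op U \<Longrightarrow> clinear_op (T o\<^sub>L U)"
  by (simp add: clinear_op_def)

lemma clinear_op_id: "clinear_op id_blinfun"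
  by (simp add: clinear_op_def)

lemma clinear_op_zero: "clinear_op 0"
  by (simp add: clinear_op_def)

lemma clinear_op_add: "clinear_op T \<Longrightarrow> clinear_op U \<Longrightarrow> clinear_op (T + U)"
  by (simp add: clinear_op_def blinfun.add_left scaleC_add_right)

lemma clinear_op_diff: "clinear_op T \<Longrightarrow> clinear_op U \<Longrightarrow> clinear_op (T - U)"
  by (simp add: clinear_op_def blinfun.diff_left scaleC_diff_right)

lemma clinear_op_scaleR: "clinear_op T \<Longrightarrow> clinear_op (r *\<^sub>R T)"
  by (simp add: clinear_op_def blinfun.scaleR_left scaleC_scaleR_commute)

lemma clinear_op_scaleC: "clinear_op T \<Longrightarrow> clinear_op (scaleC_op c T)"
  by (simp add: clinear_op_def scaleC_op.rep_eq scaleC_scaleC mult.commute)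

lemmas clinear_intros = clinear_op_compose clinear_op_id clinear_op_zero clinear_op_add
  clinear_op_diff clinear_op_scaleR clinear_op_scaleC clinear_op_cadjoint

lemma tendsto_blinfun_apply': "(f \<longlongrightarrow> T) F \<Longrightarrow> ((\<lambda>n. blinfun_apply (f n) x) \<longlongrightarrow> T x) F"
  by (intro blinfun.tendsto tendsto_const)

lemma clinear_op_LIMSEQ:
  assumes "\<And>n. clinear_op (Y n)" and "Y \<longlonglongrightarrow> Z"
  shows "clinear_op Z"
  unfolding clinear_op_def
proof (intro allI)
  fix c x
  have "(\<lambda>n. Y n (c *\<^sub>C x)) \<longlonglongrightarrow> Z (c *\<^sub>C x)"
    by (intro tendsto_blinfun_apply' assms)
  moreover have "(\<lambda>n. c *\<^sub>C Y n x) \<longlonglongrightarrow> c *\<^sub>C Z x"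
    by (intro bounded_linear.tendsto[OF bounded_linear_scaleC] tendsto_blinfun_apply' assms)
  ultimately show "Z (c *\<^sub>C x) = c *\<^sub>C Z x"
    using LIMSEQ_unique assms(1) by (fastforce simp: clinear_op_def)
qed

section \<open>Positive operators and their square roots\<close>

lemma positive_op_clinear: "positive_op P \<Longrightarrow> clinear_op P"
  by (simp add: positive_op_def)

lemma positive_op_nonneg: "positive_op P \<Longrightarrow> 0 \<le> Re (cinner (P x) x)"
  unfolding positive_op_def by (metis complex_nonneg_Reals_iff)

text \<open>Polarization: a sesquilinear form that is real on the diagonal is Hermitian, as testing
  on \<open>x + y\<close> and \<open>x + \<i> *\<^sub>C y\<close> shows.\<close>

lemma positive_op_self_adjoint:
  assumes "positive_op P"
  shows "cinner (P x) y = cinner x (P y)"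
proof -
  have im: "Im (cinner (P z) z) = 0" for z
    using assms unfolding positive_op_def by (metis complex_nonneg_Reals_iff)
  note cl = clinear_opD[OF positive_op_clinear[OF assms]]
  have "Im (cinner (P x) y) = - Im (cinner (P y) x)"
    using im[of "x + y"] im[of x] im[of y] by (simp add: blinfun.add_right cinner_simps)
  moreover have "Re (cinner (P x) y) = Re (cinner (P y) x)"
    using im[of "x + \<i> *\<^sub>C y"] im[of x] im[of y] by (simp add: blinfun.add_right cinner_simps cl)
  ultimately have "cinner (P x) y = cnj (cinner (P y) x)"
    by (simp add: complex_eq_iff)
  then show ?thesis
    using cinner_commute by metis
qed

lemma positive_opI:
  assumes "clinear_op P" "\<And>x y. cinner (P x) y = cinner x (P y)" "\<And>x. 0 \<le> Re (cinner (P x) x)"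
  shows "positive_op P"
  unfolding positive_op_def
proof (intro conjI allI assms(1))
  fix x
  have "cinner (P x) x = cnj (cinner (P x) x)"
    using assms(2) cinner_commute by metis
  then have "Im (cinner (P x) x) = 0"
    by (simp add: complex_eq_iff)
  then show "cinner (P x) x \<in> \<real>\<^sub>\<ge>\<^sub>0"
    using assms(3) by (simp add: complex_nonneg_Reals_iff)
qed

text \<open>The degenerate case of the Cauchy-Schwarz inequality for the form of \<open>P\<close>:
  moving from \<open>x\<close> in the direction \<open>P x\<close> changes the form to first order
  by \<open>2 * t * (norm (P x))^2\<close>, which positivity forbids unless it vanishes.\<close>

lemma positive_op_eq_zero:
  assumes "positive_op P" "Re (cinner (P x) x) = 0"
  shows "P x = 0"
proof -
  have "(norm (P x))\<^sup>2 = 0"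
  proof (rule quadratic_nonneg_imp_zero)
    show "0 \<le> Re (cinner (P (P x)) (P x))"
      by (rule positive_op_nonneg[OF assms(1)])
    fix t :: real
    have "cinner (P (P x)) x = of_real ((norm (P x))\<^sup>2)"
      using positive_op_self_adjoint[OF assms(1)] by (metis cinner_self)
    then have "Re (cinner (P (x + t *\<^sub>R P x)) (x + t *\<^sub>R P x))
      = 2 * t * (norm (P x))\<^sup>2 + t\<^sup>2 * Re (cinner (P (P x)) (P x))"
      using assms(2)
      by (simp add: blinfun.add_right blinfun.scaleR_right cinner_simps cinner_self power2_eq_square algebra_simps)
    then show "0 \<le> 2 * t * (norm (P x))\<^sup>2 + t\<^sup>2 * Re (cinner (P (P x)) (P x))"
      using positive_op_nonneg[OF assms(1), of "x + t *\<^sub>R P x"] by simp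
  qed
  then show ?thesis by simp
qed

text \<open>The square root of \<open>1 - B\<close> is \<open>1 - Z\<close>, where \<open>Z\<close> is the limit of the iteration
  \<open>Y \<mapsto> (B + Y\<^sup>2) / 2\<close>.  This converges in norm, because it is dominated by the scalar
  iteration for \<open>B = 1\<close>.\<close>

lemma half_square_iteration:
  fixes B :: "'a::chilbert_space \<Rightarrow>\<^sub>L 'a"
  assumes "norm B \<le> 1"
  defines "Y \<equiv> rec_nat 0 (\<lambda>_ Y. (1/2) *\<^sub>R (B + (Y o\<^sub>L Y)))"
  obtains Z where "Y \<longlonglongrightarrow> Z" "norm Z \<le> 1" "Z = (1/2) *\<^sub>R (B + (Z o\<^sub>L Z))"
proof -
  have Y0: "Y 0 = 0" and YS: "\<And>n. Y (Suc n) = (1/2) *\<^sub>R (B + (Y n o\<^sub>L Y n))"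
    by (simp_all add: Y_def)
  define y :: "nat \<Rightarrow> real" where "y = rec_nat 0 (\<lambda>_ y. (1/2) * (1 + y * y))"
  have y0: "y 0 = 0" and yS: "\<And>n. y (Suc n) = (1/2) * (1 + y n * y n)"
    by (simp_all add: y_def)
  have y_bounds: "0 \<le> y n \<and> y n \<le> 1" for n
  proof (induction n)
    case (Suc n)
    then have "y n * y n \<le> 1 * 1"
      by (intro mult_mono) auto
    then show ?case
      using Suc by (simp add: yS)
  qed (simp add: y0)
  have y_le: "y n \<le> y (Suc n)" for n
  proof -
    have "(1 - y n)\<^sup>2 \<ge> 0" by simp
    then show ?thesis
      unfolding yS power2_diff by (simp add: power2_eq_square)
  qed
  have normY: "norm (Y n) \<le> y n" for n
  proof (induction n)
    case (Suc n)
    have "norm (Y n o\<^sub>L Y n) \<le> norm (Y n) * norm (Y n)"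
      by (rule norm_blinfun_compose)
    also have "\<dots> \<le> y n * y n"
      using Suc y_bounds[of n] by (intro mult_mono) auto
    finally have "norm (B + (Y n o\<^sub>L Y n)) \<le> 1 + y n * y n"
      using assms(1) norm_triangle_mono by blast
    then show ?case
      by (simp add: YS yS)
  qed (simp add: Y0 y0)
  have step: "norm (Y (Suc n) - Y n) \<le> y (Suc n) - y n" for n
  proof (induction n)
    case 0
    then show ?case
      using assms(1) by (simp add: YS yS Y0 y0)
  next
    case (Suc n)
    let ?a = "Y (Suc n)" and ?b = "Y n"
    \<comment> \<open>The noncommutative form a (a - b) + (a - b) b of a^2 - b^2. The same identity
      for the scalars \<open>y\<close> turns the estimate into the scalar increment.\<close>
    have "Y (Suc (Suc n)) - Y (Suc n) = (1/2) *\<^sub>R ((?a o\<^sub>L (?a - ?b)) + ((?a - ?b) o\<^sub>L ?b))"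
      by (subst YS, subst (2) YS) (rule blinfun_eqI, simp add: blinfun.bilinear_simps algebra_simps)
    then have "norm (Y (Suc (Suc n)) - Y (Suc n)) \<le> (1/2) * (norm (?a o\<^sub>L (?a - ?b)) + norm ((?a - ?b) o\<^sub>L ?b))"
      by (simp add: norm_triangle_ineq)
    also have "\<dots> \<le> (1/2) * (norm ?a * norm (?a - ?b) + norm (?a - ?b) * norm ?b)"
      by (intro mult_left_mono add_mono norm_blinfun_compose) simp
    also have "\<dots> \<le> (1/2) * (y (Suc n) * (y (Suc n) - y n) + (y (Suc n) - y n) * y n)"
      using Suc y_bounds[of n] y_bounds[of "Suc n"] y_le[of n]
      by (intro mult_left_mono add_mono mult_mono normY) auto
    also have "\<dots> = y (Suc (Suc n)) - y (Suc n)"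
      by (subst yS[of "Suc n"], subst (5) yS) (simp add: algebra_simps)
    finally show ?case .
  qed
  have diff: "norm (Y (m + k) - Y m) \<le> y (m + k) - y m" for m k
  proof (induction k)
    case (Suc k)
    have "norm (Y (m + Suc k) - Y m) \<le> norm (Y (Suc (m + k)) - Y (m + k)) + norm (Y (m + k) - Y m)"
      using norm_triangle_ineq[of "Y (Suc (m + k)) - Y (m + k)" "Y (m + k) - Y m"] by simp
    then show ?case
      using Suc step[of "m + k"] by simp
  qed simp
  have "incseq y"
    by (rule incseq_SucI) (rule y_le)
  then obtain l where l: "y \<longlonglongrightarrow> l"
    using incseq_convergent[of y 1] y_bounds by blast
  have yl: "y n \<le> l" for n
    by (rule incseq_le[OF \<open>incseq y\<close> l])
  have "Cauchy Y"
  proof (rule CauchyI)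
    fix e :: real assume "e > 0"
    then obtain N where "\<forall>n\<ge>N. norm (y n - l) < e / 2"
      using l LIMSEQ_D half_gt_zero by blast
    then have N: "l - y N < e / 2"
      by (auto simp: abs_if split: if_splits)
    have near: "norm (Y i - Y N) < e / 2" if "i \<ge> N" for i
      using diff[of N "i - N"] that N yl[of i] by simp
    have "norm (Y i - Y j) < e" if "i \<ge> N" "j \<ge> N" for i j
      using norm_triangle_ineq4[of "Y i - Y N" "Y j - Y N"] near[of i] near[of j] that by simp
    then show "\<exists>M. \<forall>i\<ge>M. \<forall>j\<ge>M. norm (Y i - Y j) < e" by blast
  qed
  then obtain Z where Z: "Y \<longlonglongrightarrow> Z"
    by (auto simp: Cauchy_convergent_iff convergent_def)
  have "norm Z \<le> 1"
    using tendsto_norm[OF Z] normY y_bounds order_trans by (meson LIMSEQ_le_const2)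
  moreover have "(\<lambda>n. Y (Suc n)) \<longlonglongrightarrow> (1/2) *\<^sub>R (B + (Z o\<^sub>L Z))"
    unfolding YS by (intro tendsto_intros bounded_bilinear.tendsto[OF bounded_bilinear_blinfun_compose] Z)
  then have "Z = (1/2) *\<^sub>R (B + (Z o\<^sub>L Z))"
    using LIMSEQ_unique LIMSEQ_Suc[OF Z] by blast
  ultimately show ?thesis
    using Z that by blast
qed

lemma positive_op_complement:
  fixes P :: "'a::chilbert_space \<Rightarrow>\<^sub>L 'a"
  assumes P: "positive_op P" and M: "M > 0" "norm P \<le> M"
  defines "B \<equiv> id_blinfun - (1 / M) *\<^sub>R P"
  shows "positive_op B" "norm B \<le> 1"
proof -
  note sa = positive_op_self_adjoint[OF P]
  have clB: "clinear_op B"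
    unfolding B_def by (intro clinear_intros positive_op_clinear P)
  have saB: "cinner (B x) y = cinner x (B y)" for x y
    by (simp add: B_def blinfun.diff_left blinfun.scaleR_left cinner_simps sa)
  have B0: "0 \<le> Re (cinner (B x) x)" and B1: "Re (cinner (B x) x) \<le> (norm x)\<^sup>2" for x
  proof -
    have "Re (cinner (P x) x) \<le> norm (P x) * norm x"
      using complex_Re_le_cmod cmod_cinner_le order_trans by blast
    also have "\<dots> \<le> M * norm x * norm x"
      by (meson M(2) mult_right_mono norm_blinfun norm_ge_zero order_trans)
    finally have "Re (cinner (P x) x) / M \<le> (norm x)\<^sup>2"
      using M by (simp add: divide_simps power2_eq_square mult_ac)
    then show "0 \<le> Re (cinner (B x) x)"
      by (simp add: B_def blinfun.diff_left blinfun.scaleR_left cinner_simps cinner_self)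
    show "Re (cinner (B x) x) \<le> (norm x)\<^sup>2"
      using divide_nonneg_pos[OF positive_op_nonneg[OF P, of x] M(1)]
      by (simp add: B_def blinfun.diff_left blinfun.scaleR_left cinner_simps cinner_self)
  qed
  show "positive_op B"
    using clB saB B0 by (rule positive_opI)
  show "norm B \<le> 1"
  proof (rule norm_blinfun_bound)
    fix x
    have BB: "cinner (B (B x)) x = of_real ((norm (B x))\<^sup>2)"
      using saB by (metis cinner_self)
    \<comment> \<open>Positivity is tested at \<open>x - B x\<close> because the cross terms produce
      \<open>- 2 * (norm (B x))^2\<close>, while \<open>B1\<close> controls the two remaining
      terms.\<close>
    have "0 \<le> Re (cinner (B (x - B x)) (x - B x))"
      by (rule B0)
    also have "\<dots> = Re (cinner (B x) x) - 2 * (norm (B x))\<^sup>2 + Re (cinner (B (B x)) (B x))"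
      using BB by (simp add: blinfun.diff_right cinner_simps cinner_self)
    finally have "(norm (B x))\<^sup>2 \<le> (norm x)\<^sup>2"
      using B1[of x] B1[of "B x"] by linarith
    then show "norm (B x) \<le> 1 * norm x"
      unfolding mult_1 by (rule power2_le_imp_le) simp
  qed simp
qed

text \<open>The fixed point equation \<open>2 Z = B + Z^2\<close> says that
  \<open>(1 - Z)^2 = 1 - B = P / M\<close>. All iterates are polynomials in \<open>P\<close>, so the
  root commutes with everything that commutes with \<open>P\<close>; uniqueness rests on
  this.\<close>

lemma positive_op_sqrt:
  fixes P :: "'a::chilbert_space \<Rightarrow>\<^sub>L 'a"
  assumes "positive_op P"
  obtains R where "positive_op R" "R o\<^sub>L R = P"
    "\<And>T. T o\<^sub>L P = P o\<^sub>L T \<Longrightarrow> T o\<^sub>L R = R o\<^sub>L T"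
proof -
  define M where "M = norm P + 1"
  have M: "M > 0" "norm P \<le> M"
    by (simp_all add: M_def add_nonneg_pos)
  define B where "B = id_blinfun - (1 / M) *\<^sub>R P"
  have B: "positive_op B" "norm B \<le> 1"
    unfolding B_def by (intro positive_op_complement assms M)+
  note clB = positive_op_clinear[OF B(1)] and saB = positive_op_self_adjoint[OF B(1)]
  define Y where "Y = rec_nat 0 (\<lambda>_ Y. (1/2) *\<^sub>R (B + (Y o\<^sub>L Y)))"
  have Y0: "Y 0 = 0" and YS: "\<And>n. Y (Suc n) = (1/2) *\<^sub>R (B + (Y n o\<^sub>L Y n))"
    by (simp_all add: Y_def)
  obtain Z where Z: "Y \<longlonglongrightarrow> Z" "norm Z \<le> 1" "Z = (1/2) *\<^sub>R (B + (Z o\<^sub>L Z))"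
    using half_square_iteration[OF B(2)] unfolding Y_def by blast
  have "clinear_op (Y n)" for n
    by (induction n) (simp_all add: Y0 YS clinear_intros clB)
  then have clZ: "clinear_op Z"
    using Z(1) clinear_op_LIMSEQ by blast
  have saY: "cinner (Y n x) y = cinner x (Y n y)" for n x y
    by (induction n arbitrary: x y)
      (simp_all add: Y0 YS blinfun.add_left blinfun.scaleR_left cinner_simps saB)
  have saZ: "cinner (Z x) y = cinner x (Z y)" for x y
  proof -
    have "(\<lambda>n. cinner (Y n x) y) \<longlonglongrightarrow> cinner (Z x) y" "(\<lambda>n. cinner x (Y n y)) \<longlonglongrightarrow> cinner x (Z y)"
      by (intro tendsto_cinner tendsto_const tendsto_blinfun_apply' Z)+
    then show ?thesis
      using LIMSEQ_unique saY by fastforce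
  qed
  define R where "R = sqrt M *\<^sub>R (id_blinfun - Z)"
  have "positive_op R"
  proof (rule positive_opI)
    show "clinear_op R"
      unfolding R_def by (intro clinear_intros clZ)
    show "cinner (R x) y = cinner x (R y)" for x y
      by (simp add: R_def blinfun.diff_left blinfun.scaleR_left cinner_simps saZ)
    fix x
    have "Re (cinner (Z x) x) \<le> norm (Z x) * norm x"
      using complex_Re_le_cmod cmod_cinner_le order_trans by blast
    also have "\<dots> \<le> 1 * norm x * norm x"
      by (meson Z(2) mult_right_mono norm_blinfun norm_ge_zero order_trans)
    finally have "Re (cinner (Z x) x) \<le> (norm x)\<^sup>2"
      by (simp add: power2_eq_square)
    then show "0 \<le> Re (cinner (R x) x)"
      using M by (simp add: R_def blinfun.diff_left blinfun.scaleR_left cinner_simps cinner_self)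
  qed
  moreover have "R o\<^sub>L R = P"
  proof (rule blinfun_eqI)
    fix x
    have "Z x = (1/2) *\<^sub>R (B x + Z (Z x))"
      by (subst Z(3)) (simp add: blinfun.scaleR_left blinfun.add_left)
    then have "2 *\<^sub>R Z x = 2 *\<^sub>R ((1/2) *\<^sub>R (B x + Z (Z x)))"
      by (rule arg_cong)
    then have ZZ: "Z (Z x) = 2 *\<^sub>R Z x - B x"
      by simp
    have "(R o\<^sub>L R) x = M *\<^sub>R (x - Z x - (Z x - Z (Z x)))"
      using M by (simp add: R_def blinfun.bilinear_simps scaleR_diff_right flip: power2_eq_square)
    also have "\<dots> = M *\<^sub>R (x - B x)"
      unfolding ZZ by (simp add: scaleR_2)
    also have "\<dots> = P x"
      using M by (simp add: B_def blinfun.bilinear_simps)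
    finally show "(R o\<^sub>L R) x = P x" .
  qed
  moreover have "T o\<^sub>L R = R o\<^sub>L T" if "T o\<^sub>L P = P o\<^sub>L T" for T
  proof -
    have TP: "T (P x) = P (T x)" for x
      using that by (metis blinfun_apply_blinfun_compose)
    have TY: "T (Y n x) = Y n (T x)" for n x
      by (induction n arbitrary: x) (simp_all add: Y0 YS B_def blinfun.bilinear_simps TP)
    have "T (Z x) = Z (T x)" for x
    proof -
      have "(\<lambda>n. T (Y n x)) \<longlonglongrightarrow> T (Z x)"
        by (intro blinfun.tendsto tendsto_const tendsto_blinfun_apply' Z)
      moreover have "(\<lambda>n. Y n (T x)) \<longlonglongrightarrow> Z (T x)"
        by (intro tendsto_blinfun_apply' Z)
      ultimately show ?thesis
        using LIMSEQ_unique TY by fastforce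
    qed
    then show ?thesis
      by (intro blinfun_eqI) (simp add: R_def blinfun.bilinear_simps)
  qed
  ultimately show ?thesis
    using that by blast
qed

text \<open>Any root \<open>S\<close> commutes with \<open>P = S^2\<close>, hence with the
  constructed root \<open>R\<close>, so \<open>S + R\<close> annihilates
  \<open>y = S x - R x\<close>. Both operators being positive, each annihilates \<open>y\<close>,
  and then \<open>cinner y y\<close> vanishes by self-adjointness.\<close>

lemma positive_op_sqrt_unique:
  fixes S S' :: "'a::chilbert_space \<Rightarrow>\<^sub>L 'a"
  assumes "positive_op P" "positive_op S" "S o\<^sub>L S = P" "positive_op S'" "S' o\<^sub>L S' = P"
  shows "S = S'"
proof -
  obtain R where R: "positive_op R" "R o\<^sub>L R = P" "\<And>T. T o\<^sub>L P = P o\<^sub>L T \<Longrightarrow> T o\<^sub>L R = R o\<^sub>L T"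
    using positive_op_sqrt[OF assms(1)] by blast
  have "S = R" if S: "positive_op S" "S o\<^sub>L S = P" for S :: "'a \<Rightarrow>\<^sub>L 'a"
  proof (rule blinfun_eqI)
    fix x
    have SS: "S (S z) = P z" and RR: "R (R z) = P z" for z
      using S(2) R(2) by (metis blinfun_apply_blinfun_compose)+
    have "S o\<^sub>L P = P o\<^sub>L S"
      by (rule blinfun_eqI) (simp flip: SS)
    then have SR: "S (R z) = R (S z)" for z
      using R(3) by (metis blinfun_apply_blinfun_compose)
    define y where "y = S x - R x"
    have "S y + R y = 0"
      by (simp add: y_def blinfun.diff_right SS RR SR)
    then have "Re (cinner (S y) y) + Re (cinner (R y) y) = 0"
      by (metis cinner_add_left cinner_zero_left plus_complex.simps(1) zero_complex.simps(1))
    then have "Re (cinner (S y) y) = 0" "Re (cinner (R y) y) = 0"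
      using positive_op_nonneg[OF S(1), of y] positive_op_nonneg[OF R(1), of y] by linarith+
    then have "S y = 0" "R y = 0"
      using positive_op_eq_zero S(1) R(1) by blast+
    moreover have "cinner y y = cinner x (S y) - cinner x (R y)"
      by (metis y_def cinner_diff_left positive_op_self_adjoint[OF S(1)] positive_op_self_adjoint[OF R(1)])
    ultimately have "cinner y y = 0"
      by simp
    then show "S x = R x"
      by (simp add: y_def cinner_self)
  qed
  then show ?thesis
    using assms by metis
qed

section \<open>Absolute value of an operator\<close>

lemma positive_op_cadjoint_compose:
  assumes "clinear_op T"
  shows "positive_op (cadjoint T o\<^sub>L T)"
proof (rule positive_opI)
  show "cinner ((cadjoint T o\<^sub>L T) x) y = cinner x ((cadjoint T o\<^sub>L T) y)" for x y
    using cinner_cadjoint[OF assms, of x "T y"] cinner_cadjoint'[OF assms, of "T x" y] by simp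
  show "0 \<le> Re (cinner ((cadjoint T o\<^sub>L T) x) x)" for x
    using cinner_cadjoint'[OF assms, of "T x" x] by (simp add: cinner_self)
qed (intro clinear_intros assms)

lemma abs_op:
  assumes "clinear_op T"
  shows "positive_op (abs_op T)" "abs_op T o\<^sub>L abs_op T = cadjoint T o\<^sub>L T"
proof -
  note pos = positive_op_cadjoint_compose[OF assms]
  have "\<exists>!S. positive_op S \<and> S o\<^sub>L S = cadjoint T o\<^sub>L T"
    using positive_op_sqrt[OF pos] positive_op_sqrt_unique[OF pos] by metis
  from theI'[OF this] show "positive_op (abs_op T)" "abs_op T o\<^sub>L abs_op T = cadjoint T o\<^sub>L T"
    unfolding abs_op_def by auto
qed

lemma cinner_abs_op:
  assumes "clinear_op T"
  shows "cinner (abs_op T x) (abs_op T y) = cinner (T x) (T y)"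
proof -
  have "cinner (abs_op T x) (abs_op T y) = cinner x (abs_op T (abs_op T y))"
    by (rule positive_op_self_adjoint[OF abs_op(1)[OF assms]])
  also have "abs_op T (abs_op T y) = cadjoint T (T y)"
    using abs_op(2)[OF assms] by (metis blinfun_apply_blinfun_compose)
  finally show ?thesis
    by (simp add: cinner_cadjoint assms)
qed

lemma norm_abs_op: "clinear_op T \<Longrightarrow> norm (abs_op T x) = norm (T x)"
  using cinner_abs_op[of T x x] unfolding cinner_self of_real_eq_iff
  by (simp add: power2_eq_iff_nonneg)

section \<open>Trace class operators\<close>

definition orthonormal :: "'a::chilbert_space set \<Rightarrow> bool" where
  "orthonormal F \<longleftrightarrow> (\<forall>e\<in>F. \<forall>f\<in>F. cinner e f = (if e = f then 1 else 0))"

text \<open>For a finite orthonormal \<open>F\<close> this is the orthogonal projection onto the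
  span, and \<open>proj F x = x\<close> is the way in which membership in that span is expressed
  throughout.\<close>

definition proj :: "'a::chilbert_space set \<Rightarrow> 'a \<Rightarrow> 'a" where
  "proj F x = (\<Sum>e\<in>F. cinner x e *\<^sub>C e)"

lemma orthonormalD: "orthonormal F \<Longrightarrow> e \<in> F \<Longrightarrow> f \<in> F \<Longrightarrow> cinner e f = (if e = f then 1 else 0)"
  by (simp add: orthonormal_def)

lemma orthonormal_mono: "orthonormal F \<Longrightarrow> G \<subseteq> F \<Longrightarrow> orthonormal G"
  unfolding orthonormal_def by (meson subsetD)

lemma orthonormal_norm: "orthonormal F \<Longrightarrow> e \<in> F \<Longrightarrow> norm e = 1"
proof -
  assume "orthonormal F" "e \<in> F"
  then have "complex_of_real ((norm e)\<^sup>2) = 1"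
    using orthonormalD[of F e e] by (simp add: cinner_self)
  then have "(norm e)\<^sup>2 = 1"
    by (simp only: of_real_eq_1_iff)
  then show "norm e = 1"
    using norm_ge_zero[of e] by (simp add: power2_eq_1_iff)
qed

lemma orthonormal_basis_orthonormal: "orthonormal_basis E \<Longrightarrow> orthonormal E"
  by (simp add: orthonormal_basis_def orthonormal_def)

lemma proj_add: "proj F (x + y) = proj F x + proj F y"
  by (simp add: proj_def cinner_add_left scaleC_add_left sum.distrib)

lemma proj_diff: "proj F (x - y) = proj F x - proj F y"
  by (simp add: proj_def cinner_diff_left scaleC_diff_left sum_subtractf)

lemma proj_scaleC: "proj F (c *\<^sub>C x) = c *\<^sub>C proj F x"
  by (simp add: proj_def cinner_scaleC_left scaleC_scaleC scaleC_sum_right)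

lemma proj_scaleR: "proj F (r *\<^sub>R x) = r *\<^sub>R proj F x"
  by (metis proj_scaleC scaleC_of_real)

lemma proj_sum: "proj F (\<Sum>i\<in>I. f i) = (\<Sum>i\<in>I. proj F (f i))"
  by (induction I rule: infinite_finite_induct) (simp_all add: proj_add, simp_all add: proj_def)

lemma cinner_proj:
  assumes "finite F" "orthonormal F" "e \<in> F"
  shows "cinner (proj F x) e = cinner x e"
proof -
  have "cinner (proj F x) e = (\<Sum>f\<in>F. if f = e then cinner x f else 0)"
    unfolding proj_def cinner_sum_left
    by (intro sum.cong refl) (simp add: cinner_scaleC_left orthonormalD[OF assms(2) _ assms(3)])
  then show ?thesis
    using assms by simp
qed

lemma cinner_diff_proj:
  assumes "finite F" "orthonormal F"
  shows "cinner (x - proj F x) (proj F y) = 0"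
  unfolding proj_def[of F y] cinner_sum_right
  by (intro sum.neutral) (simp add: cinner_scaleC_right cinner_diff_left cinner_proj[OF assms])

lemma proj_idem:
  assumes "finite F" "orthonormal F"
  shows "proj F (proj F x) = proj F x"
proof -
  have "proj F (proj F x) = (\<Sum>e\<in>F. cinner (proj F x) e *\<^sub>C e)"
    by (rule proj_def)
  also have "\<dots> = proj F x"
    unfolding proj_def[of F x, symmetric] by (subst (2) proj_def) (intro sum.cong refl, simp add: cinner_proj[OF assms])
  finally show ?thesis .
qed

lemma proj_in: "finite F \<Longrightarrow> orthonormal F \<Longrightarrow> e \<in> F \<Longrightarrow> proj F e = e"
proof -
  assume F: "finite F" "orthonormal F" "e \<in> F"
  have "proj F e = (\<Sum>f\<in>F. (if f = e then e else 0))"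
    unfolding proj_def by (intro sum.cong refl) (simp add: orthonormalD[OF F(2) F(3)])
  then show ?thesis
    using F by simp
qed

lemma norm_proj:
  assumes "finite F" "orthonormal F"
  shows "(norm (proj F x))\<^sup>2 = (\<Sum>e\<in>F. (cmod (cinner x e))\<^sup>2)"
proof -
  have "complex_of_real ((norm (proj F x))\<^sup>2) = cinner (proj F x) (proj F x)"
    by (rule cinner_self[symmetric])
  also have "\<dots> = cinner x (proj F x)"
    using cinner_diff_proj[OF assms, of x x] by (simp add: cinner_diff_left)
  also have "\<dots> = (\<Sum>e\<in>F. cnj (cinner x e) * cinner x e)"
    by (simp add: proj_def[of F x] cinner_sum_right cinner_scaleC_right)
  also have "\<dots> = complex_of_real (\<Sum>e\<in>F. (cmod (cinner x e))\<^sup>2)"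
    unfolding of_real_sum by (intro sum.cong refl) (simp add: complex_norm_square mult.commute del: of_real_power)
  finally show ?thesis
    unfolding of_real_eq_iff .
qed

lemma norm_diff_proj:
  assumes "finite F" "orthonormal F"
  shows "(norm (x - proj F x))\<^sup>2 = (norm x)\<^sup>2 - (\<Sum>e\<in>F. (cmod (cinner x e))\<^sup>2)"
proof -
  have "complex_of_real ((norm x)\<^sup>2) = cinner ((x - proj F x) + proj F x) ((x - proj F x) + proj F x)"
    by (simp add: cinner_self)
  also have "\<dots> = cinner (x - proj F x) (x - proj F x) + cinner (proj F x) (proj F x)"
    using cinner_diff_proj[OF assms, of x x] cinner_commute[of "proj F x" "x - proj F x"]
    unfolding cinner_add_left cinner_add_right by simp
  finally show ?thesis
    unfolding cinner_self norm_proj[OF assms] by (simp only: of_real_add[symmetric] of_real_eq_iff)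
qed

lemma bessel:
  assumes "finite F" "orthonormal F"
  shows "(\<Sum>e\<in>F. (cmod (cinner x e))\<^sup>2) \<le> (norm x)\<^sup>2"
  using norm_diff_proj[OF assms, of x] zero_le_power2[of "norm (x - proj F x)"] by linarith

lemma norm_proj_le:
  assumes "finite F" "orthonormal F"
  shows "norm (proj F x) \<le> norm x"
  by (rule power2_le_imp_le) (simp_all add: norm_proj bessel assms)

lemma norm_diff_proj_le:
  assumes "finite F" "orthonormal F" "proj F v = v"
  shows "norm (x - proj F x) \<le> norm (x - v)"
proof -
  have "x - proj F x = (x - v) - proj F (x - v)"
    by (simp add: proj_diff assms)
  moreover have "(norm ((x - v) - proj F (x - v)))\<^sup>2 \<le> (norm (x - v))\<^sup>2"
    unfolding norm_diff_proj[OF assms(1,2)] by (simp add: sum_nonneg)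
  ultimately show ?thesis
    by (metis norm_ge_zero power2_le_imp_le)
qed

lemma proj_union_diff:
  assumes "finite F" "finite G" "orthonormal (F \<union> G)"
  shows "(norm (proj (F \<union> G) x - proj F x))\<^sup>2
    = (\<Sum>e\<in>F \<union> G. (cmod (cinner x e))\<^sup>2) - (\<Sum>e\<in>F. (cmod (cinner x e))\<^sup>2)"
proof -
  have un: "F \<union> G = F \<union> (G - F)"
    by blast
  have "proj (F \<union> G) x - proj F x = proj (G - F) x"
    unfolding proj_def by (subst un, subst sum.union_disjoint) (use assms in auto)
  moreover have "orthonormal (G - F)"
    using assms(3) by (rule orthonormal_mono) blast
  moreover have "(\<Sum>e\<in>F \<union> G. (cmod (cinner x e))\<^sup>2)
      = (\<Sum>e\<in>F. (cmod (cinner x e))\<^sup>2) + (\<Sum>e\<in>G - F. (cmod (cinner x e))\<^sup>2)"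
    by (subst un, subst sum.union_disjoint) (use assms in auto)
  ultimately show ?thesis
    using assms norm_proj[of "G - F" x] by simp
qed

text \<open>A basis is given as an orthonormal set with trivial orthogonal complement, so
  completeness is the point. Projections onto finite subsets that nearly exhaust the sum of squared
  coefficients form a Cauchy sequence; its limit differs from \<open>x\<close> by a vector
  orthogonal to \<open>E\<close>, that is, by zero.\<close>

lemma parseval:
  fixes E :: "'a::chilbert_space set"
  assumes "orthonormal_basis E"
  shows "((\<lambda>e. (cmod (cinner x e))\<^sup>2) has_sum (norm x)\<^sup>2) E"
proof -
  define a where "a e = (cmod (cinner x e))\<^sup>2" for e
  note on = orthonormal_basis_orthonormal[OF assms]
  have fin_le: "sum a F \<le> (norm x)\<^sup>2" if "finite F" "F \<subseteq> E" for F
    unfolding a_def using that on orthonormal_mono bessel by blast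
  have sm: "a summable_on E"
    by (rule nonneg_bdd_above_summable_on) (auto simp: a_def intro!: bdd_aboveI2 fin_le[unfolded a_def])
  define s where "s = infsum a E"
  have le_s: "sum a F \<le> s" if "finite F" "F \<subseteq> E" for F
    unfolding s_def using that by (intro finite_sum_le_infsum sm) (auto simp: a_def)
  \<comment> \<open>The defect is a square because it will bound squared distances: projections then
    differ by at most \<open>inverse (real (Suc n))\<close>.\<close>
  have "\<exists>F. finite F \<and> F \<subseteq> E \<and> s - (inverse (real (Suc n)))\<^sup>2 < sum a F" for n
  proof (rule ccontr)
    assume *: "\<not> ?thesis"
    have "s \<le> s - (inverse (real (Suc n)))\<^sup>2"
      unfolding s_def by (rule infsum_le_finite_sums[OF sm]) (use * in \<open>force simp: s_def not_less\<close>)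
    then show False
      by simp
  qed
  then have "\<forall>n. \<exists>F. finite F \<and> F \<subseteq> E \<and> s - (inverse (real (Suc n)))\<^sup>2 < sum a F"
    by blast
  from choice[OF this] obtain F where F: "\<And>n. finite (F n)" "\<And>n. F n \<subseteq> E"
    and Fs: "\<And>n. s - (inverse (real (Suc n)))\<^sup>2 < sum a (F n)"
    by blast
  have near: "norm (proj (F n \<union> G) x - proj (F n) x) \<le> inverse (real (Suc n))"
    if "finite G" "G \<subseteq> E" for n G
  proof (rule power2_le_imp_le)
    have "orthonormal (F n \<union> G)"
      using on by (rule orthonormal_mono) (use F that in auto)
    then have "(norm (proj (F n \<union> G) x - proj (F n) x))\<^sup>2 = sum a (F n \<union> G) - sum a (F n)"
      unfolding a_def using F(1) that by (intro proj_union_diff)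
    also have "\<dots> \<le> (inverse (real (Suc n)))\<^sup>2"
      using Fs[of n] le_s[of "F n \<union> G"] F that by fastforce
    finally show "(norm (proj (F n \<union> G) x - proj (F n) x))\<^sup>2 \<le> (inverse (real (Suc n)))\<^sup>2" .
  qed simp
  define X where "X n = proj (F n) x" for n
  have XX: "norm (X i - X j) \<le> inverse (real (Suc i)) + inverse (real (Suc j))" for i j
  proof -
    have "X i - X j = (proj (F j \<union> F i) x - X j) - (proj (F i \<union> F j) x - X i)"
      by (simp add: Un_commute)
    then have "norm (X i - X j) \<le> norm (proj (F j \<union> F i) x - X j) + norm (proj (F i \<union> F j) x - X i)"
      by (metis norm_triangle_ineq4)
    also have "\<dots> \<le> inverse (real (Suc j)) + inverse (real (Suc i))"
      unfolding X_def by (intro add_mono near F)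
    finally show ?thesis by simp
  qed
  have "Cauchy X"
  proof (rule CauchyI)
    fix e :: real assume "e > 0"
    then obtain N where N: "inverse (real (Suc N)) < e / 2"
      using reals_Archimedean[of "e / 2"] by auto
    have "norm (X i - X j) < e" if "i \<ge> N" "j \<ge> N" for i j
    proof -
      have "inverse (real (Suc i)) \<le> inverse (real (Suc N))" "inverse (real (Suc j)) \<le> inverse (real (Suc N))"
        using that by (simp_all add: frac_le inverse_eq_divide)
      then show ?thesis
        using XX[of i j] N by linarith
    qed
    then show "\<exists>M. \<forall>i\<ge>M. \<forall>j\<ge>M. norm (X i - X j) < e" by blast
  qed
  then obtain y where y: "X \<longlonglongrightarrow> y"
    by (auto simp: Cauchy_convergent_iff convergent_def)
  have "cinner (x - y) e = 0" if "e \<in> E" for e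
  proof -
    have bnd: "cmod (cinner (x - X n) e) \<le> inverse (real (Suc n))" for n
    proof -
      have onu: "orthonormal (F n \<union> {e})"
        using on by (rule orthonormal_mono) (use F that in auto)
      \<comment> \<open>Replacing \<open>x\<close> by its projection onto the span of
        \<open>F n\<close> and \<open>e\<close> keeps the coefficient at \<open>e\<close>, and that
        projection is close to \<open>X n\<close>.\<close>
      then have "cinner (x - X n) e = cinner (proj (F n \<union> {e}) x - proj (F n) x) e"
        using F(1) by (simp add: cinner_diff_left X_def cinner_proj)
      also have "cmod \<dots> \<le> norm (proj (F n \<union> {e}) x - proj (F n) x) * norm e"
        by (rule cmod_cinner_le)
      also have "\<dots> \<le> inverse (real (Suc n))"
        using near[of "{e}" n] orthonormal_norm[OF on that] that by simp
      finally show ?thesis .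
    qed
    have "(\<lambda>n. cinner (x - X n) e) \<longlonglongrightarrow> 0"
      by (rule tendsto_norm_zero_cancel, rule tendsto_sandwich[OF _ _ tendsto_const LIMSEQ_inverse_real_of_nat])
        (use bnd in auto)
    moreover have "(\<lambda>n. cinner (x - X n) e) \<longlonglongrightarrow> cinner (x - y) e"
      by (intro tendsto_cinner tendsto_intros y)
    ultimately show ?thesis
      using LIMSEQ_unique by blast
  qed
  then have "x - y = 0"
    using assms unfolding orthonormal_basis_def by blast
  then have "(\<lambda>n. (norm (X n))\<^sup>2) \<longlonglongrightarrow> (norm x)\<^sup>2"
    using y by (intro tendsto_intros) simp
  moreover have "(norm (X n))\<^sup>2 \<le> s" for n
    unfolding X_def using norm_proj[OF F(1), of n x] orthonormal_mono[OF on F(2)] le_s[OF F] by (simp add: a_def)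
  ultimately have "(norm x)\<^sup>2 \<le> s"
    using LIMSEQ_le_const2 by blast
  moreover have "s \<le> (norm x)\<^sup>2"
    unfolding s_def by (rule infsum_le_finite_sums[OF sm]) (use fin_le in auto)
  ultimately show ?thesis
    using sm has_sum_infsum unfolding s_def a_def by fastforce
qed

lemma gram_schmidt_exists:
  fixes X :: "'a::chilbert_space set"
  assumes "finite X"
  shows "\<exists>F. finite F \<and> orthonormal F \<and> (\<forall>x\<in>X. proj F x = x)"
  using assms
proof (induction X)
  case empty
  show ?case
    by (rule exI[of _ "{}"]) (simp add: orthonormal_def)
next
  case (insert x X)
  then obtain F where F: "finite F" "orthonormal F" "\<And>y. y \<in> X \<Longrightarrow> proj F y = y"
    by blast
  show ?case
  proof (cases "proj F x = x")
    case True
    then show ?thesis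
      using F by blast
  next
    case False
    define y where "y = x - proj F x"
    define e where "e = (1 / norm y) *\<^sub>R y"
    have ny: "norm y > 0"
      using False by (simp add: y_def)
    have ye: "y = norm y *\<^sub>R e"
      using ny by (simp add: e_def)
    have yf: "cinner y f = 0" if "f \<in> F" for f
      by (simp add: y_def cinner_diff_left cinner_proj F that)
    have ef: "cinner e f = 0" "cinner f e = 0" if "f \<in> F" for f
      using yf[OF that] cinner_commute[of f y] by (simp_all add: e_def cinner_simps)
    have ee: "cinner e e = 1"
      using ny by (simp add: e_def cinner_self)
    have "e \<notin> F"
      using ef ee by fastforce
    have on: "orthonormal (insert e F)"
      using F(2) ef ee unfolding orthonormal_def by auto
    have ins: "proj (insert e F) z = cinner z e *\<^sub>C e + proj F z" for z
      using F(1) \<open>e \<notin> F\<close> by (simp add: proj_def)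
    have "cinner (proj F z) e = 0" for z
      by (simp add: proj_def cinner_sum_left cinner_scaleC_left ef)
    then have old: "proj (insert e F) z = z" if "proj F z = z" for z
      by (metis that ins scaleC_zero_left add_0)
    have "proj (insert e F) y = y"
      using proj_in[OF _ on, of e] F(1) by (subst (1 2) ye) (simp add: proj_scaleR)
    moreover have "proj (insert e F) (proj F x) = proj F x"
      using F by (intro old proj_idem)
    ultimately have "proj (insert e F) (y + proj F x) = y + proj F x"
      unfolding proj_add by simp
    then have "proj (insert e F) x = x"
      by (simp add: y_def)
    then show ?thesis
      using F on old by (intro exI[of _ "insert e F"]) auto
  qed
qed

section \<open>Resolvents and approximate polar decomposition\<close>

lemma positive_op_resolvent:
  fixes Q :: "'a::chilbert_space \<Rightarrow>\<^sub>L 'a"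
  assumes Q: "positive_op Q" and "\<epsilon> > 0"
  obtains Z where "clinear_op Z" "\<And>x. Q (Z x) + \<epsilon> *\<^sub>R Z x = x" "\<And>x. Z (Q x + \<epsilon> *\<^sub>R x) = x"
proof -
  define M where "M = norm Q + 1"
  have M: "M > 0" "norm Q \<le> M"
    by (simp_all add: M_def add_nonneg_pos)
  define B where "B = id_blinfun - (1 / M) *\<^sub>R Q"
  have B: "norm B \<le> 1"
    unfolding B_def by (intro positive_op_complement Q M)
  define c where "c = 1 / (M + \<epsilon>)"
  have c: "c > 0" "c * M < 1"
    using M \<open>\<epsilon> > 0\<close> by (simp_all add: c_def add_pos_pos)
  \<comment> \<open>The Neumann series as a fixed point problem:
    \<open>Q + \<epsilon> = (M + \<epsilon>) - M * B\<close> with \<open>norm B \<le> 1\<close>, so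
    the inverse solves \<open>Z = (1 + M * B Z) / (M + \<epsilon>)\<close>, whose right-hand side
    contracts by the factor \<open>M / (M + \<epsilon>)\<close>.\<close>
  define f where "f Z = c *\<^sub>R (id_blinfun + M *\<^sub>R (B o\<^sub>L Z))" for Z
  have "\<exists>!Z. f Z = Z"
  proof (rule banach_fix_type[of "c * M"])
    show "0 \<le> c * M" "c * M < 1"
      using M c by simp_all
    show "\<forall>Z Z'. dist (f Z) (f Z') \<le> c * M * dist Z Z'"
    proof (intro allI)
      fix Z Z'
      have "f Z - f Z' = (c * M) *\<^sub>R (B o\<^sub>L (Z - Z'))"
        by (rule blinfun_eqI) (simp add: f_def blinfun.bilinear_simps algebra_simps)
      then have "norm (f Z - f Z') = c * M * norm (B o\<^sub>L (Z - Z'))"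
        using M c by simp
      also have "\<dots> \<le> c * M * (norm B * norm (Z - Z'))"
        using M c by (intro mult_left_mono norm_blinfun_compose) simp
      also have "\<dots> \<le> c * M * (1 * norm (Z - Z'))"
        using M c B by (intro mult_left_mono mult_right_mono) auto
      finally show "dist (f Z) (f Z') \<le> c * M * dist Z Z'"
        by (simp add: dist_norm)
    qed
  qed
  then obtain Z where Z: "f Z = Z" by blast
  have right: "Q (Z x) + \<epsilon> *\<^sub>R Z x = x" for x
  proof -
    have "Z x = c *\<^sub>R (x + M *\<^sub>R B (Z x))"
      by (subst Z[symmetric]) (simp add: f_def blinfun.bilinear_simps)
    then have "(M + \<epsilon>) *\<^sub>R Z x = (M + \<epsilon>) *\<^sub>R (c *\<^sub>R (x + M *\<^sub>R B (Z x)))"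
      by (rule arg_cong)
    moreover have "(M + \<epsilon>) * c = 1"
      using M \<open>\<epsilon> > 0\<close> by (simp add: c_def)
    ultimately have "(M + \<epsilon>) *\<^sub>R Z x = x + M *\<^sub>R B (Z x)"
      by (simp only: scaleR_scaleR scaleR_one)
    then show ?thesis
      using M by (simp add: B_def blinfun.bilinear_simps algebra_simps)
  qed
  have inj: "x = y" if "Q x + \<epsilon> *\<^sub>R x = Q y + \<epsilon> *\<^sub>R y" for x y
  proof -
    have "Q (x - y) + \<epsilon> *\<^sub>R (x - y) = 0"
      using that by (simp add: blinfun.diff_right algebra_simps)
    then have "Re (cinner (Q (x - y) + \<epsilon> *\<^sub>R (x - y)) (x - y)) = 0"
      by simp
    then have "Re (cinner (Q (x - y)) (x - y)) + \<epsilon> * (norm (x - y))\<^sup>2 = 0"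
      by (simp only: cinner_add_left cinner_scaleR_left cinner_self) simp
    moreover have "0 \<le> Re (cinner (Q (x - y)) (x - y))" "0 \<le> \<epsilon> * (norm (x - y))\<^sup>2"
      using positive_op_nonneg[OF Q] \<open>\<epsilon> > 0\<close> by simp_all
    ultimately have "\<epsilon> * (norm (x - y))\<^sup>2 = 0"
      by linarith
    then show ?thesis
      using \<open>\<epsilon> > 0\<close> by simp
  qed
  have "clinear_op Z"
    unfolding clinear_op_def
  proof (intro allI, rule inj)
    fix a x
    have "Q (a *\<^sub>C Z x) + \<epsilon> *\<^sub>R (a *\<^sub>C Z x) = a *\<^sub>C (Q (Z x) + \<epsilon> *\<^sub>R Z x)"
      by (simp add: clinear_opD[OF positive_op_clinear[OF Q]] scaleC_add_right scaleC_scaleR_commute)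
    then show "Q (Z (a *\<^sub>C x)) + \<epsilon> *\<^sub>R Z (a *\<^sub>C x) = Q (a *\<^sub>C Z x) + \<epsilon> *\<^sub>R (a *\<^sub>C Z x)"
      by (simp add: right)
  qed
  moreover have "Z (Q x + \<epsilon> *\<^sub>R x) = x" for x
    by (rule inj) (rule right)
  ultimately show ?thesis
    using that right by blast
qed

text \<open>A contraction \<open>U = T (\<bar>T\<bar> + \<epsilon>)\<^sup>-\<^sup>1\<close> replaces the partial isometry of the polar decomposition.\<close>

lemma approximate_polar_decomposition:
  fixes T :: "'a::chilbert_space \<Rightarrow>\<^sub>L 'a"
  assumes T: "clinear_op T" and "\<epsilon> > 0"
  shows "\<exists>U. clinear_op U \<and> norm U \<le> 1 \<and> (\<forall>x. T x = U (abs_op T x) + \<epsilon> *\<^sub>R U x) \<and>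
    (\<forall>x. Re (cinner (abs_op T x) x) \<le> cmod (cinner (T x) (U x)) + \<epsilon> * (norm x)\<^sup>2)"
proof -
  define Q where "Q = abs_op T"
  note Q = abs_op(1)[OF T, folded Q_def]
  obtain Z where Z: "clinear_op Z" "\<And>x. Q (Z x) + \<epsilon> *\<^sub>R Z x = x" "\<And>x. Z (Q x + \<epsilon> *\<^sub>R x) = x"
    using positive_op_resolvent[OF Q \<open>\<epsilon> > 0\<close>] by blast
  have QZ: "norm (Q (Z x)) \<le> norm x" for x
  proof (rule power2_le_imp_le)
    \<comment> \<open>As \<open>Q\<close> is positive, the cross term in the square of
      \<open>x = Q (Z x) + \<epsilon> *\<^sub>R Z x\<close> is nonnegative. So \<open>Q Z\<close>,
      and with it \<open>U = T Z\<close>, is a contraction.\<close>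
    have "cinner x x = cinner (Q (Z x) + \<epsilon> *\<^sub>R Z x) (Q (Z x) + \<epsilon> *\<^sub>R Z x)"
      by (simp add: Z)
    also have "\<dots> = cinner (Q (Z x)) (Q (Z x)) + 2 * of_real \<epsilon> * cinner (Q (Z x)) (Z x)
        + of_real (\<epsilon>\<^sup>2) * cinner (Z x) (Z x)"
      by (simp add: cinner_simps positive_op_self_adjoint[OF Q] power2_eq_square algebra_simps)
    finally have "(norm x)\<^sup>2 = (norm (Q (Z x)))\<^sup>2 + 2 * \<epsilon> * Re (cinner (Q (Z x)) (Z x)) + \<epsilon>\<^sup>2 * (norm (Z x))\<^sup>2"
      unfolding cinner_self by (simp add: complex_eq_iff)
    moreover have "0 \<le> 2 * \<epsilon> * Re (cinner (Q (Z x)) (Z x))" "0 \<le> \<epsilon>\<^sup>2 * (norm (Z x))\<^sup>2"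
      using positive_op_nonneg[OF Q] \<open>\<epsilon> > 0\<close> by simp_all
    ultimately show "(norm (Q (Z x)))\<^sup>2 \<le> (norm x)\<^sup>2"
      by linarith
  qed simp
  define U where "U = T o\<^sub>L Z"
  have "clinear_op U"
    unfolding U_def by (intro clinear_intros T Z)
  moreover have "norm U \<le> 1"
    by (rule norm_blinfun_bound) (simp_all add: U_def QZ[unfolded Q_def] norm_abs_op[OF T, symmetric])
  moreover have "T x = U (Q x) + \<epsilon> *\<^sub>R U x" for x
    using arg_cong[OF Z(3)[of x], of "blinfun_apply T"] by (simp add: U_def blinfun.bilinear_simps)
  moreover have "Re (cinner (Q x) x) \<le> cmod (cinner (T x) (U x)) + \<epsilon> * (norm x)\<^sup>2" for x
  proof -
    have "cinner (T x) (U x) = cinner (Q x) (Q (Z x))"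
      unfolding Q_def cinner_abs_op[OF T] by (simp add: U_def)
    also have "\<dots> = cinner (Q x) (x - \<epsilon> *\<^sub>R Z x)"
      by (metis Z(2) add_diff_cancel_right')
    also have "\<dots> = cinner (Q x) x - of_real \<epsilon> * cinner x (Q (Z x))"
      by (simp add: cinner_diff_right cinner_scaleR_right positive_op_self_adjoint[OF Q])
    finally have "cinner (Q x) x = cinner (T x) (U x) + of_real \<epsilon> * cinner x (Q (Z x))"
      by simp
    then have "Re (cinner (Q x) x) \<le> cmod (cinner (T x) (U x) + of_real \<epsilon> * cinner x (Q (Z x)))"
      using complex_Re_le_cmod by metis
    also have "\<dots> \<le> cmod (cinner (T x) (U x)) + cmod (of_real \<epsilon> * cinner x (Q (Z x)))"
      by (rule norm_triangle_ineq)
    also have "cmod (of_real \<epsilon> * cinner x (Q (Z x))) \<le> \<epsilon> * (norm x * norm x)"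
      using \<open>\<epsilon> > 0\<close> cmod_cinner_le[of x "Q (Z x)"] mult_left_mono[OF QZ[of x] norm_ge_zero[of x]]
      by (simp add: norm_mult)
    finally show ?thesis
      by (simp add: power2_eq_square)
  qed
  ultimately show ?thesis
    unfolding Q_def by blast
qed

section \<open>Hilbert-Schmidt sums and the trace norm\<close>

lemma has_sum_finite_sum:
  fixes f :: "'i \<Rightarrow> 'b \<Rightarrow> 'c::topological_comm_monoid_add"
  assumes "\<And>i. i \<in> I \<Longrightarrow> (f i has_sum s i) A"
  shows "((\<lambda>x. \<Sum>i\<in>I. f i x) has_sum (\<Sum>i\<in>I. s i)) A"
  using assms by (induction I rule: infinite_finite_induct) (auto intro: has_sum_add)

lemma has_sum_diff:
  fixes f g :: "'b \<Rightarrow> 'c::real_normed_vector"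
  assumes "(f has_sum a) A" "(g has_sum b) A"
  shows "((\<lambda>x. f x - g x) has_sum (a - b)) A"
  using has_sum_add[of f A a "\<lambda>x. - g x" "- b"] assms by (simp add: has_sum_uminus)

text \<open>A Hilbert-Schmidt estimate for \<open>R V\<close>: expand by Parseval in
  \<open>E\<close>, interchange the sums, and apply Bessel in \<open>F\<close> to
  \<open>cadjoint V (R e)\<close>. With \<open>V\<close> the identity it compares sums over
  unrelated orthonormal sets.\<close>

lemma sum_norm_sqrt_le:
  fixes E :: "'a::chilbert_space set"
  assumes E: "orthonormal_basis E" and R: "positive_op R"
    and t: "((\<lambda>e. (norm (R e))\<^sup>2) has_sum t) E"
    and V: "clinear_op V" "norm V \<le> 1" and F: "finite F" "orthonormal F"
  shows "(\<Sum>f\<in>F. (norm (R (V f)))\<^sup>2) \<le> t"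
proof (rule has_sum_mono[OF _ t])
  show "((\<lambda>e. \<Sum>f\<in>F. (cmod (cinner (R (V f)) e))\<^sup>2) has_sum (\<Sum>f\<in>F. (norm (R (V f)))\<^sup>2)) E"
    by (rule has_sum_finite_sum) (rule parseval[OF E])
  fix e
  have "cinner (R (V f)) e = cinner f (cadjoint V (R e))" for f
    by (simp add: positive_op_self_adjoint[OF R] cinner_cadjoint[OF V(1)])
  then have "cmod (cinner (R (V f)) e) = cmod (cinner (cadjoint V (R e)) f)" for f
    by (metis cinner_commute complex_mod_cnj)
  then have "(\<Sum>f\<in>F. (cmod (cinner (R (V f)) e))\<^sup>2) \<le> (norm (cadjoint V (R e)))\<^sup>2"
    using bessel[OF F] by simp
  also have "\<dots> \<le> (1 * norm (R e))\<^sup>2"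
    by (intro power_mono norm_ge_zero)
      (meson V norm_cadjoint_le mult_right_mono norm_blinfun norm_ge_zero order_trans)
  finally show "(\<Sum>f\<in>F. (cmod (cinner (R (V f)) e))\<^sup>2) \<le> (norm (R e))\<^sup>2"
    by simp
qed

text \<open>The least such \<open>M\<close> is the trace norm of \<open>T\<close>; in this form its subadditivity is evident.\<close>

definition nuclear_bound :: "('a::chilbert_space \<Rightarrow>\<^sub>L 'a) \<Rightarrow> real \<Rightarrow> bool" where
  "nuclear_bound T M \<longleftrightarrow> (\<forall>W F. clinear_op W \<longrightarrow> norm W \<le> 1 \<longrightarrow> finite F \<longrightarrow> orthonormal F \<longrightarrow>
    (\<Sum>f\<in>F. cmod (cinner (T f) (W f))) \<le> M)"

lemma nuclear_bound_diff:
  fixes T T' :: "'a::chilbert_space \<Rightarrow>\<^sub>L 'a"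
  assumes "nuclear_bound T M" "nuclear_bound T' M'"
  shows "nuclear_bound (T - T') (M + M')"
  unfolding nuclear_bound_def
proof (intro allI impI)
  fix W :: "'a \<Rightarrow>\<^sub>L 'a" and F :: "'a set" assume *: "clinear_op W" "norm W \<le> 1" "finite F" "orthonormal F"
  have "(\<Sum>f\<in>F. cmod (cinner ((T - T') f) (W f)))
      \<le> (\<Sum>f\<in>F. cmod (cinner (T f) (W f)) + cmod (cinner (T' f) (W f)))"
    by (intro sum_mono) (simp add: blinfun.diff_left cinner_diff_left norm_triangle_ineq4)
  also have "\<dots> \<le> M + M'"
    using assms * unfolding nuclear_bound_def sum.distrib by (intro add_mono) auto
  finally show "(\<Sum>f\<in>F. cmod (cinner ((T - T') f) (W f))) \<le> M + M'" .
qed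

lemma nuclear_bound_scaleC:
  assumes "nuclear_bound T M"
  shows "nuclear_bound (scaleC_op c T) (cmod c * M)"
  using assms unfolding nuclear_bound_def
  by (simp add: scaleC_op.rep_eq cinner_scaleC_left norm_mult mult_left_mono flip: sum_distrib_left)

lemma abs_op_sqrt:
  fixes T :: "'a::chilbert_space \<Rightarrow>\<^sub>L 'a"
  assumes "clinear_op T"
  obtains R where "positive_op R" "\<And>x. R (R x) = abs_op T x" "\<And>x. Re (cinner (abs_op T x) x) = (norm (R x))\<^sup>2"
proof -
  obtain R where R: "positive_op R" "R o\<^sub>L R = abs_op T"
    using positive_op_sqrt[OF abs_op(1)[OF assms]] by blast
  have RR: "R (R x) = abs_op T x" for x
    using R(2) by (metis blinfun_apply_blinfun_compose)
  moreover have "Re (cinner (abs_op T x) x) = (norm (R x))\<^sup>2" for x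
    unfolding RR[symmetric] positive_op_self_adjoint[OF R(1), of "R x"] cinner_self by simp
  ultimately show ?thesis
    using that R by blast
qed

text \<open>With \<open>R\<close> the square root of \<open>abs_op T\<close> one has
  \<open>T = U R R + \<epsilon> U\<close>, so a term of the sum is, up to \<open>\<epsilon>\<close>,
  the inner product of \<open>R f\<close> and \<open>R (V f)\<close> with
  \<open>V = cadjoint U o\<^sub>L W\<close>. Both families have square sums at most
  \<open>t\<close>; the arithmetic-geometric mean inequality finishes.\<close>

lemma trace_imp_nuclear_bound:
  fixes T :: "'a::chilbert_space \<Rightarrow>\<^sub>L 'a"
  assumes T: "clinear_op T" and E: "orthonormal_basis E"
    and t: "((\<lambda>e. Re (cinner (abs_op T e) e)) has_sum t) E"
  shows "nuclear_bound T t"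
  unfolding nuclear_bound_def
proof (intro allI impI)
  fix W :: "'a \<Rightarrow>\<^sub>L 'a" and F :: "'a set" assume W: "clinear_op W" "norm W \<le> 1" and F: "finite F" "orthonormal F"
  obtain R where R: "positive_op R" "\<And>x. R (R x) = abs_op T x" "\<And>x. Re (cinner (abs_op T x) x) = (norm (R x))\<^sup>2"
    using abs_op_sqrt[OF T] by blast
  have t': "((\<lambda>e. (norm (R e))\<^sup>2) has_sum t) E"
    using t by (simp add: R)
  have "(\<Sum>f\<in>F. cmod (cinner (T f) (W f))) \<le> t + \<epsilon> * card F" if "\<epsilon> > 0" for \<epsilon> :: real
  proof -
    obtain U where U: "clinear_op U" "norm U \<le> 1" "\<forall>x. T x = U (abs_op T x) + \<epsilon> *\<^sub>R U x"
      "\<forall>x. Re (cinner (abs_op T x) x) \<le> cmod (cinner (T x) (U x)) + \<epsilon> * (norm x)\<^sup>2"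
      using approximate_polar_decomposition[OF T \<open>\<epsilon> > 0\<close>] by blast
    define V where "V = cadjoint U o\<^sub>L W"
    have "norm V \<le> norm (cadjoint U) * norm W"
      unfolding V_def by (rule norm_blinfun_compose)
    also have "\<dots> \<le> 1 * 1"
      using norm_cadjoint_le[OF U(1)] U W by (intro mult_mono) auto
    finally have V: "clinear_op V" "norm V \<le> 1"
      unfolding V_def by (auto intro: clinear_intros U W)
    have "cmod (cinner (T f) (W f)) \<le> ((norm (R f))\<^sup>2 + (norm (R (V f)))\<^sup>2) / 2 + \<epsilon>" if "f \<in> F" for f
    proof -
      have "cinner (T f) (W f) = cinner (R f) (R (V f)) + of_real \<epsilon> * cinner (U f) (W f)"
      proof -
        have "cinner (U (R (R f))) (W f) = cinner (R f) (R (V f))"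
          using cinner_cadjoint[OF U(1), of "R (R f)" "W f"] positive_op_self_adjoint[OF R(1), of "R f" "V f"]
          by (simp add: V_def)
        then show ?thesis
          unfolding U(3)[rule_format, of f] R(2)[symmetric] by (simp add: cinner_add_left cinner_scaleR_left)
      qed
      then have "cmod (cinner (T f) (W f)) \<le> cmod (cinner (R f) (R (V f))) + \<epsilon> * cmod (cinner (U f) (W f))"
        using norm_triangle_ineq[of "cinner (R f) (R (V f))" "of_real \<epsilon> * cinner (U f) (W f)"] \<open>\<epsilon> > 0\<close>
        by (simp add: norm_mult)
      moreover have "cmod (cinner (R f) (R (V f))) \<le> ((norm (R f))\<^sup>2 + (norm (R (V f)))\<^sup>2) / 2"
        using cmod_cinner_le[of "R f" "R (V f)"] sum_squares_bound[of "norm (R f)" "norm (R (V f))"] by simp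
      moreover have "cmod (cinner (U f) (W f)) \<le> 1"
      proof -
        have "norm (U f) \<le> 1 * norm f" "norm (W f) \<le> 1 * norm f"
          by (meson U W mult_right_mono norm_blinfun norm_ge_zero order_trans)+
        then have "norm (U f) * norm (W f) \<le> 1 * 1"
          using orthonormal_norm[OF F(2) that] by (intro mult_mono) auto
        then show ?thesis
          using cmod_cinner_le[of "U f" "W f"] by simp
      qed
      then have "\<epsilon> * cmod (cinner (U f) (W f)) \<le> \<epsilon> * 1"
        using \<open>\<epsilon> > 0\<close> by (intro mult_left_mono) auto
      ultimately show ?thesis
        by linarith
    qed
    then have "(\<Sum>f\<in>F. cmod (cinner (T f) (W f)))
        \<le> (\<Sum>f\<in>F. ((norm (R f))\<^sup>2 + (norm (R (V f)))\<^sup>2) / 2 + \<epsilon>)"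
      by (rule sum_mono)
    also have "\<dots> = ((\<Sum>f\<in>F. (norm (R f))\<^sup>2) + (\<Sum>f\<in>F. (norm (R (V f)))\<^sup>2)) / 2 + \<epsilon> * card F"
      by (simp add: sum.distrib flip: sum_divide_distrib)
    also have "\<dots> \<le> (t + t) / 2 + \<epsilon> * card F"
      using sum_norm_sqrt_le[OF E R(1) t' V F] sum_norm_sqrt_le[OF E R(1) t' clinear_op_id norm_blinfun_id_le F]
      by simp
    finally show ?thesis by simp
  qed
  note * = this
  show "(\<Sum>f\<in>F. cmod (cinner (T f) (W f))) \<le> t"
  proof (rule field_le_epsilon)
    fix d :: real assume "d > 0"
    have "d / (real (card F) + 1) * card F \<le> d"
      using \<open>d > 0\<close> by (simp add: divide_simps)
    then show "(\<Sum>f\<in>F. cmod (cinner (T f) (W f))) \<le> t + d"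
      using *[of "d / (real (card F) + 1)"] \<open>d > 0\<close> by (simp add: add_nonneg_pos)
  qed
qed

text \<open>The contraction of the approximate polar decomposition is an admissible test operator
  and recovers the diagonal of \<open>abs_op T\<close> up to an arbitrarily small error, so finite
  partial sums are at most \<open>M\<close>.\<close>

lemma nuclear_bound_imp_trace:
  fixes T :: "'a::chilbert_space \<Rightarrow>\<^sub>L 'a"
  assumes T: "clinear_op T" and M: "nuclear_bound T M" and E: "orthonormal E"
  shows "(\<lambda>e. Re (cinner (abs_op T e) e)) summable_on E"
proof (rule nonneg_bdd_above_summable_on)
  show "0 \<le> Re (cinner (abs_op T e) e)" for e
    by (rule positive_op_nonneg[OF abs_op(1)[OF T]])
  show "bdd_above (sum (\<lambda>e. Re (cinner (abs_op T e) e)) ` {F. F \<subseteq> E \<and> finite F})"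
  proof (rule bdd_aboveI2[where M = M])
    fix F assume "F \<in> {F. F \<subseteq> E \<and> finite F}"
    then have F: "finite F" "F \<subseteq> E" "orthonormal F"
      using E orthonormal_mono by auto
    show "(\<Sum>f\<in>F. Re (cinner (abs_op T f) f)) \<le> M"
    proof (rule field_le_epsilon)
      fix d :: real assume "d > 0"
      \<comment> \<open>The total error is \<open>\<epsilon> * card F\<close>; the added 1 covers
        empty \<open>F\<close>.\<close>
      define \<epsilon> where "\<epsilon> = d / (real (card F) + 1)"
      have "\<epsilon> > 0"
        using \<open>d > 0\<close> by (simp add: \<epsilon>_def add_nonneg_pos)
      have "\<epsilon> * card F \<le> d"
        using \<open>d > 0\<close> by (simp add: \<epsilon>_def divide_simps)
      obtain U where U: "clinear_op U" "norm U \<le> 1" "\<forall>x. T x = U (abs_op T x) + \<epsilon> *\<^sub>R U x"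
      "\<forall>x. Re (cinner (abs_op T x) x) \<le> cmod (cinner (T x) (U x)) + \<epsilon> * (norm x)\<^sup>2"
        using approximate_polar_decomposition[OF T \<open>\<epsilon> > 0\<close>] by blast
      have "(\<Sum>f\<in>F. Re (cinner (abs_op T f) f)) \<le> (\<Sum>f\<in>F. cmod (cinner (T f) (U f)) + \<epsilon>)"
      proof (rule sum_mono)
        fix f assume "f \<in> F"
        then show "Re (cinner (abs_op T f) f) \<le> cmod (cinner (T f) (U f)) + \<epsilon>"
          using U(4)[rule_format, of f] orthonormal_norm[OF F(3)] by simp
      qed
      also have "\<dots> = (\<Sum>f\<in>F. cmod (cinner (T f) (U f))) + \<epsilon> * card F"
        by (simp add: sum.distrib)
      also have "\<dots> \<le> M + d"
        using M U F \<open>\<epsilon> * card F \<le> d\<close> unfolding nuclear_bound_def by (intro add_mono) auto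
      finally show "(\<Sum>f\<in>F. Re (cinner (abs_op T f) f)) \<le> M + d" .
    qed
  qed
qed

lemma trace_class_clinear: "trace_class T \<Longrightarrow> clinear_op T"
  by (simp add: trace_class_def)

lemma trace_class_imp_nuclear_bound:
  fixes T :: "'a::chilbert_space \<Rightarrow>\<^sub>L 'a"
  assumes "trace_class T"
  obtains E :: "'a set" and M where "orthonormal_basis E" "nuclear_bound T M"
proof -
  from assms obtain E :: "'a set" where E: "orthonormal_basis E" "(\<lambda>e. Re (cinner (abs_op T e) e)) summable_on E"
    by (auto simp: trace_class_def)
  then show ?thesis
    using that trace_imp_nuclear_bound[OF trace_class_clinear[OF assms] E(1) has_sum_infsum[OF E(2)]] by blast
qed

text \<open>The absolute value of a difference is not accessible from those of its terms, hence the
  detour through \<open>nuclear_bound\<close>.\<close>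

lemma trace_class_diff:
  fixes T T' :: "'a::chilbert_space \<Rightarrow>\<^sub>L 'a"
  assumes "trace_class T" "trace_class T'"
  shows "trace_class (T - T')"
proof -
  obtain E :: "'a set" and M where E: "orthonormal_basis E" "nuclear_bound T M"
    using trace_class_imp_nuclear_bound[OF assms(1)] by blast
  obtain M' where "nuclear_bound T' M'"
    using trace_class_imp_nuclear_bound[OF assms(2)] by blast
  note nb = nuclear_bound_diff[OF E(2) this]
  have cl: "clinear_op (T - T')"
    using assms trace_class_clinear clinear_op_diff by blast
  show ?thesis
    unfolding trace_class_def
    using cl E(1) nuclear_bound_imp_trace[OF cl nb orthonormal_basis_orthonormal[OF E(1)]] by blast
qed

lemma trace_class_scaleC:
  fixes T :: "'a::chilbert_space \<Rightarrow>\<^sub>L 'a"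
  assumes "trace_class T"
  shows "trace_class (scaleC_op c T)"
proof -
  obtain E :: "'a set" and M where E: "orthonormal_basis E" "nuclear_bound T M"
    using trace_class_imp_nuclear_bound[OF assms(1)] by blast
  note nb = nuclear_bound_scaleC[OF E(2), of c]
  have cl: "clinear_op (scaleC_op c T)"
    using assms trace_class_clinear clinear_op_scaleC by blast
  show ?thesis
    unfolding trace_class_def
    using cl E(1) nuclear_bound_imp_trace[OF cl nb orthonormal_basis_orthonormal[OF E(1)]] by blast
qed

text \<open>The definition of \<open>trace_class\<close> supplies some basis, whereas
  \<open>trace_norm\<close> sums over a chosen one. The nuclear bound carries summability from the
  former to the latter.\<close>

lemma trace_norm_has_sum:
  fixes T :: "'a::chilbert_space \<Rightarrow>\<^sub>L 'a"
  assumes "trace_class T"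
  obtains E :: "'a set" where "orthonormal_basis E" "((\<lambda>e. Re (cinner (abs_op T e) e)) has_sum trace_norm T) E"
proof -
  obtain E :: "'a set" and M where E: "orthonormal_basis E" "nuclear_bound T M"
    using trace_class_imp_nuclear_bound[OF assms(1)] by blast
  then have "orthonormal_basis (SOME E :: 'a set. orthonormal_basis E)"
    by (rule_tac someI)
  moreover from this have "((\<lambda>e. Re (cinner (abs_op T e) e)) has_sum trace_norm T) (SOME E. orthonormal_basis E)"
    unfolding trace_norm_def
    by (intro has_sum_infsum nuclear_bound_imp_trace[OF trace_class_clinear[OF assms] E(2)] orthonormal_basis_orthonormal)
  ultimately show ?thesis
    using that by blast
qed

lemma nuclear_bound_trace_norm: "trace_class T \<Longrightarrow> nuclear_bound T (trace_norm T)"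
  using trace_norm_has_sum trace_imp_nuclear_bound trace_class_clinear by metis

lemma norm_sqrt_le:
  fixes E :: "'a::chilbert_space set"
  assumes E: "orthonormal_basis E" and R: "positive_op R"
    and t: "((\<lambda>e. (norm (R e))\<^sup>2) has_sum t) E"
  shows "norm (R x) \<le> sqrt t * norm x" and "t \<ge> 0"
proof -
  show "t \<ge> 0"
    using t by (rule has_sum_nonneg) simp
  show "norm (R x) \<le> sqrt t * norm x"
  proof (cases "x = 0")
    case False
    define u where "u = (1 / norm x) *\<^sub>R x"
    have x: "x = norm x *\<^sub>R u"
      using False by (simp add: u_def)
    have "orthonormal {u}"
      using False by (simp add: orthonormal_def cinner_self u_def)
    then have "(norm (R u))\<^sup>2 \<le> t"
      using sum_norm_sqrt_le[OF E R t clinear_op_id norm_blinfun_id_le, of "{u}"] by simp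
    then have "norm (R u) \<le> sqrt t"
      by (rule real_le_rsqrt)
    then have "norm x * norm (R u) \<le> norm x * sqrt t"
      by (intro mult_left_mono) auto
    then show ?thesis
      by (subst x) (simp add: blinfun.scaleR_right mult.commute)
  qed simp
qed

lemma norm_le_trace_norm:
  fixes T :: "'a::chilbert_space \<Rightarrow>\<^sub>L 'a"
  assumes "trace_class T"
  shows "norm T \<le> trace_norm T"
proof -
  note T = trace_class_clinear[OF assms]
  obtain E :: "'a set" where E: "orthonormal_basis E" "((\<lambda>e. Re (cinner (abs_op T e) e)) has_sum trace_norm T) E"
    using trace_norm_has_sum[OF assms] by blast
  obtain R where R: "positive_op R" "\<And>x. R (R x) = abs_op T x" "\<And>x. Re (cinner (abs_op T x) x) = (norm (R x))\<^sup>2"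
    using abs_op_sqrt[OF T] by blast
  note b = norm_sqrt_le[OF E(1) R(1) E(2)[unfolded R(3)]]
  show ?thesis
  proof (rule norm_blinfun_bound)
    fix x
    have "norm (T x) = norm (R (R x))"
      by (simp add: R(2) norm_abs_op[OF T])
    also have "\<dots> \<le> sqrt (trace_norm T) * norm (R x)"
      by (rule b)
    also have "\<dots> \<le> sqrt (trace_norm T) * (sqrt (trace_norm T) * norm x)"
      by (intro mult_left_mono b) (simp add: b)
    finally show "norm (T x) \<le> trace_norm T * norm x"
      by (simp add: b(2) flip: mult.assoc)
  qed (rule b)
qed

text \<open>Compactness, stated for every finite orthonormal \<open>F\<close> whose span contains
  \<open>X\<close>, so that requirements from different points can be met together by enlarging the
  span.\<close>

lemma trace_class_compact:
  fixes T :: "'a::chilbert_space \<Rightarrow>\<^sub>L 'a"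
  assumes "trace_class T" and "\<delta> > 0"
  shows "\<exists>X. finite X \<and> (\<forall>F h. finite F \<longrightarrow> orthonormal F \<longrightarrow> (\<forall>x\<in>X. proj F x = x) \<longrightarrow>
    norm (T h - proj F (T h)) \<le> \<delta> * norm h)"
proof -
  note T = trace_class_clinear[OF assms(1)]
  define t where "t = trace_norm T"
  obtain E :: "'a set" where E: "orthonormal_basis E" "((\<lambda>e. Re (cinner (abs_op T e) e)) has_sum t) E"
    using trace_norm_has_sum[OF assms(1)] unfolding t_def by blast
  obtain R where R: "positive_op R" "\<And>x. R (R x) = abs_op T x" "\<And>x. Re (cinner (abs_op T x) x) = (norm (R x))\<^sup>2"
    using abs_op_sqrt[OF T] by blast
  note t = E(2)[unfolded R(3)]
  note b = norm_sqrt_le[OF E(1) R(1) t]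
  note on = orthonormal_basis_orthonormal[OF E(1)]
  obtain U where U: "clinear_op U" "norm U \<le> 1" "\<forall>x. T x = U (abs_op T x) + (\<delta>/2) *\<^sub>R U x"
    using approximate_polar_decomposition[OF T half_gt_zero[OF \<open>\<delta> > 0\<close>]] by blast
  have Un: "norm (U x) \<le> norm x" for x
    by (metis U(2) mult_1 mult_right_mono norm_blinfun norm_ge_zero order_trans)
  \<comment> \<open>Chosen so that \<open>sqrt t * sqrt \<eta> \<le> \<delta> / 2\<close>, the other
    half of \<open>\<delta>\<close> being spent on the polar decomposition; \<open>t + 1\<close>
    avoids division by zero.\<close>
  define \<eta> where "\<eta> = (\<delta> / 2)\<^sup>2 / (t + 1)"
  have \<eta>: "\<eta> > 0" "t * \<eta> \<le> (\<delta> / 2)\<^sup>2"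
    using b(2) \<open>\<delta> > 0\<close> by (simp_all add: \<eta>_def add_nonneg_pos divide_simps mult_right_mono)
  have "\<exists>F0. finite F0 \<and> F0 \<subseteq> E \<and> t - \<eta> < (\<Sum>e\<in>F0. (norm (R e))\<^sup>2)"
  proof (rule ccontr)
    assume *: "\<not> ?thesis"
    have "t \<le> t - \<eta>"
      by (rule has_sum_le_finite_sums[OF t]) (use * in \<open>force simp: not_less\<close>)
    then show False
      using \<eta> by simp
  qed
  then obtain F0 where F0: "finite F0" "F0 \<subseteq> E" "t - \<eta> < (\<Sum>e\<in>F0. (norm (R e))\<^sup>2)"
    by blast
  note onF0 = orthonormal_mono[OF on F0(2)]
  have tail: "norm (R h - proj F0 (R h)) \<le> sqrt \<eta> * norm h" for h
  proof -
    have swap: "cmod (cinner (R h) e) = cmod (cinner h (R e))" for e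
      by (simp add: positive_op_self_adjoint[OF R(1)])
    \<comment> \<open>By Cauchy-Schwarz every term is nonnegative, so the partial sum over
      \<open>F0\<close> is at most the total. Rearranged, the tail of \<open>R h\<close> is bounded
      by the tail of the trace.\<close>
    have "((\<lambda>e. (norm h)\<^sup>2 * (norm (R e))\<^sup>2 - (cmod (cinner (R h) e))\<^sup>2) has_sum ((norm h)\<^sup>2 * t - (norm (R h))\<^sup>2)) E"
      by (intro has_sum_diff has_sum_cmult_right t parseval E)
    then have "(\<Sum>e\<in>F0. (norm h)\<^sup>2 * (norm (R e))\<^sup>2 - (cmod (cinner (R h) e))\<^sup>2) \<le> (norm h)\<^sup>2 * t - (norm (R h))\<^sup>2"
      by (rule finite_sum_le_has_sum)
        (use F0 swap cmod_cinner_le in \<open>auto simp flip: power_mult_distrib intro!: power_mono\<close>)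
    then have "(norm (R h - proj F0 (R h)))\<^sup>2 \<le> (norm h)\<^sup>2 * (t - (\<Sum>e\<in>F0. (norm (R e))\<^sup>2))"
      unfolding norm_diff_proj[OF F0(1) onF0] by (simp add: sum_subtractf right_diff_distrib flip: sum_distrib_left)
    also have "\<dots> \<le> (norm h)\<^sup>2 * \<eta>"
      using F0(3) by (intro mult_left_mono) auto
    also have "\<dots> = (sqrt \<eta> * norm h)\<^sup>2"
      using \<eta> by (simp add: power_mult_distrib)
    finally show ?thesis
      by (rule power2_le_imp_le) (use \<eta> in simp)
  qed
  show ?thesis
  \<comment> \<open>These vectors span the range of the finite rank approximation
    \<open>U R (proj F0) R\<close> of \<open>T\<close>.\<close>
  proof (intro exI[of _ "(\<lambda>e. U (R e)) ` F0"] conjI allI impI)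
    show "finite ((\<lambda>e. U (R e)) ` F0)"
      using F0 by simp
    fix F h assume F: "finite F" "orthonormal F" "\<forall>x\<in>(\<lambda>e. U (R e)) ` F0. proj F x = x"
    define v where "v = U (R (proj F0 (R h)))"
    have v: "v = (\<Sum>e\<in>F0. cinner (R h) e *\<^sub>C U (R e))"
      unfolding v_def proj_def
      by (simp add: clinear_op_sum[OF positive_op_clinear[OF R(1)]] clinear_op_sum[OF U(1)])
    have "proj F v = v"
      unfolding v proj_sum proj_scaleC by (intro sum.cong refl) (simp add: F)
    then have "norm (T h - proj F (T h)) \<le> norm (T h - v)"
      using F by (intro norm_diff_proj_le)
    also have "T h - v = U (R (R h - proj F0 (R h))) + (\<delta>/2) *\<^sub>R U h"
      unfolding v_def U(3)[rule_format, of h] R(2)[symmetric] by (simp add: blinfun.diff_right)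
    also have "norm \<dots> \<le> norm (U (R (R h - proj F0 (R h)))) + norm ((\<delta>/2) *\<^sub>R U h)"
      by (rule norm_triangle_ineq)
    also have "\<dots> \<le> sqrt t * (sqrt \<eta> * norm h) + \<delta>/2 * norm h"
    proof (intro add_mono)
      show "norm (U (R (R h - proj F0 (R h)))) \<le> sqrt t * (sqrt \<eta> * norm h)"
        by (rule order_trans[OF Un order_trans[OF b(1)]]) (intro mult_left_mono tail, simp add: b)
      show "norm ((\<delta>/2) *\<^sub>R U h) \<le> \<delta>/2 * norm h"
        using Un \<open>\<delta> > 0\<close> by simp
    qed
    also have "sqrt t * (sqrt \<eta> * norm h) \<le> \<delta>/2 * norm h"
    proof -
      have "sqrt (t * \<eta>) \<le> \<delta> / 2"
        using \<eta> \<open>\<delta> > 0\<close> by (intro real_le_lsqrt) auto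
      then show ?thesis
        using mult_right_mono[of "sqrt (t * \<eta>)" "\<delta> / 2" "norm h"] by (simp add: real_sqrt_mult mult.assoc)
    qed
    finally show "norm (T h - proj F (T h)) \<le> \<delta> * norm h"
      by simp
  qed
qed

section \<open>Determinants of matrices\<close>

lemma trace_mult_commute:
  fixes X Y :: "'a::comm_ring_1 Matrix.mat"
  assumes "X \<in> carrier_mat n n" "Y \<in> carrier_mat n n"
  shows "(\<Sum>i<n. (X * Y) $$ (i,i)) = (\<Sum>i<n. (Y * X) $$ (i,i))"
proof -
  have "(\<Sum>i<n. (X * Y) $$ (i,i)) = (\<Sum>i<n. \<Sum>k<n. X $$ (i,k) * Y $$ (k,i))"
    using assms by (intro sum.cong refl) (auto simp: scalar_prod_def lessThan_atLeast0)
  also have "\<dots> = (\<Sum>k<n. \<Sum>i<n. Y $$ (k,i) * X $$ (i,k))"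
    by (subst sum.swap) (simp add: mult.commute)
  also have "\<dots> = (\<Sum>k<n. (Y * X) $$ (k,k))"
    using assms by (intro sum.cong refl) (auto simp: scalar_prod_def lessThan_atLeast0)
  finally show ?thesis .
qed

text \<open>A Schur triangular form carries the eigenvalues with multiplicity on its diagonal, and
  similarity preserves determinant and trace.\<close>

lemma complex_mat_eigenvalues:
  fixes A :: "complex Matrix.mat"
  assumes A: "A \<in> carrier_mat n n"
  obtains es where "length es = n" "Determinant.det A = prod_list es"
    "(\<Sum>i<n. A $$ (i,i)) = sum_list es" "\<And>a. a \<in> set es \<Longrightarrow> eigenvalue A a"
proof -
  obtain es where es: "char_poly A = (\<Prod>a\<leftarrow>es. [:- a, 1:])" "length es = n"
    using char_poly_factorized[OF A] by blast
  obtain B P Q where "schur_decomposition A es = (B, P, Q)"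
    by (cases "schur_decomposition A es") auto
  from schur_decomposition[OF A es(1) this]
  have sim: "similar_mat_wit A B P Q" and B: "upper_triangular B" "diag_mat B = es"
    by auto
  note w = similar_mat_witD2[OF A sim]
  have PQ: "P \<in> carrier_mat n n" "Q \<in> carrier_mat n n" and Bc: "B \<in> carrier_mat n n"
    using w by auto
  have "Determinant.det A = Determinant.det P * Determinant.det B * Determinant.det Q"
    unfolding w(3) using PQ Bc by (simp add: det_mult[where n = n])
  also have "\<dots> = Determinant.det (P * Q) * Determinant.det B"
    using PQ by (simp add: det_mult[where n = n])
  finally have "Determinant.det A = Determinant.det B"
    by (simp add: w(1))
  then have "Determinant.det A = prod_list es"
    using det_upper_triangular[OF B(1) Bc] B(2) by simp
  moreover have "(\<Sum>i<n. A $$ (i,i)) = sum_list es"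
  proof -
    have "(\<Sum>i<n. A $$ (i,i)) = (\<Sum>i<n. (Q * (P * B)) $$ (i,i))"
      unfolding w(3) using PQ Bc by (intro trace_mult_commute) auto
    also have "Q * (P * B) = (Q * P) * B"
      using PQ Bc by (simp add: assoc_mult_mat[where ?n\<^sub>1 = n and ?n\<^sub>2 = n and ?n\<^sub>3 = n and ?n\<^sub>4 = n])
    also have "\<dots> = B"
      using Bc by (simp add: w(2))
    finally show ?thesis
      unfolding B(2)[symmetric] using Bc by (simp add: diag_mat_def sum_list_sum_nth lessThan_atLeast0)
  qed
  moreover have "eigenvalue A a" if "a \<in> set es" for a
  proof -
    have "poly (char_poly A) a = (\<Prod>b\<leftarrow>es. a - b)"
      unfolding es(1) poly_prod_list by (simp add: o_def algebra_simps)
    also have "\<dots> = 0"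
      using that by (auto simp: prod_list_zero_iff)
    finally show ?thesis
      using eigenvalue_root_char_poly[OF A] by blast
  qed
  ultimately show ?thesis
    using that es(2) by blast
qed

text \<open>The list consists of the squared singular values of \<open>A\<close>, as eigenvalues of
  the Gram matrix. The eigenvectors are kept because bounds on \<open>A *\<^sub>v v\<close> then
  become bounds on single singular values.\<close>

lemma gram_matrix_eigenvalues:
  fixes A :: "complex Matrix.mat"
  assumes A: "A \<in> carrier_mat n n"
  shows "\<exists>es :: real list. length es = n \<and> (cmod (Determinant.det A))\<^sup>2 = prod_list es \<and>
    (\<Sum>i<n. \<Sum>j<n. (cmod (A $$ (i,j)))\<^sup>2) = sum_list es \<and>
    (\<forall>a\<in>set es. a \<ge> 0) \<and>
    (\<forall>a\<in>set es. \<exists>v \<in> carrier_vec n. v \<noteq> 0\<^sub>v n \<and>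
      (\<Sum>i<n. (cmod (vec_index (A *\<^sub>v v) i))\<^sup>2) = a * (\<Sum>i<n. (cmod (vec_index v i))\<^sup>2))"
proof -
  interpret cnj: comm_ring_hom cnj
    by unfold_locales auto
  define H where "H = transpose_mat (map_mat cnj A)"
  have H: "H \<in> carrier_mat n n"
    using A by (simp add: H_def)
  have HA: "H * A \<in> carrier_mat n n"
    using H A by simp
  have Hij: "H $$ (i,j) = cnj (A $$ (j,i))" if "i < n" "j < n" for i j
    using that A by (simp add: H_def)
  have "Determinant.det H = cnj (Determinant.det A)"
    unfolding H_def using A by (subst det_transpose[where n = n]) simp_all
  then have detHA: "Determinant.det (H * A) = of_real ((cmod (Determinant.det A))\<^sup>2)"
    using det_mult[OF H A] by (simp only: complex_norm_square mult.commute)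
  have trHA: "(\<Sum>i<n. (H * A) $$ (i,i)) = of_real (\<Sum>i<n. \<Sum>j<n. (cmod (A $$ (i,j)))\<^sup>2)"
  proof -
    have "(\<Sum>j<n. (H * A) $$ (j,j)) = (\<Sum>j<n. \<Sum>i<n. cnj (A $$ (i,j)) * A $$ (i,j))"
      using H A by (intro sum.cong refl) (auto simp: scalar_prod_def lessThan_atLeast0 Hij)
    also have "\<dots> = (\<Sum>j<n. \<Sum>i<n. of_real ((cmod (A $$ (i,j)))\<^sup>2))"
      by (intro sum.cong refl) (simp only: complex_norm_square mult.commute)
    also have "\<dots> = (\<Sum>i<n. \<Sum>j<n. of_real ((cmod (A $$ (i,j)))\<^sup>2))"
      by (rule sum.swap)
    finally show ?thesis
      by simp
  qed
  obtain cs where cs: "length cs = n" "Determinant.det (H * A) = prod_list cs"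
    "(\<Sum>i<n. (H * A) $$ (i,i)) = sum_list cs" "\<And>a. a \<in> set cs \<Longrightarrow> eigenvalue (H * A) a"
    using complex_mat_eigenvalues[OF HA] by blast
  have ev: "a = of_real (Re a) \<and> Re a \<ge> 0 \<and> (\<exists>v \<in> carrier_vec n. v \<noteq> 0\<^sub>v n \<and>
      (\<Sum>i<n. (cmod (vec_index (A *\<^sub>v v) i))\<^sup>2) = Re a * (\<Sum>i<n. (cmod (vec_index v i))\<^sup>2))"
    if a: "a \<in> set cs" for a
  proof -
    obtain v where v: "v \<in> carrier_vec n" "v \<noteq> 0\<^sub>v n" "(H * A) *\<^sub>v v = a \<cdot>\<^sub>v v"
      using cs(4)[OF a] HA unfolding eigenvalue_def eigenvector_def by auto
    define w where "w = A *\<^sub>v v"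
    have w: "w \<in> carrier_vec n"
      using A v by (simp add: w_def)
    have Hw: "H *\<^sub>v w = a \<cdot>\<^sub>v v"
      using v H A unfolding w_def by (simp add: assoc_mult_mat_vec[where ?n\<^sub>1 = n and ?n\<^sub>2 = n and ?n\<^sub>3 = n])
    define p where "p = (\<Sum>i<n. (cmod (vec_index w i))\<^sup>2)"
    define q where "q = (\<Sum>i<n. (cmod (vec_index v i))\<^sup>2)"
    \<comment> \<open>Two evaluations of the pairing of \<open>v\<close> with
      \<open>H *\<^sub>v w\<close>: as the squared norm of \<open>w\<close> and, by the eigenvalue
      equation, as \<open>a\<close> times that of \<open>v\<close>. Hence \<open>a\<close> is real
      and nonnegative.\<close>
    have "(\<Sum>j<n. cnj (vec_index v j) * vec_index (H *\<^sub>v w) j)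
        = (\<Sum>j<n. \<Sum>i<n. cnj (vec_index v j) * (cnj (A $$ (i,j)) * vec_index w i))"
      using H w by (intro sum.cong refl) (auto simp: scalar_prod_def lessThan_atLeast0 Hij sum_distrib_left)
    also have "\<dots> = (\<Sum>i<n. \<Sum>j<n. cnj (vec_index v j) * (cnj (A $$ (i,j)) * vec_index w i))"
      by (rule sum.swap)
    also have "\<dots> = (\<Sum>i<n. cnj (vec_index w i) * vec_index w i)"
      using A v by (intro sum.cong refl)
        (auto simp: w_def scalar_prod_def lessThan_atLeast0 sum_distrib_left sum_distrib_right mult_ac)
    also have "\<dots> = of_real p"
      unfolding p_def of_real_sum by (intro sum.cong refl) (simp only: complex_norm_square mult.commute)
    finally have "of_real p = (\<Sum>j<n. cnj (vec_index v j) * (a * vec_index v j))"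
      unfolding Hw using v by simp
    also have "\<dots> = a * (\<Sum>j<n. of_real ((cmod (vec_index v j))\<^sup>2))"
      unfolding sum_distrib_left by (intro sum.cong refl) (simp only: complex_norm_square mult_ac)
    finally have pq: "of_real p = a * of_real q"
      by (simp add: q_def)
    obtain i where "i < n" "vec_index v i \<noteq> 0"
      using v by (metis carrier_vecD eq_vecI index_zero_vec)
    then have q: "q > 0"
      unfolding q_def by (intro sum_pos2[of _ i]) auto
    have "p \<ge> 0"
      by (simp add: p_def sum_nonneg)
    have aq: "a = of_real (p / q)"
      using pq q by (simp add: field_simps)
    then have "Re a = p / q"
      by simp
    then show ?thesis
      using aq q \<open>p \<ge> 0\<close> v by (intro conjI bexI[of _ v]) (simp_all add: p_def q_def w_def)
  qed
  define es where "es = map Re cs"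
  have cs_es: "cs = map of_real es"
    unfolding es_def map_map by (rule map_idI[symmetric]) (use ev in auto)
  have "prod_list (map of_real xs) = (of_real (prod_list xs) :: complex)"
    "sum_list (map of_real xs) = (of_real (sum_list xs) :: complex)" for xs
    by (induction xs) auto
  then have "(cmod (Determinant.det A))\<^sup>2 = prod_list es"
    "(\<Sum>i<n. \<Sum>j<n. (cmod (A $$ (i,j)))\<^sup>2) = sum_list es"
    using cs(2,3) unfolding detHA trHA cs_es by (simp_all only: of_real_eq_iff)
  moreover have "length es = n"
    by (simp add: es_def cs)
  moreover have "a \<ge> 0" if "a \<in> set es" for a
    using that ev unfolding es_def by auto
  moreover have "\<exists>v \<in> carrier_vec n. v \<noteq> 0\<^sub>v n \<and>
      (\<Sum>i<n. (cmod (vec_index (A *\<^sub>v v) i))\<^sup>2) = a * (\<Sum>i<n. (cmod (vec_index v i))\<^sup>2)" if "a \<in> set es" for a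
    using that ev unfolding es_def by auto
  ultimately show ?thesis
    by blast
qed

text \<open>Apply \<open>x \<le> exp (x - 1)\<close> to each squared singular value.\<close>

lemma det_le_exp:
  fixes A :: "complex Matrix.mat"
  assumes A: "A \<in> carrier_mat n n"
  shows "(cmod (Determinant.det A))\<^sup>2 \<le> exp ((\<Sum>i<n. \<Sum>j<n. (cmod (A $$ (i,j)))\<^sup>2) - real n)"
proof -
  obtain es :: "real list" where es: "length es = n" "(cmod (Determinant.det A))\<^sup>2 = prod_list es"
    "(\<Sum>i<n. \<Sum>j<n. (cmod (A $$ (i,j)))\<^sup>2) = sum_list es" "\<forall>a\<in>set es. a \<ge> 0"
    using gram_matrix_eigenvalues[OF A] by blast
  have "prod_list xs \<le> exp (sum_list xs - length xs)" if "\<And>a. a \<in> set xs \<Longrightarrow> a \<ge> 0" for xs :: "real list"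
    using that
  proof (induction xs)
    case (Cons x xs)
    have "x * prod_list xs \<le> exp (x - 1) * exp (sum_list xs - length xs)"
      using Cons exp_ge_add_one_self[of "x - 1"] by (intro mult_mono Cons.IH prod_list_nonneg) auto
    then show ?case
      by (simp add: algebra_simps flip: exp_add)
  qed simp
  then show ?thesis
    using es by metis
qed

text \<open>The squared singular values lie between \<open>c\<close> and 1, where
  \<open>ln x \<ge> 1 - 1 / x \<ge> - (1 - x) / c\<close>. Summation yields the defect of the
  squared Hilbert-Schmidt norm from \<open>n\<close>, a quantity that a trace norm will control in
  every dimension.\<close>

lemma det_ge_exp:
  fixes A :: "complex Matrix.mat"
  assumes A: "A \<in> carrier_mat n n" and c: "c > 0"
    and lower: "\<And>v. v \<in> carrier_vec n \<Longrightarrow>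
      c * (\<Sum>i<n. (cmod (vec_index v i))\<^sup>2) \<le> (\<Sum>i<n. (cmod (vec_index (A *\<^sub>v v) i))\<^sup>2)"
    and upper: "\<And>v. v \<in> carrier_vec n \<Longrightarrow>
      (\<Sum>i<n. (cmod (vec_index (A *\<^sub>v v) i))\<^sup>2) \<le> (\<Sum>i<n. (cmod (vec_index v i))\<^sup>2)"
  shows "exp (- (real n - (\<Sum>i<n. \<Sum>j<n. (cmod (A $$ (i,j)))\<^sup>2)) / c) \<le> (cmod (Determinant.det A))\<^sup>2"
proof -
  obtain es :: "real list" where es: "length es = n" "(cmod (Determinant.det A))\<^sup>2 = prod_list es"
    "(\<Sum>i<n. \<Sum>j<n. (cmod (A $$ (i,j)))\<^sup>2) = sum_list es"
    "\<forall>a\<in>set es. \<exists>v \<in> carrier_vec n. v \<noteq> 0\<^sub>v n \<and>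
      (\<Sum>i<n. (cmod (vec_index (A *\<^sub>v v) i))\<^sup>2) = a * (\<Sum>i<n. (cmod (vec_index v i))\<^sup>2)"
    using gram_matrix_eigenvalues[OF A] by blast
  have a: "c \<le> a \<and> a \<le> 1" if mem: "a \<in> set es" for a
  proof -
    obtain v where v: "v \<in> carrier_vec n" "v \<noteq> 0\<^sub>v n"
      "(\<Sum>i<n. (cmod (vec_index (A *\<^sub>v v) i))\<^sup>2) = a * (\<Sum>i<n. (cmod (vec_index v i))\<^sup>2)"
      using bspec[OF es(4) mem] by blast
    have "\<exists>i<n. vec_index v i \<noteq> 0"
      using v by (metis carrier_vecD eq_vecI index_zero_vec)
    then obtain i where "i < n" "vec_index v i \<noteq> 0" by blast
    then have pos: "(\<Sum>i<n. (cmod (vec_index v i))\<^sup>2) > 0" (is "?S > 0")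
      by (intro sum_pos2[of _ i]) auto
    have "c * ?S \<le> a * ?S" "a * ?S \<le> 1 * ?S"
      using lower[OF v(1)] upper[OF v(1)] unfolding v(3) by simp_all
    then show ?thesis
      using pos by (simp only: mult_le_cancel_right_pos)
  qed
  have "exp (- (length xs - sum_list xs) / c) \<le> prod_list xs"
    if "\<And>a. a \<in> set xs \<Longrightarrow> c \<le> a \<and> a \<le> 1" for xs :: "real list"
    using that
  proof (induction xs)
    case (Cons x xs)
    then have x: "c \<le> x" "x \<le> 1"
      by auto
    have "(1 - x) / x \<le> (1 - x) / c"
      using x c by (intro divide_left_mono) auto
    then have "- (1 - x) / c \<le> - (1 - x) / x"
      by (simp only: minus_divide_left[symmetric] neg_le_iff_le)
    also have "- (1 - x) / x = 1 - 1 / x"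
      using x c by (simp add: field_simps)
    also have "\<dots> \<le> ln x"
      using ln_le_minus_one[of "1 / x"] ln_div[of 1 x] x c by simp
    finally have "exp (- (1 - x) / c) \<le> exp (ln x)"
      by (simp only: exp_le_cancel_iff)
    then have "exp (- (1 - x) / c) \<le> x"
      using x c by simp
    moreover have "exp (- (length xs - sum_list xs) / c) \<le> prod_list xs"
      using Cons by auto
    ultimately have "exp (- (1 - x) / c) * exp (- (length xs - sum_list xs) / c) \<le> x * prod_list xs"
      using x c by (intro mult_mono) auto
    moreover have "- (length (x # xs) - sum_list (x # xs)) / c = - (1 - x) / c + - (length xs - sum_list xs) / c"
      by (simp add: add_divide_distrib[symmetric])
    ultimately show ?case
      unfolding exp_add[symmetric] by (simp only: prod_list.Cons)
  qed simp
  from this[of es] a show ?thesis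
    unfolding es(2,3) by (simp add: es(1))
qed

text \<open>An eigenvalue is 1 if its eigenvector is orthogonal to \<open>g\<close>, and
  \<open>1 + c\<close> otherwise. Comparison with the trace \<open>n + c\<close> shows that
  \<open>1 + c\<close> occurs once when \<open>c\<close> is nonzero.\<close>

lemma det_rank_one_update:
  fixes g :: "complex Matrix.vec" and c :: complex
  assumes g: "g \<in> carrier_vec n" "(\<Sum>i<n. (cmod (vec_index g i))\<^sup>2) = 1"
  defines "Q \<equiv> Matrix.mat n n (\<lambda>(i,j). (if i = j then 1 else 0) + c * vec_index g i * cnj (vec_index g j))"
  shows "Determinant.det Q = 1 + c"
proof -
  have Q: "Q \<in> carrier_mat n n"
    by (simp add: Q_def)
  have gg: "(\<Sum>i<n. vec_index g i * cnj (vec_index g i)) = 1"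
    using g(2) by (simp only: complex_norm_square[symmetric] of_real_sum[symmetric] of_real_1)
  obtain es where es: "length es = n" "Determinant.det Q = prod_list es"
    "(\<Sum>i<n. Q $$ (i,i)) = sum_list es" "\<And>a. a \<in> set es \<Longrightarrow> eigenvalue Q a"
    using complex_mat_eigenvalues[OF Q] by blast
  have tr: "sum_list es = of_nat n + c"
    unfolding es(3)[symmetric] Q_def using gg by (simp add: sum.distrib mult.assoc flip: sum_distrib_left)
  have ev: "a = 1 \<or> a = 1 + c" if a: "a \<in> set es" for a
  proof -
    obtain v where v: "v \<in> carrier_vec n" "v \<noteq> 0\<^sub>v n" "Q *\<^sub>v v = a \<cdot>\<^sub>v v"
      using es(4)[OF a] Q unfolding eigenvalue_def eigenvector_def by auto
    define b where "b = (\<Sum>j<n. cnj (vec_index g j) * vec_index v j)"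
    have av: "a * vec_index v i = vec_index v i + c * vec_index g i * b" if "i < n" for i
    proof -
      have "a * vec_index v i = vec_index (Q *\<^sub>v v) i"
        using v that by simp
      also have "\<dots> = (\<Sum>j<n. ((if i = j then 1 else 0) + c * vec_index g i * cnj (vec_index g j)) * vec_index v j)"
        using that v(1) Q by (simp add: Q_def scalar_prod_def lessThan_atLeast0)
      also have "\<dots> = (\<Sum>j<n. (if i = j then vec_index v j else 0) + c * vec_index g i * (cnj (vec_index g j) * vec_index v j))"
        by (intro sum.cong refl) (simp add: algebra_simps)
      also have "\<dots> = vec_index v i + c * vec_index g i * b"
        using that by (simp add: sum.distrib b_def flip: sum_distrib_left)
      finally show ?thesis .
    qed
    show ?thesis
    proof (cases "b = 0")
      case True
      obtain i where "i < n" "vec_index v i \<noteq> 0"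
        using v by (metis carrier_vecD eq_vecI index_zero_vec)
      then show ?thesis
        using av[of i] True by simp
    next
      case False
      have "a * b = (\<Sum>i<n. cnj (vec_index g i) * (a * vec_index v i))"
        by (simp add: b_def sum_distrib_left mult_ac)
      also have "\<dots> = (\<Sum>i<n. cnj (vec_index g i) * vec_index v i + c * b * (vec_index g i * cnj (vec_index g i)))"
        by (intro sum.cong refl) (simp add: av algebra_simps)
      also have "\<dots> = b + c * b"
        using gg by (simp add: sum.distrib b_def flip: sum_distrib_left)
      finally have "a * b = (1 + c) * b"
        by (simp add: algebra_simps)
      then show ?thesis
        using False by simp
    qed
  qed
  have cnt: "\<exists>k. prod_list xs = (1 + c) ^ k \<and> sum_list xs = of_nat (length xs) + of_nat k * c"
    if "\<And>a. a \<in> set xs \<Longrightarrow> a = 1 \<or> a = 1 + c" for xs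
    using that
  proof (induction xs)
    case Nil
    then show ?case by (intro exI[of _ 0]) simp
  next
    case (Cons x xs)
    then obtain k where k: "prod_list xs = (1 + c) ^ k" "sum_list xs = of_nat (length xs) + of_nat k * c"
      by auto
    have "x = 1 \<or> x = 1 + c"
      using Cons by simp
    then show ?case
    proof
      assume "x = 1"
      then show ?thesis
        using k by (intro exI[of _ k]) simp
    next
      assume "x = 1 + c"
      then show ?thesis
        using k by (intro exI[of _ "Suc k"]) (simp add: algebra_simps)
    qed
  qed
  obtain k where k: "prod_list es = (1 + c) ^ k" "sum_list es = of_nat n + of_nat k * c"
    using cnt[OF ev] es(1) by blast
  then have "of_nat k * c = c"
    using tr by simp
  then have "c = 0 \<or> k = 1"
    by auto
  then show ?thesis
    using es(2) k by auto
qed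

text \<open>Rescaling \<open>A\<close> in the direction \<open>g\<close> by the factor \<open>1 / norm (A g)\<close> multiplies the determinant
  by that factor and increases the squared Hilbert-Schmidt norm by less than \<open>1\<close>.\<close>

lemma det_le_norm_mult_vec:
  fixes A :: "complex Matrix.mat"
  assumes A: "A \<in> carrier_mat n n" and g: "g \<in> carrier_vec n" "(\<Sum>i<n. (cmod (vec_index g i))\<^sup>2) = 1"
    and hs: "(\<Sum>i<n. \<Sum>j<n. (cmod (A $$ (i,j)))\<^sup>2) \<le> n"
  shows "(cmod (Determinant.det A))\<^sup>2 \<le> 3 * (\<Sum>i<n. (cmod (vec_index (A *\<^sub>v g) i))\<^sup>2)"
proof -
  define \<sigma> where "\<sigma> = (\<Sum>i<n. (cmod (vec_index (A *\<^sub>v g) i))\<^sup>2)"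
  have "\<sigma> \<ge> 0"
    by (simp add: \<sigma>_def sum_nonneg)
  show ?thesis
  proof (cases "\<sigma> = 0")
    \<comment> \<open>The rescaling breaks down here, but \<open>A\<close> is singular.\<close>
    case True
    have "A *\<^sub>v g = 0\<^sub>v n"
    proof (rule eq_vecI)
      fix i assume i: "i < dim_vec (0\<^sub>v n :: complex Matrix.vec)"
      then have "(cmod (vec_index (A *\<^sub>v g) i))\<^sup>2 = 0"
        using True unfolding \<sigma>_def by (subst (asm) sum_nonneg_eq_0_iff) auto
      then show "vec_index (A *\<^sub>v g) i = vec_index (0\<^sub>v n) i"
        using i by simp
    qed (use A in simp)
    moreover have "g \<noteq> 0\<^sub>v n"
      using g(2) by auto
    ultimately have "Determinant.det A = 0"
      using det_0_iff_vec_prod_zero[OF A] g(1) by blast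
    then show ?thesis
      by (simp add: sum_nonneg)
  next
    case False
    then have \<sigma>: "\<sigma> > 0"
      using \<open>\<sigma> \<ge> 0\<close> by simp
    define s where "s = 1 / sqrt \<sigma>"
    have s: "s > 0" "s\<^sup>2 * \<sigma> = 1"
      using \<sigma> by (simp_all add: s_def power_divide)
    define c where "c = s - 1"
    define Q where "Q = Matrix.mat n n (\<lambda>(i,j). (if i = j then 1 else 0) + of_real c * vec_index g i * cnj (vec_index g j))"
    have Q: "Q \<in> carrier_mat n n"
      by (simp add: Q_def)
    have detQ: "Determinant.det Q = of_real s"
      unfolding Q_def det_rank_one_update[OF g] by (simp add: c_def)
    define u where "u i = vec_index (A *\<^sub>v g) i" for i
    have u: "u i = (\<Sum>k<n. A $$ (i,k) * vec_index g k)" if "i < n" for i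
      using that A g by (simp add: u_def scalar_prod_def lessThan_atLeast0)
    have AQ: "(A * Q) $$ (i,j) = A $$ (i,j) + of_real c * u i * cnj (vec_index g j)" if "i < n" "j < n" for i j
    proof -
      have "(A * Q) $$ (i,j) = (\<Sum>k<n. A $$ (i,k) * ((if k = j then 1 else 0) + of_real c * vec_index g k * cnj (vec_index g j)))"
        using that A by (simp add: Q_def scalar_prod_def lessThan_atLeast0)
      also have "\<dots> = (\<Sum>k<n. (if k = j then A $$ (i,k) else 0) + of_real c * cnj (vec_index g j) * (A $$ (i,k) * vec_index g k))"
        by (intro sum.cong refl) (simp add: algebra_simps)
      also have "\<dots> = A $$ (i,j) + of_real c * cnj (vec_index g j) * u i"
        using that by (simp add: sum.distrib u flip: sum_distrib_left)
      finally show ?thesis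
        by (simp add: mult_ac)
    qed
    have row: "(\<Sum>j<n. (cmod ((A * Q) $$ (i,j)))\<^sup>2) = (\<Sum>j<n. (cmod (A $$ (i,j)))\<^sup>2) + (2 * c + c\<^sup>2) * (cmod (u i))\<^sup>2"
      if "i < n" for i
    proof -
      have "(cmod (a + of_real c * w * cnj d))\<^sup>2 = (cmod a)\<^sup>2 + 2 * c * Re (cnj w * (a * d)) + c\<^sup>2 * (cmod w)\<^sup>2 * (cmod d)\<^sup>2" for a w d
      proof -
        have add: "(cmod (x + y))\<^sup>2 = (cmod x)\<^sup>2 + 2 * Re (x * cnj y) + (cmod y)\<^sup>2" for x y
          unfolding cmod_power2 by (simp add: power2_eq_square algebra_simps)
        have eq: "a * cnj (of_real c * w * cnj d) = of_real c * (cnj w * (a * d))"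
          by (simp add: mult_ac)
        show ?thesis
          unfolding add eq by (simp add: norm_mult power_mult_distrib algebra_simps)
      qed
      then have "(\<Sum>j<n. (cmod ((A * Q) $$ (i,j)))\<^sup>2) = (\<Sum>j<n. (cmod (A $$ (i,j)))\<^sup>2
          + 2 * c * Re (cnj (u i) * (A $$ (i,j) * vec_index g j)) + c\<^sup>2 * (cmod (u i))\<^sup>2 * (cmod (vec_index g j))\<^sup>2)"
        using that by (intro sum.cong refl) (simp add: AQ)
      also have "\<dots> = (\<Sum>j<n. (cmod (A $$ (i,j)))\<^sup>2) + 2 * c * Re (cnj (u i) * u i)
          + c\<^sup>2 * (cmod (u i))\<^sup>2 * (\<Sum>j<n. (cmod (vec_index g j))\<^sup>2)"
        by (simp only: sum.distrib u[OF that] sum_distrib_left Re_sum)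
      also have "Re (cnj (u i) * u i) = (cmod (u i))\<^sup>2"
        by (metis Re_complex_of_real complex_norm_square mult.commute)
      finally show ?thesis
        using g(2) by (simp add: algebra_simps)
    qed
    have "(\<Sum>i<n. \<Sum>j<n. (cmod ((A * Q) $$ (i,j)))\<^sup>2)
        = (\<Sum>i<n. \<Sum>j<n. (cmod (A $$ (i,j)))\<^sup>2) + (2 * c + c\<^sup>2) * \<sigma>"
      unfolding \<sigma>_def u_def[symmetric] by (simp add: row sum.distrib sum_distrib_left)
    \<comment> \<open>Since \<open>2 * c + c^2 = s^2 - 1\<close>, the contribution
      \<open>\<sigma>\<close> of the direction \<open>g\<close> is replaced by 1.\<close>
    also have "(2 * c + c\<^sup>2) * \<sigma> = 1 - \<sigma>"
      using s by (simp add: c_def power2_eq_square algebra_simps)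
    finally have "(\<Sum>i<n. \<Sum>j<n. (cmod ((A * Q) $$ (i,j)))\<^sup>2) - n \<le> 1"
      using hs \<sigma> by simp
    moreover have "(cmod (Determinant.det (A * Q)))\<^sup>2 \<le> exp ((\<Sum>i<n. \<Sum>j<n. (cmod ((A * Q) $$ (i,j)))\<^sup>2) - n)"
      using A Q by (intro det_le_exp) auto
    ultimately have "(cmod (Determinant.det (A * Q)))\<^sup>2 \<le> exp 1"
      by (meson exp_le_cancel_iff order_trans)
    \<comment> \<open>The constant 3 is the bound for \<open>exp 1\<close> in
      \<open>exp_le\<close>.\<close>
    then have "s\<^sup>2 * (cmod (Determinant.det A))\<^sup>2 \<le> 3"
      using exp_le s by (simp add: det_mult[OF A Q] detQ norm_mult power_mult_distrib mult.commute)
    then have "\<sigma> * (s\<^sup>2 * (cmod (Determinant.det A))\<^sup>2) \<le> \<sigma> * 3"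
      using \<sigma> by (intro mult_left_mono) auto
    also have "\<sigma> * (s\<^sup>2 * (cmod (Determinant.det A))\<^sup>2) = (s\<^sup>2 * \<sigma>) * (cmod (Determinant.det A))\<^sup>2"
      by (simp only: mult_ac)
    finally show ?thesis
      unfolding s(2) by (simp add: \<sigma>_def mult.commute)
  qed
qed

section \<open>Bounded holomorphic functions with sparse small values\<close>

text \<open>Harnack's inequality for the positive harmonic function
  \<open>- ln (norm (f z))\<close>; at half the radius its constant is (1 + 1/2) / (1 - 1/2) = 3. A
  logarithm of \<open>f\<close> maps the disc into the left half-plane, and after a Moebius map
  sending \<open>b\<close> to 0 the Schwarz lemma applies.\<close>

lemma harnack_nonvanishing:
  assumes hol: "f holomorphic_on ball z0 R" and R: "R > 0"
    and nz: "\<And>z. z \<in> ball z0 R \<Longrightarrow> f z \<noteq> 0" and lt: "\<And>z. z \<in> ball z0 R \<Longrightarrow> norm (f z) < 1"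
    and z: "norm (z - z0) \<le> R / 2"
  shows "(norm (f z)) ^ 3 \<le> norm (f z0)"
proof -
  obtain g where g: "g holomorphic_on ball z0 R" "\<And>z. z \<in> ball z0 R \<Longrightarrow> f z = exp (g z)"
    using contractible_imp_holomorphic_log[OF hol convex_imp_contractible[OF convex_ball]] nz by metis
  have Re_neg: "Re (g z) < 0" if "z \<in> ball z0 R" for z
    using lt[OF that] g(2)[OF that] by (simp add: norm_exp_eq_Re)
  define b where "b = g z0"
  have b: "Re b < 0"
    unfolding b_def using Re_neg R by simp
  define \<phi> where "\<phi> w = (g (z0 + of_real R * w) - b) / (g (z0 + of_real R * w) + cnj b)" for w
  have mem: "z0 + of_real R * w \<in> ball z0 R" if "norm w < 1" for w
    using that R by (simp add: dist_norm norm_mult)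
  have den: "g (z0 + of_real R * w) + cnj b \<noteq> 0" if "norm w < 1" for w
    using Re_neg[OF mem[OF that]] b by (auto simp: complex_eq_iff)
  have ineq: "norm (a - b) < norm (a + cnj b)" if "Re a < 0" for a
  proof (rule power2_less_imp_less)
    have "(norm (a + cnj b))\<^sup>2 - (norm (a - b))\<^sup>2 = 4 * (Re a * Re b)"
      unfolding cmod_power2 by (simp add: power2_eq_square algebra_simps)
    moreover have "Re a * Re b > 0"
      using that b by (simp add: mult_neg_neg)
    ultimately show "(norm (a - b))\<^sup>2 < (norm (a + cnj b))\<^sup>2"
      by linarith
  qed simp
  define w where "w = (z - z0) / of_real R"
  have w: "norm w \<le> 1 / 2" "z0 + of_real R * w = z"
    using z R by (simp_all add: w_def norm_divide divide_simps)
  have "norm (\<phi> w) \<le> norm w"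
  proof (rule Schwarz_Lemma(1))
    have "(\<lambda>w. g (z0 + of_real R * w)) holomorphic_on ball 0 1"
    proof (rule holomorphic_on_compose_gen[OF _ g(1), unfolded o_def])
      show "(\<lambda>w. z0 + of_real R * w) holomorphic_on ball 0 1"
        by (intro holomorphic_intros)
      show "(\<lambda>w. z0 + of_real R * w) ` ball 0 1 \<subseteq> ball z0 R"
        using mem by auto
    qed
    then show "\<phi> holomorphic_on ball 0 1"
      unfolding \<phi>_def using den by (intro holomorphic_intros) auto
    show "\<phi> 0 = 0"
      by (simp add: \<phi>_def b_def)
    show "norm (\<phi> w) < 1" if "norm w < 1" for w
      using ineq[OF Re_neg[OF mem[OF that]]] den[OF that] by (simp add: \<phi>_def norm_divide divide_simps)
    show "norm w < 1"
      using w by simp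
  qed
  then have "norm (g z - b) \<le> norm w * norm (g z + cnj b)"
    using w den[of w] by (simp add: \<phi>_def norm_divide divide_simps)
  also have "\<dots> \<le> 1 / 2 * norm (g z + cnj b)"
    using w by (intro mult_right_mono) auto
  finally have "norm (g z - b) \<le> 1 / 2 * norm (g z + cnj b)" .
  then have le2: "(norm (g z - b))\<^sup>2 \<le> (1 / 2 * norm (g z + cnj b))\<^sup>2"
    by (rule power_mono) simp
  have sq: "(2 * t)\<^sup>2 = 4 * t\<^sup>2" for t :: real
    by (simp add: power2_eq_square)
  from le2 have "4 * (Re (g z) - Re b)\<^sup>2 + 4 * (Im (g z) - Im b)\<^sup>2 \<le> (Re (g z) + Re b)\<^sup>2 + (Im (g z) - Im b)\<^sup>2"
    by (simp add: power_mult_distrib power_divide cmod_power2)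
  then have "(2 * (Re (g z) - Re b))\<^sup>2 \<le> (Re (g z) + Re b)\<^sup>2"
    unfolding sq using zero_le_power2[of "Im (g z) - Im b"] by linarith
  then have "\<bar>2 * (Re (g z) - Re b)\<bar> \<le> \<bar>Re (g z) + Re b\<bar>"
    by (simp add: abs_le_square_iff)
  moreover have zb: "z \<in> ball z0 R"
    using z R by (simp add: dist_norm norm_minus_commute)
  moreover have "Re (g z) < 0"
    using Re_neg[OF zb] .
  ultimately have "3 * Re (g z) \<le> Re b"
    using b by (simp add: abs_if split: if_splits)
  then have "exp (3 * Re (g z)) \<le> exp (Re b)"
    by simp
  also have "exp (3 * Re (g z)) = (norm (f z)) ^ 3"
    using g(2)[OF zb] by (simp add: norm_exp_eq_Re exp_of_nat_mult[of 3, simplified])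
  also have "exp (Re b) = norm (f z0)"
    using g(2)[of z0] R by (simp add: norm_exp_eq_Re b_def)
  finally show ?thesis .
qed

text \<open>Unimodular on the real axis, larger than 1 above it: powers of it cost nothing at the
  boundary and gain at \<open>\<i> / 2\<close>.\<close>

definition blaschke_inverse :: "real \<Rightarrow> complex \<Rightarrow> complex" where
  "blaschke_inverse x z = (z - Complex x (-1/2)) / (z - Complex x (1/2))"

lemma norm_blaschke_inverse:
  assumes "z \<noteq> Complex x (1/2)"
  shows "(norm (blaschke_inverse x z))\<^sup>2 = 1 + 2 * Im z / (norm (z - Complex x (1/2)))\<^sup>2"
proof -
  have "(norm (z - Complex x (-1/2)))\<^sup>2 = (norm (z - Complex x (1/2)))\<^sup>2 + 2 * Im z"
    unfolding cmod_power2 by (simp add: power2_eq_square algebra_simps)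
  moreover have "norm (z - Complex x (1/2)) \<noteq> 0"
    using assms by simp
  ultimately show ?thesis
    by (simp add: blaschke_inverse_def norm_divide power_divide add_divide_distrib)
qed

lemma norm_blaschke_inverse_le:
  assumes "z \<noteq> Complex x (1/2)"
  shows "norm (blaschke_inverse x z) \<le> exp (Im z / (norm (z - Complex x (1/2)))\<^sup>2)"
proof (rule power2_le_imp_le)
  have "(norm (blaschke_inverse x z))\<^sup>2 \<le> exp (2 * (Im z / (norm (z - Complex x (1/2)))\<^sup>2))"
    unfolding norm_blaschke_inverse[OF assms]
    using exp_ge_add_one_self[of "2 * (Im z / (norm (z - Complex x (1/2)))\<^sup>2)"] by simp
  also have "\<dots> = (exp (Im z / (norm (z - Complex x (1/2)))\<^sup>2))\<^sup>2"
    by (rule exp_double)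
  finally show "(norm (blaschke_inverse x z))\<^sup>2 \<le> (exp (Im z / (norm (z - Complex x (1/2)))\<^sup>2))\<^sup>2" .
qed simp

text \<open>The maximum principle for \<open>d\<close> times powers of inverse Blaschke factors with poles at
  \<open>x k + \<i>/2\<close>, on the half-plane with discs about these points removed: on the circles,
  the smallness of \<open>d\<close> beats the growth of the inverse Blaschke factors.\<close>

lemma sparse_small_values:
  fixes d :: "complex \<Rightarrow> complex" and x :: "nat \<Rightarrow> real" and n :: nat and \<epsilon> :: real
  assumes hol: "d holomorphic_on {z. Im z > 0}" and le1: "\<And>z. Im z > 0 \<Longrightarrow> norm (d z) \<le> 1"
    and \<epsilon>: "\<epsilon> > 0"
    and x1: "\<And>k. k < n \<Longrightarrow> 1 \<le> \<bar>x k\<bar>" and xbig: "\<And>k. k < n \<Longrightarrow> 120 + \<epsilon> * n \<le> \<epsilon> * (x k)\<^sup>2"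
    and sparse: "\<And>j k. j < k \<Longrightarrow> k < n \<Longrightarrow> 2 * \<bar>x j\<bar> \<le> \<bar>x k\<bar>"
    and nz: "\<And>k z. k < n \<Longrightarrow> z \<in> ball (Complex (x k) (1/2)) (3/8) \<Longrightarrow> d z \<noteq> 0"
    and small: "\<And>k. k < n \<Longrightarrow> norm (d (Complex (x k) (1/2))) \<le> 2 * exp (- \<epsilon> * (x k)\<^sup>2)"
  shows "norm (d (\<i> / 2)) \<le> exp (- \<epsilon> * n / 960)"
proof -
  have \<epsilon>n: "0 \<le> \<epsilon> * n"
    using \<epsilon> by simp
  \<comment> \<open>Half the radius 3/8 of the zero-free discs, as Harnack's inequality
    requires.\<close>
  define r :: real where "r = 3/16"
  define c where "c k = Complex (x k) (1/2)" for k
  \<comment> \<open>On its own circle the factor with index \<open>k\<close> has modulus at most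
    \<open>exp 20\<close>, because (11/16) / (3/16)^2 < 20. With the divisor 120 its power costs
    \<open>\<epsilon> * (x k)^2 / 6\<close> in the exponent, half of the gain
    \<open>\<epsilon> * (x k)^2 / 3\<close> from Harnack's inequality.\<close>
  define m where "m k = nat \<lfloor>\<epsilon> * (x k)\<^sup>2 / 120\<rfloor>" for k
  have m_le: "real (m k) \<le> \<epsilon> * (x k)\<^sup>2 / 120" for k
    unfolding m_def using \<epsilon> by (intro of_nat_floor) simp
  have m_ge: "\<epsilon> * (x k)\<^sup>2 / 240 \<le> real (m k)" if "k < n" for k
  proof -
    have "1 \<le> \<epsilon> * (x k)\<^sup>2 / 120"
      using xbig[OF that] \<epsilon>n by linarith
    moreover have "real (m k) \<ge> \<epsilon> * (x k)\<^sup>2 / 120 - 1"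
      unfolding m_def by linarith
    moreover have "real (m k) \<ge> 1"
      using le_nat_floor[of 1 "\<epsilon> * (x k)\<^sup>2 / 120"] calculation(1) by (simp add: m_def)
    ultimately show ?thesis
      by linarith
  qed
  define P where "P z = (\<Prod>k<n. blaschke_inverse (x k) z ^ m k)" for z
  define h where "h z = d z * P z" for z
  define M where "M = (\<Sum>k<n. real (m k))"
  have M: "M \<ge> 0"
    by (simp add: M_def sum_nonneg)
  have P_le: "norm (P z) \<le> exp (\<Sum>k<n. m k * b k)"
    if "\<And>k. k < n \<Longrightarrow> z \<noteq> c k" "\<And>k. k < n \<Longrightarrow> Im z / (norm (z - c k))\<^sup>2 \<le> b k" for z and b :: "nat \<Rightarrow> real"
  proof -
    have "norm (P z) = (\<Prod>k<n. norm (blaschke_inverse (x k) z) ^ m k)"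
      by (simp add: P_def prod_norm[symmetric] norm_power)
    also have "\<dots> \<le> (\<Prod>k<n. exp (m k * b k))"
    proof (rule prod_mono)
      fix k assume "k \<in> {..<n}"
      then have k: "k < n"
        by simp
      have "norm (blaschke_inverse (x k) z) \<le> exp (Im z / (norm (z - c k))\<^sup>2)"
        using norm_blaschke_inverse_le[of z "x k"] that(1)[OF k] by (simp add: c_def)
      also have "\<dots> \<le> exp (b k)"
        using that(2)[OF k] by simp
      finally have "norm (blaschke_inverse (x k) z) \<le> exp (b k)" .
      then have "norm (blaschke_inverse (x k) z) ^ m k \<le> exp (b k) ^ m k"
        by (intro power_mono) auto
      then show "0 \<le> norm (blaschke_inverse (x k) z) ^ m k \<and> norm (blaschke_inverse (x k) z) ^ m k \<le> exp (m k * b k)"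
        by (simp add: exp_of_nat_mult)
    qed
    also have "\<dots> = exp (\<Sum>k<n. m k * b k)"
      by (simp add: exp_sum)
    finally show ?thesis .
  qed
  have on_circle: "norm (h z) \<le> 1" if k: "k < n" and zk: "norm (z - c k) = r" for z k
  proof -
    have Im: "Im z \<le> 1" "Im z > 0"
      using abs_Im_le_cmod[of "z - c k"] zk by (simp_all add: c_def r_def)
    \<comment> \<open>Harnack's inequality asks for modulus strictly below 1, hence
      \<open>d / 2\<close>; this also absorbs the factor 2 in \<open>small\<close>.\<close>
    have "(norm (d z / 2)) ^ 3 \<le> norm (d (c k) / 2)"
    proof (rule harnack_nonvanishing[where f = "\<lambda>z. d z / 2" and R = "3/8"])
      have sub: "0 < Im w" if "w \<in> ball (c k) (3/8)" for w
        using abs_Im_le_cmod[of "w - c k"] that by (simp add: c_def dist_norm norm_minus_commute)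
      show "(\<lambda>z. d z / 2) holomorphic_on ball (c k) (3/8)"
        by (intro holomorphic_intros holomorphic_on_subset[OF hol]) (use sub in auto)
      show "d w / 2 \<noteq> 0" if "w \<in> ball (c k) (3/8)" for w
        using nz[OF k] that by (simp add: c_def)
      show "norm (d w / 2) < 1" if "w \<in> ball (c k) (3/8)" for w
        using le1[OF sub[OF that]] by (simp add: norm_divide)
      show "norm (z - c k) \<le> 3 / 8 / 2"
        using zk by (simp add: r_def)
    qed simp
    also have "\<dots> \<le> exp (- \<epsilon> * (x k)\<^sup>2)"
      using small[OF k] by (simp add: c_def norm_divide)
    also have "\<dots> = (exp (- \<epsilon> * (x k)\<^sup>2 / 3)) ^ 3"
      by (simp add: exp_of_nat_mult[of 3, simplified, symmetric])
    finally have "norm (d z / 2) \<le> exp (- \<epsilon> * (x k)\<^sup>2 / 3)"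
      by (subst (asm) power_mono_iff) auto
    then have dz: "norm (d z) \<le> 2 * exp (- \<epsilon> * (x k)\<^sup>2 / 3)"
      by (simp add: norm_divide)
    define b :: "nat \<Rightarrow> real" where "b j = (if j = k then 20 else 16 / (x j)\<^sup>2)" for j
    \<comment> \<open>Doubling separates the centres by at least half of
      \<open>\<bar>x j\<bar>\<close>, whichever index is larger; as
      \<open>1 \<le> \<bar>x j\<bar>\<close>, subtracting \<open>r = 3/16\<close> leaves at least a
      quarter.\<close>
    have far: "\<bar>x j\<bar> / 4 \<le> norm (z - c j)" if j: "j < n" "j \<noteq> k" for j
    proof -
      have "\<bar>x j\<bar> / 2 \<le> \<bar>x k - x j\<bar>"
        using sparse[of j k] sparse[of k j] j k
          abs_triangle_ineq2[of "x k" "x j"] abs_triangle_ineq2_sym[of "x j" "x k"]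
        by (cases "j < k") auto
      also have "\<bar>x k - x j\<bar> \<le> norm (c k - c j)"
        using abs_Re_le_cmod[of "c k - c j"] by (simp add: c_def)
      also have "\<dots> \<le> norm (z - c j) + norm (z - c k)"
        using norm_triangle_ineq4[of "z - c j" "z - c k"] by simp
      finally show ?thesis
        using x1[OF j(1)] zk by (simp add: r_def)
    qed
    have "norm (P z) \<le> exp (\<Sum>j<n. m j * b j)"
    proof (rule P_le)
      fix j assume j: "j < n"
      show "z \<noteq> c j"
        using far[OF j] x1[OF j] zk by (cases "j = k") (auto simp: r_def)
      show "Im z / (norm (z - c j))\<^sup>2 \<le> b j"
      proof (cases "j = k")
        case True
        have "Im z \<le> 11/16"
          using abs_Im_le_cmod[of "z - c k"] zk by (simp add: c_def r_def)
        then show ?thesis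
          unfolding b_def True zk r_def by (simp add: power2_eq_square)
      next
        case False
        have "Im z / (norm (z - c j))\<^sup>2 \<le> 1 / (\<bar>x j\<bar> / 4)\<^sup>2"
          using Im far[OF j False] x1[OF j] by (intro frac_le power_mono zero_less_power) auto
        then show ?thesis
          using False by (simp add: b_def power_divide)
      qed
    qed
    \<comment> \<open>The other factors cost
      \<open>m j * 16 / (x j)^2 \<le> \<epsilon> * 16 / 120\<close> each, whatever
      \<open>x j\<close> is; \<open>xbig\<close> lets the gain at \<open>x k\<close> pay for all of
      them.\<close>
    also have "(\<Sum>j<n. m j * b j) \<le> \<epsilon> * (x k)\<^sup>2 / 6 + \<epsilon> * n * 16 / 120"
    proof -
      have "m j * b j \<le> (if j = k then \<epsilon> * (x k)\<^sup>2 / 6 else 0) + \<epsilon> * 16 / 120" if "j < n" for j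
      proof (cases "j = k")
        case True
        then show ?thesis
          using m_le[of k] \<epsilon> by (simp add: b_def)
      next
        case False
        have "(x j)\<^sup>2 > 0"
          using x1[OF that] by auto
        then have "m j * (16 / (x j)\<^sup>2) \<le> (\<epsilon> * (x j)\<^sup>2 / 120) * (16 / (x j)\<^sup>2)"
          using m_le[of j] by (intro mult_right_mono) auto
        also have "\<dots> = \<epsilon> * 16 / 120"
          using \<open>(x j)\<^sup>2 > 0\<close> by (simp add: field_simps)
        finally show ?thesis
          using False by (simp add: b_def)
      qed
      then have "(\<Sum>j<n. m j * b j) \<le> (\<Sum>j<n. (if j = k then \<epsilon> * (x k)\<^sup>2 / 6 else 0) + \<epsilon> * 16 / 120)"
        by (intro sum_mono) auto
      also have "\<dots> = \<epsilon> * (x k)\<^sup>2 / 6 + \<epsilon> * n * 16 / 120"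
        using k by (simp add: sum.distrib)
      finally show ?thesis .
    qed
    finally have "norm (P z) \<le> exp (\<epsilon> * (x k)\<^sup>2 / 6 + \<epsilon> * n * 16 / 120)"
      by simp
    then have "norm (h z) \<le> (2 * exp (- \<epsilon> * (x k)\<^sup>2 / 3)) * exp (\<epsilon> * (x k)\<^sup>2 / 6 + \<epsilon> * n * 16 / 120)"
      unfolding h_def norm_mult using dz by (intro mult_mono) auto
    also have "\<dots> = 2 * exp (\<epsilon> * n * 16 / 120 - \<epsilon> * (x k)\<^sup>2 / 6)"
      by (simp flip: exp_add)
    also have "\<epsilon> * n * 16 / 120 - \<epsilon> * (x k)\<^sup>2 / 6 \<le> - 1"
      using xbig[OF k] \<epsilon>n by linarith
    finally have "norm (h z) \<le> 2 * exp (- 1)"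
      by simp
    also have "\<dots> \<le> 1"
      using exp_ge_add_one_self[of 1] by (simp add: exp_minus field_simps)
    finally show ?thesis .
  qed
  \<comment> \<open>As \<open>d\<close> is given only in the open half-plane, the maximum principle
    is applied above the height \<open>1 / \<rho>\<close> and within the radius
    \<open>\<rho>\<close>. On both outer pieces the exponents
    \<open>Im z / (norm (z - c k))^2\<close> are at most \<open>8 / \<rho>\<close>, which tends to
    0.\<close>
  have bound: "norm (h (\<i> / 2)) \<le> exp (8 * M / \<rho>)"
    if \<rho>: "\<rho> \<ge> 8" "\<And>k. k < n \<Longrightarrow> \<rho> \<ge> 2 * norm (c k)" for \<rho> :: real
  proof -
    define S where "S = {z. 1 / \<rho> \<le> Im z} \<inter> cball 0 \<rho> \<inter> (\<Inter>k<n. - ball (c k) r)"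
    define O' where "O' = {z. 1 / \<rho> < Im z} \<inter> ball 0 \<rho> \<inter> (\<Inter>k<n. - cball (c k) r)"
    have "closed S"
      unfolding S_def by (intro closed_Int closed_halfspace_Im_ge closed_cball closed_INT ballI) (simp add: closed_Compl)
    have "open O'"
      unfolding O'_def by (intro open_Int open_halfspace_Im_gt open_ball open_INT) auto
    have S_iff: "z \<in> S \<longleftrightarrow> 1 / \<rho> \<le> Im z \<and> norm z \<le> \<rho> \<and> (\<forall>k<n. r \<le> norm (z - c k))" for z
      by (auto simp: S_def dist_norm norm_minus_commute not_less)
    have O_iff: "z \<in> O' \<longleftrightarrow> 1 / \<rho> < Im z \<and> norm z < \<rho> \<and> (\<forall>k<n. r < norm (z - c k))" for z
      by (auto simp: O'_def dist_norm norm_minus_commute not_le)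
    have "O' \<subseteq> S"
      using S_iff O_iff less_imp_le by blast
    have pos: "Im z > 0" if "z \<in> S" for z
      using that \<rho> by (auto simp: S_def intro: less_le_trans[of 0 "1 / \<rho>"])
    have ne: "z \<noteq> c k" if "z \<in> S" "k < n" for z k
      using that S_iff by (auto simp: r_def)
    have holS: "h holomorphic_on S"
      unfolding h_def P_def blaschke_inverse_def
      by (intro holomorphic_intros holomorphic_on_subset[OF hol]) (use pos ne in \<open>auto simp: c_def\<close>)
    show ?thesis
    proof (rule maximum_modulus_frontier[where S = S and f = h and \<xi> = "\<i> / 2"])
      show "h holomorphic_on interior S"
        using holS interior_subset holomorphic_on_subset by blast
      show "continuous_on (closure S) h"
        using \<open>closed S\<close> holS by (simp add: holomorphic_on_imp_continuous_on)
      show "bounded S"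
        by (rule bounded_subset[OF bounded_cball[of 0 \<rho>]]) (auto simp: S_def)
      have \<rho>8: "1 / \<rho> \<le> 1 / 8"
        using \<rho>(1) by (intro divide_left_mono) auto
      have "r \<le> norm (c k - \<i> / 2)" if "k < n" for k
        using abs_Re_le_cmod[of "c k - \<i> / 2"] x1[OF that] by (simp add: c_def r_def)
      then show "\<i> / 2 \<in> S"
        using \<rho> \<rho>8 by (auto simp: S_def dist_norm norm_divide not_less)
      fix z assume "z \<in> frontier S"
      then have "z \<in> S" "z \<notin> interior S"
        using \<open>closed S\<close> by (auto simp: frontier_def)
      then have "z \<notin> O'"
        using \<open>open O'\<close> \<open>O' \<subseteq> S\<close> interior_maximal by blast
      then consider "Im z = 1 / \<rho>" | "norm z = \<rho>" | k where "k < n" "norm (z - c k) = r"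
        using \<open>z \<in> S\<close> unfolding S_iff O_iff by (meson antisym not_le)
      then show "norm (h z) \<le> exp (8 * M / \<rho>)"
      proof cases
        case 3
        then show ?thesis
          using on_circle[OF 3] M \<rho>(1) order_trans[of _ 1 "exp (8 * M / \<rho>)"] by simp
      next
        case 1
        have "norm (P z) \<le> exp (\<Sum>k<n. m k * (8 / \<rho>))"
        proof (rule P_le)
          fix k assume k: "k < n"
          show "z \<noteq> c k"
            using ne \<open>z \<in> S\<close> k by blast
          have "3 / 8 \<le> norm (z - c k)"
            using abs_Im_le_cmod[of "z - c k"] 1 \<rho>8 by (simp add: c_def)
          then have "(3/8)\<^sup>2 \<le> (norm (z - c k))\<^sup>2"
            by (intro power_mono) auto
          then have "Im z / (norm (z - c k))\<^sup>2 \<le> (1 / \<rho>) / (3/8)\<^sup>2"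
            unfolding 1 using \<rho> by (intro frac_le) auto
          also have "\<dots> \<le> 8 / \<rho>"
            using \<rho> by (simp add: power2_eq_square field_simps)
          finally show "Im z / (norm (z - c k))\<^sup>2 \<le> 8 / \<rho>" .
        qed
        also have "\<dots> = exp (8 * M / \<rho>)"
          by (simp add: M_def sum_distrib_left sum_divide_distrib mult_ac)
        finally have "norm (d z) * norm (P z) \<le> 1 * exp (8 * M / \<rho>)"
          using le1[OF pos[OF \<open>z \<in> S\<close>]] by (intro mult_mono) auto
        then show ?thesis
          by (simp add: h_def norm_mult)
      next
        case 2
        have "norm (P z) \<le> exp (\<Sum>k<n. m k * (8 / \<rho>))"
        proof (rule P_le)
          fix k assume k: "k < n"
          show "z \<noteq> c k"
            using ne \<open>z \<in> S\<close> k by blast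
          have "\<rho> / 2 \<le> norm (z - c k)"
            using norm_triangle_ineq2[of z "c k"] 2 \<rho>(2)[OF k] by linarith
          then have "(\<rho> / 2)\<^sup>2 \<le> (norm (z - c k))\<^sup>2"
            using \<rho> by (intro power_mono) auto
          moreover have "Im z \<le> \<rho>"
            using abs_Im_le_cmod[of z] 2 by simp
          ultimately have "Im z / (norm (z - c k))\<^sup>2 \<le> \<rho> / (\<rho> / 2)\<^sup>2"
            using \<rho> by (intro frac_le) auto
          also have "\<dots> \<le> 8 / \<rho>"
            using \<rho> by (simp add: power2_eq_square field_simps)
          finally show "Im z / (norm (z - c k))\<^sup>2 \<le> 8 / \<rho>" .
        qed
        also have "\<dots> = exp (8 * M / \<rho>)"
          by (simp add: M_def sum_distrib_left sum_divide_distrib mult_ac)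
        finally have "norm (d z) * norm (P z) \<le> 1 * exp (8 * M / \<rho>)"
          using le1[OF pos[OF \<open>z \<in> S\<close>]] by (intro mult_mono) auto
        then show ?thesis
          by (simp add: h_def norm_mult)
      qed
    qed
  qed
  have "norm (h (\<i> / 2)) \<le> 1"
  proof (rule tendsto_lowerbound)
    have "((\<lambda>\<rho>::real. exp (8 * M * inverse \<rho>)) \<longlongrightarrow> exp (8 * M * 0)) at_top"
      by (intro tendsto_intros tendsto_inverse_0_at_top filterlim_ident)
    then show "((\<lambda>\<rho>::real. exp (8 * M / \<rho>)) \<longlongrightarrow> 1) at_top"
      by (simp add: divide_inverse)
    have "eventually (\<lambda>\<rho>. \<rho> \<ge> 8 + (\<Sum>k<n. 2 * norm (c k))) at_top"
      by (rule eventually_ge_at_top)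
    then show "eventually (\<lambda>\<rho>. norm (h (\<i> / 2)) \<le> exp (8 * M / \<rho>)) at_top"
    proof eventually_elim
      case (elim \<rho>)
      have "0 \<le> (\<Sum>k<n. 2 * norm (c k))"
        by (simp add: sum_nonneg)
      then have "8 \<le> \<rho>"
        using elim by linarith
      moreover have "2 * norm (c k) \<le> \<rho>" if "k < n" for k
      proof -
        have "2 * norm (c k) \<le> (\<Sum>k<n. 2 * norm (c k))"
          using that by (intro member_le_sum) auto
        then show ?thesis
          using elim by linarith
      qed
      ultimately show ?case
        by (rule bound)
    qed
  qed simp
  \<comment> \<open>With \<open>t = 1 / (x k)^2\<close>, a single factor has modulus
    \<open>sqrt (1 + t) \<ge> exp (t / 4)\<close> at \<open>\<i> / 2\<close>. As
    \<open>m k \<ge> \<epsilon> * (x k)^2 / 240\<close>, its power is at least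
    \<open>exp (\<epsilon> / 960)\<close>, independently of \<open>x k\<close>.\<close>
  moreover have "exp (\<epsilon> * n / 960) \<le> norm (P (\<i> / 2))"
  proof -
    have "exp (\<epsilon> / 960) \<le> norm (blaschke_inverse (x k) (\<i> / 2)) ^ m k" if k: "k < n" for k
    proof -
      have x2: "(x k)\<^sup>2 \<ge> 1"
        using x1[OF k] by (simp add: abs_le_square_iff[of 1, simplified])
      have x0: "x k \<noteq> 0"
        using x1[OF k] by auto
      define t where "t = 1 / (x k)\<^sup>2"
      have t: "0 < t" "t \<le> 1"
        using x2 x0 by (simp_all add: t_def)
      have ne: "\<i> / 2 \<noteq> Complex (x k) (1/2)"
        using x1[OF k] by (auto simp: complex_eq_iff)
      have "(norm (\<i> / 2 - Complex (x k) (1/2)))\<^sup>2 = (x k)\<^sup>2"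
        by (simp add: cmod_power2)
      then have n2: "(norm (blaschke_inverse (x k) (\<i> / 2)))\<^sup>2 = 1 + t"
        unfolding norm_blaschke_inverse[OF ne] by (simp add: t_def)
      have "exp (t / 2) \<le> 1 + t"
        using exp_bound_lemma[of "t / 2"] t by simp
      then have "(exp (t / 4))\<^sup>2 \<le> (norm (blaschke_inverse (x k) (\<i> / 2)))\<^sup>2"
        unfolding n2 by (simp flip: exp_double)
      then have "exp (t / 4) \<le> norm (blaschke_inverse (x k) (\<i> / 2))"
        by (rule power2_le_imp_le) simp
      then have "exp (t / 4) ^ m k \<le> norm (blaschke_inverse (x k) (\<i> / 2)) ^ m k"
        by (intro power_mono) auto
      moreover have "\<epsilon> / 960 \<le> m k * (t / 4)"
      proof -
        have "\<epsilon> / 960 = (\<epsilon> * (x k)\<^sup>2 / 240) * (t / 4)"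
          using x0 by (simp add: t_def field_simps)
        also have "\<dots> \<le> m k * (t / 4)"
          using m_ge[OF k] t by (intro mult_right_mono) auto
        finally show ?thesis .
      qed
      then have "exp (\<epsilon> / 960) \<le> exp (t / 4) ^ m k"
        by (simp flip: exp_of_nat_mult)
      ultimately show ?thesis
        by (rule order_trans[rotated])
    qed
    then have "(\<Prod>k<n. exp (\<epsilon> / 960)) \<le> (\<Prod>k<n. norm (blaschke_inverse (x k) (\<i> / 2)) ^ m k)"
      by (intro prod_mono) auto
    then show ?thesis
      by (simp add: P_def prod_norm[symmetric] norm_power exp_of_nat_mult[symmetric] mult.commute)
  qed
  then have "norm (d (\<i> / 2)) * exp (\<epsilon> * n / 960) \<le> norm (h (\<i> / 2))"
    unfolding h_def norm_mult by (intro mult_left_mono) auto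
  ultimately have "norm (d (\<i> / 2)) * exp (\<epsilon> * n / 960) \<le> 1"
    by linarith
  then show ?thesis
    by (simp add: exp_minus field_simps)
qed

section \<open>Contractive operator functions in the half-plane\<close>

text \<open>The denominator \<open>(1 - \<i> * \<delta> * z)^2\<close> has modulus at least 1 in the
  closed half-plane and grows quadratically, so it beats the linear growth of \<open>\<phi>\<close>
  on large half-circles and preserves the bound on the axis. Finally \<open>\<delta>\<close> tends
  to 0.\<close>

lemma phragmen_lindelof_half_plane:
  assumes hol: "\<phi> holomorphic_on {z. Im z > 0}" and cont: "continuous_on {z. Im z \<ge> 0} \<phi>"
    and bd: "\<And>z. Im z = 0 \<Longrightarrow> norm (\<phi> z) \<le> 1"
    and growth: "\<And>z. Im z > 0 \<Longrightarrow> norm (\<phi> z) \<le> K * (1 + norm z)"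
    and z0: "Im z0 > 0"
  shows "norm (\<phi> z0) \<le> 1"
proof -
  have "K \<ge> 0"
    using growth[OF z0] norm_ge_zero[of "\<phi> z0"] by (smt (verit) mult_neg_pos norm_ge_zero)
  have main: "norm (\<phi> z0) \<le> (norm (1 - \<i> * of_real \<delta> * z0))\<^sup>2" if "\<delta> > 0" for \<delta> :: real
  proof -
    define q where "q z = 1 - \<i> * of_real \<delta> * z" for z
    have q2: "(norm (q z))\<^sup>2 = 1 + 2 * \<delta> * Im z + \<delta>\<^sup>2 * (norm z)\<^sup>2" for z
      unfolding q_def cmod_power2 by (simp add: power2_eq_square algebra_simps)
    have q1: "1 \<le> (norm (q z))\<^sup>2" "\<delta>\<^sup>2 * (norm z)\<^sup>2 \<le> (norm (q z))\<^sup>2" if "Im z \<ge> 0" for z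
      unfolding q2 using that \<open>\<delta> > 0\<close> by simp_all
    have qpos: "0 < (norm (q z))\<^sup>2" if "Im z \<ge> 0" for z
      using q1(1)[OF that] by linarith
    have q0: "q z \<noteq> 0" if "Im z \<ge> 0" for z
      using q1(1)[OF that] by auto
    define \<psi> where "\<psi> z = \<phi> z / (q z)\<^sup>2" for z
    have \<psi>n: "norm (\<psi> z) = norm (\<phi> z) / (norm (q z))\<^sup>2" for z
      by (simp add: \<psi>_def norm_divide norm_power)
    \<comment> \<open>Large enough for
      \<open>K * (1 + R) \<le> 2 * K * R \<le> \<delta>^2 * R^2\<close>.\<close>
    define R where "R = norm z0 + 1 + 2 * K / \<delta>\<^sup>2"
    have R: "R \<ge> 1" "R > norm z0" "2 * K / \<delta>\<^sup>2 \<le> R"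
      using \<open>K \<ge> 0\<close> by (simp_all add: R_def add_pos_nonneg)
    have KR: "2 * K \<le> \<delta>\<^sup>2 * R"
      using R(3) \<open>\<delta> > 0\<close> by (simp add: divide_le_eq mult.commute)
    define S where "S = {z. 0 \<le> Im z} \<inter> cball 0 R"
    define O' where "O' = {z. 0 < Im z} \<inter> ball 0 R"
    have "closed S"
      unfolding S_def by (intro closed_Int closed_halfspace_Im_ge closed_cball)
    have "open O'"
      unfolding O'_def by (intro open_Int open_halfspace_Im_gt open_ball)
    have "interior S \<subseteq> {z. 0 < Im z}"
    proof
      fix z assume "z \<in> interior S"
      then obtain r where r: "r > 0" "ball z r \<subseteq> S"
        by (auto simp: mem_interior)
      have "z - \<i> * of_real (r / 2) \<in> ball z r"
        using r(1) by (simp add: dist_norm norm_mult)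
      then have "z - \<i> * of_real (r / 2) \<in> S"
        using r(2) by blast
      then show "z \<in> {z. 0 < Im z}"
        using r(1) by (simp add: S_def)
    qed
    have "norm (\<psi> z0) \<le> 1"
    proof (rule maximum_modulus_frontier[where S = S and f = \<psi> and \<xi> = z0])
      show "\<psi> holomorphic_on interior S"
        unfolding \<psi>_def
      proof (intro holomorphic_intros)
        show "\<phi> holomorphic_on interior S"
          using hol \<open>interior S \<subseteq> _\<close> by (rule holomorphic_on_subset)
        show "q holomorphic_on interior S"
          unfolding q_def by (intro holomorphic_intros)
        show "(q z)\<^sup>2 \<noteq> 0" if "z \<in> interior S" for z
          using q0[of z] that \<open>interior S \<subseteq> _\<close> by fastforce
      qed
      show "continuous_on (closure S) \<psi>"
        unfolding \<psi>_def closure_closed[OF \<open>closed S\<close>]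
      proof (intro continuous_intros)
        show "continuous_on S \<phi>"
          by (rule continuous_on_subset[OF cont]) (auto simp: S_def)
        show "continuous_on S q"
          unfolding q_def by (intro continuous_intros)
        show "\<forall>z\<in>S. (q z)\<^sup>2 \<noteq> 0"
          using q0 by (auto simp: S_def)
      qed
      show "bounded S"
        by (rule bounded_subset[OF bounded_cball[of 0 R]]) (auto simp: S_def)
      show "z0 \<in> S"
        using z0 R by (simp add: S_def)
      fix z assume "z \<in> frontier S"
      moreover have "O' \<subseteq> interior S"
        using \<open>open O'\<close> by (intro interior_maximal) (auto simp: S_def O'_def)
      ultimately have "z \<in> S" "z \<notin> O'"
        using \<open>closed S\<close> by (auto simp: frontier_def)
      then consider "Im z = 0" | "Im z > 0" "norm z = R"
        unfolding S_def O'_def by force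
      then show "norm (\<psi> z) \<le> 1"
      proof cases
        case 1
        then show ?thesis
          unfolding \<psi>n using bd[OF 1] q1(1)[of z] pos_divide_le_eq[OF qpos[of z]] by simp
      next
        case 2
        have "norm (\<phi> z) \<le> K * (1 + R)"
          using growth[OF 2(1)] 2(2) by simp
        also have "\<dots> \<le> K * (2 * R)"
          using R \<open>K \<ge> 0\<close> by (intro mult_left_mono) auto
        also have "\<dots> \<le> \<delta>\<^sup>2 * R\<^sup>2"
          using mult_right_mono[OF KR, of R] R by (simp add: power2_eq_square mult_ac)
        also have "\<dots> \<le> (norm (q z))\<^sup>2"
          using q1(2)[of z] 2 by simp
        finally show ?thesis
          unfolding \<psi>n using pos_divide_le_eq[OF qpos[of z]] 2 by simp
      qed
    qed
    then show ?thesis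
      unfolding \<psi>n using pos_divide_le_eq[OF qpos[of z0]] z0 by (simp add: q_def)
  qed
  show ?thesis
  proof (rule tendsto_lowerbound)
    have "((\<lambda>\<delta>::real. (norm (1 - \<i> * of_real \<delta> * z0))\<^sup>2) \<longlongrightarrow> (norm (1 - \<i> * of_real 0 * z0))\<^sup>2) (at_right 0)"
      by (intro tendsto_intros)
    then show "((\<lambda>\<delta>::real. (norm (1 - \<i> * of_real \<delta> * z0))\<^sup>2) \<longlongrightarrow> 1) (at_right 0)"
      by simp
    show "eventually (\<lambda>\<delta>. norm (\<phi> z0) \<le> (norm (1 - \<i> * of_real \<delta> * z0))\<^sup>2) (at_right 0)"
      using main by (auto simp: eventually_at_filter)
  qed simp
qed

section \<open>Consequences of regularity in the trace norm\<close>

lemma trace_holomorphic_cinner: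
  fixes A :: "complex \<Rightarrow> 'a::chilbert_space \<Rightarrow>\<^sub>L 'a"
  assumes "trace_holomorphic_on S A"
  shows "(\<lambda>z. cinner (A z f) g) holomorphic_on S"
  unfolding holomorphic_on_def
proof
  fix z assume z: "z \<in> S"
  with assms obtain D where D: "trace_class D"
    "((\<lambda>w. trace_norm (scaleC_op (inverse (w - z)) (A w - A z) - D)) \<longlongrightarrow> 0) (at z within S)"
    unfolding trace_holomorphic_on_def by blast
  have tc: "trace_class (A w)" if "w \<in> S" for w
    using assms that unfolding trace_holomorphic_on_def by blast
  have "((\<lambda>w. (cinner (A w f) g - cinner (A z f) g) / (w - z) - cinner (D f) g) \<longlongrightarrow> 0) (at z within S)"
  proof (rule Lim_null_comparison)
    show "((\<lambda>w. trace_norm (scaleC_op (inverse (w - z)) (A w - A z) - D) * norm f * norm g) \<longlongrightarrow> 0) (at z within S)"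
      using tendsto_mult_left_zero[OF tendsto_mult_left_zero[OF D(2), of "norm f"], of "norm g"] by simp
    show "\<forall>\<^sub>F w in at z within S. norm ((cinner (A w f) g - cinner (A z f) g) / (w - z) - cinner (D f) g)
        \<le> trace_norm (scaleC_op (inverse (w - z)) (A w - A z) - D) * norm f * norm g"
      unfolding eventually_at_filter
    proof (intro always_eventually allI impI)
      fix w assume "w \<noteq> z" "w \<in> S"
      define T where "T = scaleC_op (inverse (w - z)) (A w - A z) - D"
      have "trace_class T"
        unfolding T_def using tc z \<open>w \<in> S\<close> D(1) by (intro trace_class_diff trace_class_scaleC) auto
      have "(cinner (A w f) g - cinner (A z f) g) / (w - z) - cinner (D f) g = cinner (T f) g"
        by (simp add: T_def blinfun.diff_left scaleC_op.rep_eq cinner_diff_left cinner_scaleC_left divide_inverse mult.commute)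
      also have "norm \<dots> \<le> norm (T f) * norm g"
        by (rule cmod_cinner_le)
      also have "\<dots> \<le> trace_norm T * norm f * norm g"
        by (intro mult_right_mono[OF order_trans[OF norm_blinfun]] mult_right_mono
            norm_le_trace_norm \<open>trace_class T\<close> norm_ge_zero)
      finally show "norm ((cinner (A w f) g - cinner (A z f) g) / (w - z) - cinner (D f) g)
        \<le> trace_norm (scaleC_op (inverse (w - z)) (A w - A z) - D) * norm f * norm g"
        by (simp add: T_def)
    qed
  qed
  then have "((\<lambda>w. (cinner (A w f) g - cinner (A z f) g) / (w - z)) \<longlongrightarrow> cinner (D f) g) (at z within S)"
    by (simp add: Lim_null[symmetric])
  then show "(\<lambda>z. cinner (A z f) g) field_differentiable at z within S"
    unfolding field_differentiable_def has_field_derivative_iff by blast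
qed

lemma trace_continuous_imp_continuous:
  fixes A :: "complex \<Rightarrow> 'a::chilbert_space \<Rightarrow>\<^sub>L 'a"
  assumes "trace_continuous_on S A"
  shows "continuous_on S A"
  unfolding continuous_on_def
proof
  fix z assume z: "z \<in> S"
  have tc: "trace_class (A w)" if "w \<in> S" for w
    using assms that unfolding trace_continuous_on_def by blast
  have "((\<lambda>w. A w - A z) \<longlongrightarrow> 0) (at z within S)"
  proof (rule Lim_null_comparison)
    show "((\<lambda>w. trace_norm (A w - A z)) \<longlongrightarrow> 0) (at z within S)"
      using assms z unfolding trace_continuous_on_def by blast
    show "\<forall>\<^sub>F w in at z within S. norm (A w - A z) \<le> trace_norm (A w - A z)"
      unfolding eventually_at_filter
      using tc z by (intro always_eventually allI impI norm_le_trace_norm trace_class_diff) auto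
  qed
  then show "(A \<longlongrightarrow> A z) (at z within S)"
    by (simp add: Lim_null[symmetric])
qed

lemma unitary_op_norm:
  assumes "unitary_op U"
  shows "norm (U x) = norm x"
proof -
  have "cinner (U x) (U x) = cinner x (cadjoint U (U x))"
    using assms unfolding unitary_op_def by (intro cinner_cadjoint) auto
  also have "cadjoint U (U x) = x"
    using assms unfolding unitary_op_def by (metis blinfun_apply_blinfun_compose id_blinfun.rep_eq)
  finally show ?thesis
    unfolding cinner_self of_real_eq_iff by (simp add: power2_eq_iff_nonneg)
qed

lemma inverse_op_left:
  assumes "invertible_op T"
  shows "inverse_op T (T x) = x" "T (inverse_op T x) = x"
proof -
  have app: "T (S x) = x" "S (T x) = x" if "is_inverse_op T S" for S x
    using that unfolding is_inverse_op_def
    by (metis blinfun_apply_blinfun_compose id_blinfun.rep_eq)+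
  from assms obtain S where S: "is_inverse_op T S"
    unfolding invertible_op_def by blast
  have "S' = S" if S': "is_inverse_op T S'" for S'
  proof (rule blinfun_eqI)
    fix x
    have "S' x = S' (T (S x))"
      by (simp only: app(1)[OF S])
    then show "S' x = S x"
      by (simp only: app(2)[OF S'])
  qed
  then have "inverse_op T = S"
    unfolding inverse_op_def using S by (intro the_equality)
  then show "inverse_op T (T x) = x" "T (inverse_op T x) = x"
    using app[OF S] by simp_all
qed

section \<open>Estimates uniform on compact sets\<close>

lemma compact_ball_cover:
  fixes K :: "'b::metric_space set"
  assumes "compact K" "\<And>z. z \<in> K \<Longrightarrow> e z > 0"
  shows "\<exists>G. finite G \<and> G \<subseteq> K \<and> K \<subseteq> (\<Union>z\<in>G. ball z (e z))"
proof -
  have cover: "K \<subseteq> (\<Union>z\<in>K. ball z (e z))"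
    using assms(2) by auto
  obtain G where "G \<subseteq> K" "finite G" "K \<subseteq> (\<Union>z\<in>G. ball z (e z))"
    by (rule compactE_image[OF assms(1) open_ball cover])
  then show ?thesis
    by blast
qed

text \<open>The lower bound at \<open>z\<close> survives, with half its constant, wherever
  \<open>A w\<close> is within \<open>b z / 2\<close> of \<open>A z\<close>; a finite subcover
  leaves finitely many constants.\<close>

lemma uniformly_bounded_below:
  fixes A :: "complex \<Rightarrow> 'a::chilbert_space \<Rightarrow>\<^sub>L 'a"
  assumes K: "compact K" and cont: "continuous_on K A"
    and inv: "\<And>z. z \<in> K \<Longrightarrow> invertible_op (id_blinfun + A z)"
  shows "\<exists>c>0. \<forall>z\<in>K. \<forall>h. c * norm h \<le> norm ((id_blinfun + A z) h)"
proof -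
  \<comment> \<open>On the trivial space the inverse has norm 0, hence the added 1.\<close>
  define b where "b z = 1 / (norm (inverse_op (id_blinfun + A z)) + 1)" for z
  have b: "b z > 0" for z
    by (simp add: b_def add_nonneg_pos)
  have low: "b z * norm h \<le> norm ((id_blinfun + A z) h)" if z: "z \<in> K" for z h
  proof -
    have "norm h = norm (inverse_op (id_blinfun + A z) ((id_blinfun + A z) h))"
      by (simp add: inverse_op_left(1)[OF inv[OF z]])
    also have "\<dots> \<le> norm (inverse_op (id_blinfun + A z)) * norm ((id_blinfun + A z) h)"
      by (rule norm_blinfun)
    also have "\<dots> \<le> (norm (inverse_op (id_blinfun + A z)) + 1) * norm ((id_blinfun + A z) h)"
      by (intro mult_right_mono) auto
    finally show ?thesis
      by (simp add: b_def divide_le_eq mult.commute add_nonneg_pos)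
  qed
  have near: "b z / 2 * norm h \<le> norm ((id_blinfun + A w) h)"
    if z: "z \<in> K" and w: "dist (A w) (A z) < b z / 2" for z w h
  proof -
    have "norm ((id_blinfun + A z) h) \<le> norm ((id_blinfun + A w) h) + norm ((A w - A z) h)"
      using norm_triangle_ineq4[of "(id_blinfun + A w) h" "(A w - A z) h"] by (simp add: blinfun.bilinear_simps)
    moreover have "norm ((A w - A z) h) \<le> b z / 2 * norm h"
      by (rule order_trans[OF norm_blinfun mult_right_mono]) (use w in \<open>simp_all add: dist_norm\<close>)
    ultimately show ?thesis
      using low[OF z, of h] by simp
  qed
  have "\<forall>z\<in>K. \<exists>e>0. \<forall>w\<in>K. dist w z < e \<longrightarrow> dist (A w) (A z) < b z / 2"
    by (intro ballI cont[unfolded continuous_on_iff, rule_format]) (simp_all add: b)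
  from bchoice[OF this] obtain e
    where e: "\<forall>z\<in>K. e z > 0 \<and> (\<forall>w\<in>K. dist w z < e z \<longrightarrow> dist (A w) (A z) < b z / 2)" ..
  have e_pos: "e z > 0" if "z \<in> K" for z
    using bspec[OF e that] by simp
  from compact_ball_cover[OF K e_pos] obtain G
    where "finite G \<and> G \<subseteq> K \<and> K \<subseteq> (\<Union>z\<in>G. ball z (e z))" ..
  note G = conjunct1[OF this] conjunct2[OF this, THEN conjunct1] conjunct2[OF this, THEN conjunct2]
  \<comment> \<open>Inserting 1 makes the minimum meaningful when the cover is empty.\<close>
  define m where "m = Min (insert 1 ((\<lambda>z. b z / 2) ` G))"
  have "m > 0"
    unfolding m_def using G b by (subst Min_gr_iff) auto
  moreover have "m * norm h \<le> norm ((id_blinfun + A w) h)" if w: "w \<in> K" for w h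
  proof -
    from subsetD[OF G(3) w] obtain z where "z \<in> G" "w \<in> ball z (e z)"
      by (rule UN_E)
    then have z: "z \<in> G" "dist w z < e z"
      by (simp_all add: dist_commute)
    then have zK: "z \<in> K"
      using G(2) by blast
    have "m \<le> b z / 2"
      unfolding m_def using G z by (intro Min_le) auto
    then have "m * norm h \<le> b z / 2 * norm h"
      by (intro mult_right_mono) auto
    also have "\<dots> \<le> norm ((id_blinfun + A w) h)"
      using bspec[OF e zK, THEN conjunct2, rule_format, OF w z(2)] by (rule near[OF zK])
    finally show ?thesis .
  qed
  ultimately show ?thesis
    by blast
qed

text \<open>Half of \<open>\<delta>\<close> is spent on compactness at the centre of a ball, half on
  the variation of \<open>A\<close> within it, which \<open>1 - proj F\<close> does not increase.
  The finite sets belonging to the centres are united.\<close>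

lemma uniformly_compact:
  fixes A :: "complex \<Rightarrow> 'a::chilbert_space \<Rightarrow>\<^sub>L 'a"
  assumes K: "compact K" and cont: "continuous_on K A"
    and tc: "\<And>z. z \<in> K \<Longrightarrow> trace_class (A z)" and "\<delta> > 0"
  shows "\<exists>X. finite X \<and> (\<forall>F. finite F \<longrightarrow> orthonormal F \<longrightarrow> (\<forall>x\<in>X. proj F x = x) \<longrightarrow>
    (\<forall>z\<in>K. \<forall>h. norm (A z h - proj F (A z h)) \<le> \<delta> * norm h))"
proof -
  have d2: "\<delta> / 2 > 0"
    using \<open>\<delta> > 0\<close> by simp
  have "\<forall>z\<in>K. \<exists>e>0. \<forall>w\<in>K. dist w z < e \<longrightarrow> dist (A w) (A z) < \<delta> / 2"
    by (intro ballI cont[unfolded continuous_on_iff, rule_format] d2)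
  from bchoice[OF this] obtain e
    where e: "\<forall>z\<in>K. e z > 0 \<and> (\<forall>w\<in>K. dist w z < e z \<longrightarrow> dist (A w) (A z) < \<delta> / 2)" ..
  have "\<forall>z\<in>K. \<exists>X. finite X \<and> (\<forall>F h. finite F \<longrightarrow> orthonormal F \<longrightarrow> (\<forall>x\<in>X. proj F x = x) \<longrightarrow>
      norm (A z h - proj F (A z h)) \<le> \<delta> / 2 * norm h)"
    by (intro ballI trace_class_compact tc d2)
  from bchoice[OF this] obtain X
    where X: "\<forall>z\<in>K. finite (X z) \<and> (\<forall>F h. finite F \<longrightarrow> orthonormal F \<longrightarrow> (\<forall>x\<in>X z. proj F x = x) \<longrightarrow>
      norm (A z h - proj F (A z h)) \<le> \<delta> / 2 * norm h)" ..
  have e_pos: "e z > 0" if "z \<in> K" for z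
    using bspec[OF e that] by simp
  from compact_ball_cover[OF K e_pos] obtain G
    where "finite G \<and> G \<subseteq> K \<and> K \<subseteq> (\<Union>z\<in>G. ball z (e z))" ..
  note G = conjunct1[OF this] conjunct2[OF this, THEN conjunct1] conjunct2[OF this, THEN conjunct2]
  show ?thesis
  proof (intro exI[of _ "\<Union>z\<in>G. X z"] conjI allI impI ballI)
    show "finite (\<Union>z\<in>G. X z)"
      using G X by auto
    fix F w h assume F: "finite F" "orthonormal F" "\<forall>x\<in>\<Union>z\<in>G. X z. proj F x = x" and w: "w \<in> K"
    from subsetD[OF G(3) w] obtain z where "z \<in> G" "w \<in> ball z (e z)"
      by (rule UN_E)
    then have z: "z \<in> G" "dist w z < e z"
      by (simp_all add: dist_commute)
    then have zK: "z \<in> K"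
      using G(2) by blast
    define y where "y = (A w - A z) h"
    have "norm (y - proj F y) \<le> norm (y - 0)"
      using F by (intro norm_diff_proj_le) (simp_all add: proj_def)
    also have "\<dots> \<le> \<delta> / 2 * norm h"
    proof -
      have "norm (A w - A z) \<le> \<delta> / 2"
        using bspec[OF e zK, THEN conjunct2, rule_format, OF w z(2)] by (simp add: dist_norm)
      then show ?thesis
        unfolding y_def diff_zero by (rule order_trans[OF norm_blinfun mult_right_mono]) simp
    qed
    finally have "norm (y - proj F y) \<le> \<delta> / 2 * norm h" .
    moreover have "norm (A z h - proj F (A z h)) \<le> \<delta> / 2 * norm h"
      using bspec[OF X zK, THEN conjunct2, rule_format, OF F(1,2)] F(3) z(1) by simp
    moreover have "A w h - proj F (A w h) = (y - proj F y) + (A z h - proj F (A z h))"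
      by (simp add: y_def blinfun.diff_left proj_diff)
    ultimately show "norm (A w h - proj F (A w h)) \<le> \<delta> * norm h"
      using norm_triangle_ineq[of "y - proj F y" "A z h - proj F (A z h)"] by simp
  qed
qed

section \<open>Determinants of compressions\<close>

definition compression_mat :: "(nat \<Rightarrow> 'a::chilbert_space) \<Rightarrow> nat \<Rightarrow> ('a \<Rightarrow>\<^sub>L 'a) \<Rightarrow> complex Matrix.mat" where
  "compression_mat e n T = Matrix.mat n n (\<lambda>(i,j). cinner (T (e j)) (e i))"

lemma compression_mat_carrier [simp]: "compression_mat e n T \<in> carrier_mat n n"
  by (simp add: compression_mat_def)

lemma holomorphic_det_compression:
  fixes T :: "complex \<Rightarrow> 'a::chilbert_space \<Rightarrow>\<^sub>L 'a"
  assumes "\<And>f g. (\<lambda>z. cinner (T z f) g) holomorphic_on S"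
  shows "(\<lambda>z. Determinant.det (compression_mat e n (T z))) holomorphic_on S"
proof -
  have "Determinant.det (compression_mat e n (T z))
    = (\<Sum>p | p permutes {0..<n}. signof p * (\<Prod>i = 0..<n. cinner (T z (e (p i))) (e i)))" for z
    unfolding det_def'[OF compression_mat_carrier]
    by (intro sum.cong refl arg_cong2[where f = times] prod.cong)
      (auto simp: compression_mat_def permutes_in_image)
  then show ?thesis
    by (simp only:) (intro holomorphic_intros assms)
qed

context
  fixes F :: "'a::chilbert_space set" and e :: "nat \<Rightarrow> 'a" and n :: nat
  assumes F: "finite F" "orthonormal F" and e: "bij_betw e {..<n} F"
begin

lemma enum_mem: "i < n \<Longrightarrow> e i \<in> F"
  using e by (auto simp: bij_betw_def)

lemma sum_over_enum: "(\<Sum>i<n. f (e i)) = sum f F"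
  by (rule sum.reindex_bij_betw[OF e])

lemma card_eq_enum: "card F = n"
  using bij_betw_same_card[OF e] by simp

text \<open>Coordinates with respect to \<open>e\<close> are isometric on the span of
  \<open>F\<close>, and the matrix acts there as \<open>T\<close> followed by \<open>proj F\<close>;
  this carries the matrix estimates over to operators.\<close>

lemma sum_compression_mat_vec:
  assumes T: "clinear_op T" and h: "proj F h = h"
  defines "v \<equiv> Matrix.vec n (\<lambda>i. cinner h (e i))"
  shows "(\<Sum>i<n. (cmod (vec_index v i))\<^sup>2) = (norm h)\<^sup>2"
    "(\<Sum>i<n. (cmod (vec_index (compression_mat e n T *\<^sub>v v) i))\<^sup>2) = (norm (proj F (T h)))\<^sup>2"
proof -
  have "(\<Sum>i<n. (cmod (vec_index v i))\<^sup>2) = (norm (proj F h))\<^sup>2"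
    unfolding norm_proj[OF F] sum_over_enum[symmetric] by (simp add: v_def)
  then show "(\<Sum>i<n. (cmod (vec_index v i))\<^sup>2) = (norm h)\<^sup>2"
    by (simp add: h)
  have "vec_index (compression_mat e n T *\<^sub>v v) i = cinner (T h) (e i)" if "i < n" for i
  proof -
    have "vec_index (compression_mat e n T *\<^sub>v v) i = (\<Sum>j<n. cinner (T (e j)) (e i) * cinner h (e j))"
      using that by (simp add: compression_mat_def v_def scalar_prod_def lessThan_atLeast0)
    also have "\<dots> = cinner (\<Sum>j<n. cinner h (e j) *\<^sub>C T (e j)) (e i)"
      by (simp add: cinner_sum_left cinner_scaleC_left mult.commute)
    also have "(\<Sum>j<n. cinner h (e j) *\<^sub>C T (e j)) = T (proj F h)"
      unfolding proj_def sum_over_enum[symmetric] by (simp add: clinear_op_sum[OF T])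
    finally show ?thesis
      by (simp add: h)
  qed
  then show "(\<Sum>i<n. (cmod (vec_index (compression_mat e n T *\<^sub>v v) i))\<^sup>2) = (norm (proj F (T h)))\<^sup>2"
    unfolding norm_proj[OF F] sum_over_enum[symmetric] by simp
qed

lemma carrier_vec_coordinates:
  assumes "v \<in> carrier_vec n"
  obtains h where "proj F h = h" "v = Matrix.vec n (\<lambda>i. cinner h (e i))"
proof
  define h where "h = (\<Sum>j<n. vec_index v j *\<^sub>C e j)"
  have "cinner h (e i) = vec_index v i" if "i < n" for i
  proof -
    have "cinner h (e i) = (\<Sum>j<n. if j = i then vec_index v j else 0)"
      unfolding h_def cinner_sum_left
    proof (intro sum.cong refl)
      fix j assume "j \<in> {..<n}"
      then have "e j = e i \<longleftrightarrow> j = i"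
        using that e by (auto simp: bij_betw_def inj_on_def)
      then show "cinner (vec_index v j *\<^sub>C e j) (e i) = (if j = i then vec_index v j else 0)"
        using orthonormalD[OF F(2) enum_mem enum_mem, of j i] that \<open>j \<in> {..<n}\<close>
        by (simp add: cinner_scaleC_left)
    qed
    then show ?thesis
      using that by simp
  qed
  then show "v = Matrix.vec n (\<lambda>i. cinner h (e i))"
    using assms by (intro eq_vecI) auto
  show "proj F h = h"
    unfolding h_def proj_sum proj_scaleC
    by (intro sum.cong refl) (simp add: proj_in[OF F enum_mem])
qed

lemma sum_compression_mat:
  assumes "clinear_op T"
  shows "(\<Sum>i<n. \<Sum>j<n. (cmod (compression_mat e n T $$ (i,j)))\<^sup>2) = (\<Sum>f\<in>F. (norm (proj F (T f)))\<^sup>2)"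
proof -
  have "(\<Sum>i<n. \<Sum>j<n. (cmod (compression_mat e n T $$ (i,j)))\<^sup>2)
      = (\<Sum>j<n. \<Sum>i<n. (cmod (cinner (T (e j)) (e i)))\<^sup>2)"
    by (subst sum.swap) (simp add: compression_mat_def)
  also have "\<dots> = (\<Sum>j<n. (norm (proj F (T (e j))))\<^sup>2)"
    by (simp only: norm_proj[OF F] sum_over_enum[where f = "\<lambda>f. (cmod (cinner x f))\<^sup>2" for x])
  finally show ?thesis
    by (simp only: sum_over_enum[where f = "\<lambda>f. (norm (proj F (T f)))\<^sup>2"])
qed

lemma contraction_apply_le:
  fixes T :: "'a \<Rightarrow>\<^sub>L 'a"
  assumes "norm T \<le> 1"
  shows "norm (proj F (T h)) \<le> norm (T h)" "norm (T h) \<le> norm h"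
proof -
  show "norm (proj F (T h)) \<le> norm (T h)"
    by (rule norm_proj_le[OF F])
  show "norm (T h) \<le> norm h"
    by (metis assms mult_1 mult_right_mono norm_blinfun norm_ge_zero order_trans)
qed

lemma sum_compression_mat_le:
  assumes "clinear_op T" "norm T \<le> 1"
  shows "(\<Sum>i<n. \<Sum>j<n. (cmod (compression_mat e n T $$ (i,j)))\<^sup>2) \<le> n"
proof -
  have "(norm (proj F (T f)))\<^sup>2 \<le> 1" if "f \<in> F" for f
    using contraction_apply_le[OF assms(2), of f] orthonormal_norm[OF F(2) that]
    by (simp add: power_le_one)
  then have "(\<Sum>f\<in>F. (norm (proj F (T f)))\<^sup>2) \<le> (\<Sum>f\<in>F. 1)"
    by (rule sum_mono)
  then show ?thesis
    by (simp add: sum_compression_mat[OF assms(1)] card_eq_enum)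
qed

lemma det_compression_le_one:
  assumes "clinear_op T" "norm T \<le> 1"
  shows "cmod (Determinant.det (compression_mat e n T)) \<le> 1"
proof -
  have "(cmod (Determinant.det (compression_mat e n T)))\<^sup>2
      \<le> exp ((\<Sum>i<n. \<Sum>j<n. (cmod (compression_mat e n T $$ (i,j)))\<^sup>2) - n)"
    by (rule det_le_exp) simp
  also have "\<dots> \<le> 1"
    using sum_compression_mat_le[OF assms] by simp
  finally show ?thesis
    by (simp add: power_le_one_iff)
qed

lemma det_compression_le_norm_apply:
  assumes T: "clinear_op T" "norm T \<le> 1" and g: "proj F g = g" "norm g = 1"
  shows "cmod (Determinant.det (compression_mat e n T)) \<le> 2 * norm (T g)"
proof (rule power2_le_imp_le)
  note v = sum_compression_mat_vec[OF T(1) g(1)]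
  have "(cmod (Determinant.det (compression_mat e n T)))\<^sup>2 \<le> 3 * (norm (proj F (T g)))\<^sup>2"
    unfolding v(2)[symmetric]
    by (rule det_le_norm_mult_vec) (use v(1) g(2) sum_compression_mat_le[OF T] in simp_all)
  also have "\<dots> \<le> 4 * (norm (T g))\<^sup>2"
    using contraction_apply_le(1)[OF T(2), of g] by (intro mult_mono power_mono) auto
  finally show "(cmod (Determinant.det (compression_mat e n T)))\<^sup>2 \<le> (2 * norm (T g))\<^sup>2"
    by (simp add: power_mult_distrib)
qed simp

lemma det_compression_ge_exp:
  assumes T: "clinear_op T" "norm T \<le> 1" and c: "c > 0"
    and low: "\<And>h. proj F h = h \<Longrightarrow> c * norm h \<le> norm (proj F (T h))"
  shows "exp (- (\<Sum>f\<in>F. 1 - (norm (proj F (T f)))\<^sup>2) / c\<^sup>2) \<le> (cmod (Determinant.det (compression_mat e n T)))\<^sup>2"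
proof -
  have "exp (- (real n - (\<Sum>i<n. \<Sum>j<n. (cmod (compression_mat e n T $$ (i,j)))\<^sup>2)) / c\<^sup>2)
      \<le> (cmod (Determinant.det (compression_mat e n T)))\<^sup>2"
  proof (rule det_ge_exp)
    fix v :: "complex Matrix.vec" assume "v \<in> carrier_vec n"
    then obtain h where h: "proj F h = h" and v: "v = Matrix.vec n (\<lambda>i. cinner h (e i))"
      by (rule carrier_vec_coordinates)
    note s = sum_compression_mat_vec[OF T(1) h, folded v]
    have "(c * norm h)\<^sup>2 \<le> (norm (proj F (T h)))\<^sup>2"
      using low[OF h] c by (intro power_mono) auto
    then show "c\<^sup>2 * (\<Sum>i<n. (cmod (vec_index v i))\<^sup>2) \<le> (\<Sum>i<n. (cmod (vec_index (compression_mat e n T *\<^sub>v v) i))\<^sup>2)"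
      unfolding s by (simp add: power_mult_distrib)
    show "(\<Sum>i<n. (cmod (vec_index (compression_mat e n T *\<^sub>v v) i))\<^sup>2) \<le> (\<Sum>i<n. (cmod (vec_index v i))\<^sup>2)"
      unfolding s using contraction_apply_le[OF T(2), of h] by (intro power_mono) auto
  qed (use c in simp_all)
  then show ?thesis
    by (simp add: sum_compression_mat[OF T(1)] sum_subtractf card_eq_enum)
qed

end

text \<open>The norm is recovered from the scalar functions
  \<open>cinner ((id_blinfun + A w) f) g\<close>, with \<open>f\<close> and \<open>g\<close> the
  normalised \<open>x\<close> and its image at \<open>z\<close>. Unitarity bounds them by 1 on the
  axis, and the trace norm bound gives the linear growth that Phragmen-Lindelof tolerates.\<close>

lemma contraction_in_half_plane:
  fixes A :: "complex \<Rightarrow> ('a::chilbert_space \<Rightarrow>\<^sub>L 'a)"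
  assumes hol: "trace_holomorphic_on {z. Im z > 0} A"
    and boundary: "trace_continuous_on {z. Im z \<ge> 0} A"
    and bound: "\<And>z. Im z > 0 \<Longrightarrow> trace_norm (A z) \<le> C * (1 + cmod z)"
    and unitary: "\<And>x :: real. unitary_op (id_blinfun + A (complex_of_real x))"
    and z: "Im z > 0"
  shows "norm (id_blinfun + A z) \<le> 1"
proof (rule norm_blinfun_bound)
  fix x
  define y where "y = (id_blinfun + A z) x"
  show "norm ((id_blinfun + A z) x) \<le> 1 * norm x"
  proof (cases "x = 0 \<or> y = 0")
    case False
    define f where "f = (1 / norm x) *\<^sub>R x"
    define g where "g = (1 / norm y) *\<^sub>R y"
    have fg: "norm f = 1" "norm g = 1"
      using False by (simp_all add: f_def g_def)
    define \<phi> where "\<phi> w = cinner ((id_blinfun + A w) f) g" for w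
    have \<phi>_eq: "\<phi> w = cinner f g + cinner (A w f) g" for w
      by (simp add: \<phi>_def blinfun.add_left cinner_add_left)
    have "norm (\<phi> z) \<le> 1"
    proof (rule phragmen_lindelof_half_plane[where \<phi> = \<phi> and K = "1 + \<bar>C\<bar>" and ?z0.0 = z])
      show "\<phi> holomorphic_on {z. 0 < Im z}"
        unfolding \<phi>_eq by (intro holomorphic_intros trace_holomorphic_cinner hol)
      show "continuous_on {z. 0 \<le> Im z} \<phi>"
        unfolding \<phi>_def
        by (intro bounded_bilinear.continuous_on[OF bounded_bilinear_cinner]
            blinfun.continuous_on continuous_intros trace_continuous_imp_continuous boundary)
      show "norm (\<phi> w) \<le> 1" if "Im w = 0" for w
      proof -
        have "w = complex_of_real (Re w)"
          using that by (simp add: complex_eq_iff)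
        then have "norm ((id_blinfun + A w) f) = norm f"
          using unitary_op_norm[OF unitary[of "Re w"]] by metis
        then show ?thesis
          using cmod_cinner_le[of "(id_blinfun + A w) f" g] fg by (simp add: \<phi>_def)
      qed
      show "norm (\<phi> w) \<le> (1 + \<bar>C\<bar>) * (1 + norm w)" if w: "Im w > 0" for w
      proof -
        have "trace_class (A w)"
          using hol w unfolding trace_holomorphic_on_def by blast
        then have "norm (A w) \<le> C * (1 + norm w)"
          using norm_le_trace_norm bound[OF w] order_trans by blast
        also have "\<dots> \<le> \<bar>C\<bar> * (1 + norm w)"
          by (intro mult_right_mono) auto
        finally have "norm (A w f) \<le> \<bar>C\<bar> * (1 + norm w)"
          using norm_blinfun[of "A w" f] fg by simp
        moreover have "norm (\<phi> w) \<le> norm f * norm g + norm (A w f) * norm g"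
          unfolding \<phi>_eq using cmod_cinner_le[of f g] cmod_cinner_le[of "A w f" g]
            norm_triangle_ineq[of "cinner f g" "cinner (A w f) g"] by linarith
        ultimately have "norm (\<phi> w) \<le> 1 + \<bar>C\<bar> * (1 + norm w)"
          using fg by simp
        also have "\<dots> \<le> (1 + \<bar>C\<bar>) * (1 + norm w)"
          by (simp add: distrib_right)
        finally show ?thesis .
      qed
    qed (rule z)
    moreover have "\<phi> z = of_real (norm y / norm x)"
    proof -
      have "(id_blinfun + A z) f = (1 / norm x) *\<^sub>R y"
        by (simp add: f_def y_def blinfun.scaleR_right)
      then show ?thesis
        using False by (simp add: \<phi>_def g_def cinner_scaleR_left cinner_scaleR_right cinner_self power2_eq_square)
    qed
    ultimately have "norm y / norm x \<le> 1"
      by (simp add: norm_divide)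
    then show ?thesis
      using False by (simp add: y_def divide_le_eq)
  qed (auto simp: y_def)
qed simp

lemma inverse_large_imp_almost_kernel:
  assumes "invertible_op T" and "norm (inverse_op T) > B" "B > 0"
  shows "\<exists>g. norm g = 1 \<and> norm (T g) \<le> 1 / B"
proof -
  have "\<not> (\<forall>y. norm (inverse_op T y) \<le> B * norm y)"
    using norm_blinfun_bound[of B "inverse_op T"] assms by force
  then obtain y where y: "\<not> norm (inverse_op T y) \<le> B * norm y"
    by blast
  define u where "u = inverse_op T y"
  have "0 \<le> B * norm y"
    using assms(3) by simp
  then have u: "norm u > B * norm y" "norm u > 0"
    using y unfolding u_def by linarith+
  have "T u = y"
    by (simp add: u_def inverse_op_left[OF assms(1)])
  then have "norm (T ((1 / norm u) *\<^sub>R u)) = norm y / norm u"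
    using u by (simp add: blinfun.scaleR_right)
  also have "\<dots> \<le> 1 / B"
    using u assms(3) by (simp add: field_simps)
  finally show ?thesis
    using u by (intro exI[of _ "(1 / norm u) *\<^sub>R u"]) auto
qed

text \<open>Only the diagonal coefficient \<open>1 + a\<close>, with
  \<open>a = cinner (A f) f\<close>, is kept, so each defect is at most
  \<open>1 - (cmod (1 + a))^2 \<le> 2 * cmod a\<close>. The sum over \<open>F\<close> becomes a
  nuclear sum, bounded whatever the size of \<open>F\<close>.\<close>

lemma sum_defect_le:
  fixes A :: "'a::chilbert_space \<Rightarrow>\<^sub>L 'a"
  assumes "trace_class A" "finite F" "orthonormal F"
  shows "(\<Sum>f\<in>F. 1 - (norm (proj F ((id_blinfun + A) f)))\<^sup>2) \<le> 2 * trace_norm A"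
proof -
  have "1 - (norm (proj F ((id_blinfun + A) f)))\<^sup>2 \<le> 2 * cmod (cinner (A f) (id_blinfun f))" if f: "f \<in> F" for f
  proof -
    define a where "a = cinner (A f) f"
    have "cinner ((id_blinfun + A) f) f = 1 + a"
      using orthonormalD[OF assms(3) f f] by (simp add: a_def blinfun.add_left cinner_add_left)
    then have "(cmod (1 + a))\<^sup>2 \<le> (norm (proj F ((id_blinfun + A) f)))\<^sup>2"
      unfolding norm_proj[OF assms(2,3)]
      using member_le_sum[OF f, of "\<lambda>e. (cmod (cinner ((id_blinfun + A) f) e))\<^sup>2"] assms(2) by simp
    moreover have "(cmod (1 + a))\<^sup>2 = 1 + 2 * Re a + (cmod a)\<^sup>2"
      unfolding cmod_power2 by (simp add: power2_eq_square algebra_simps)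
    moreover have "- Re a \<le> cmod a"
      using abs_Re_le_cmod[of a] by linarith
    ultimately have "1 - (norm (proj F ((id_blinfun + A) f)))\<^sup>2 \<le> 2 * cmod a"
      using zero_le_power2[of "cmod a"] by linarith
    then show ?thesis
      by (simp add: a_def)
  qed
  then have "(\<Sum>f\<in>F. 1 - (norm (proj F ((id_blinfun + A) f)))\<^sup>2)
      \<le> (\<Sum>f\<in>F. 2 * cmod (cinner (A f) (id_blinfun f)))"
    by (rule sum_mono)
  also have "\<dots> = 2 * (\<Sum>f\<in>F. cmod (cinner (A f) (id_blinfun f)))"
    by (simp add: sum_distrib_left)
  also have "\<dots> \<le> 2 * trace_norm A"
    using nuclear_bound_trace_norm[OF assms(1), unfolded nuclear_bound_def, rule_format,
        OF clinear_op_id norm_blinfun_id_le assms(2,3)]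
    by simp
  finally show ?thesis .
qed

lemma sparse_sequence:
  assumes "\<And>R :: real. \<exists>x. R \<le> \<bar>x\<bar> \<and> P x"
  shows "\<exists>x :: nat \<Rightarrow> real. (\<forall>k. P (x k)) \<and> (\<forall>k. R0 \<le> \<bar>x k\<bar>) \<and> (\<forall>j k. j < k \<longrightarrow> 2 * \<bar>x j\<bar> \<le> \<bar>x k\<bar>)"
proof -
  have "\<forall>R :: real. \<exists>x. R \<le> \<bar>x\<bar> \<and> P x"
    using assms by blast
  from choice[OF this] obtain p where p: "\<And>R. R \<le> \<bar>p R\<bar>" "\<And>R. P (p R)"
    by blast
  define x where "x = rec_nat (p R0) (\<lambda>_ y. p (2 * \<bar>y\<bar>))"
  have xS: "2 * \<bar>x k\<bar> \<le> \<bar>x (Suc k)\<bar>" for k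
    using p(1) by (simp add: x_def)
  have mono: "\<bar>x i\<bar> \<le> \<bar>x j\<bar>" if "i \<le> j" for i j
    by (rule lift_Suc_mono_le[of "\<lambda>k. \<bar>x k\<bar>", OF _ that]) (use xS abs_ge_zero[of "x _"] in \<open>simp add: order_trans[OF _ xS]\<close>)
  have "P (x k)" for k
    by (cases k) (simp_all add: x_def p)
  moreover have "R0 \<le> \<bar>x k\<bar>" for k
    using mono[of 0 k] p(1)[of R0] by (simp add: x_def)
  moreover have "2 * \<bar>x j\<bar> \<le> \<bar>x k\<bar>" if "j < k" for j k
    using xS[of j] mono[of "Suc j" k] that by simp
  ultimately show ?thesis
    by blast
qed

theorem theorem3p2:
  fixes A :: "complex \<Rightarrow> ('a::chilbert_space \<Rightarrow>\<^sub>L 'a)"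
    and C :: real
  assumes hol: "trace_holomorphic_on {z. Im z > 0} A"
    and boundary: "trace_continuous_on {z. Im z \<ge> 0} A"
    and C_pos: "C > 0"
    and bound: "\<And>z. Im z > 0 \<Longrightarrow> trace_norm (A z) \<le> C * (1 + cmod z)"
    and unitary: "\<And>x :: real. unitary_op (id_blinfun + A (complex_of_real x))"
    and invertible: "\<And>z. 0 < Im z \<Longrightarrow> Im z < 1 \<Longrightarrow> invertible_op (id_blinfun + A z)"
  shows "\<forall>\<epsilon>>0. \<exists>C\<^sub>\<epsilon>>0. \<forall>x :: real.
    norm (inverse_op (id_blinfun + A (complex_of_real x + \<i> / 2))) \<le> C\<^sub>\<epsilon> * exp (\<epsilon> * \<bar>x\<bar>\<^sup>2)"
proof (intro allI impI, rule ccontr)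
  fix \<epsilon> :: real assume \<epsilon>: "\<epsilon> > 0"
  define S where "S z = id_blinfun + A z" for z
  define pt where "pt x = Complex x (1/2)" for x
  have pt: "complex_of_real x + \<i> / 2 = pt x" for x
    by (simp add: pt_def complex_eq_iff)
  have pt0: "pt 0 = \<i> / 2"
    by (simp add: pt_def complex_eq_iff)
  assume "\<not> (\<exists>C\<^sub>\<epsilon>>0. \<forall>x :: real.
    norm (inverse_op (id_blinfun + A (complex_of_real x + \<i> / 2))) \<le> C\<^sub>\<epsilon> * exp (\<epsilon> * \<bar>x\<bar>\<^sup>2))"
  then have bad: "\<exists>x. norm (inverse_op (S (pt x))) > B * exp (\<epsilon> * x\<^sup>2)" if "B > 0" for B
    using that unfolding S_def pt by (simp add: not_le)
  have tc: "trace_class (A z)" if "Im z > 0" for z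
    using hol that unfolding trace_holomorphic_on_def by blast
  have clS: "clinear_op (S z)" if "Im z > 0" for z
    unfolding S_def by (intro clinear_intros trace_class_clinear tc that)
  have nS: "norm (S z) \<le> 1" if "Im z > 0" for z
    unfolding S_def using contraction_in_half_plane[OF hol boundary bound unitary that] .
  have inv: "invertible_op (S z)" if "0 < Im z" "Im z < 1" for z
    unfolding S_def using invertible that .
  have cont: "continuous_on K A" if "\<And>z. z \<in> K \<Longrightarrow> 0 < Im z" for K
    by (rule continuous_on_subset[OF trace_continuous_imp_continuous[OF boundary]]) (use that less_imp_le in blast)
  have low: "\<exists>c>0. \<forall>z\<in>K. \<forall>h. c * norm h \<le> norm (S z h)"
    if "compact K" "\<And>z. z \<in> K \<Longrightarrow> 0 < Im z \<and> Im z < 1" for K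
    unfolding S_def using that invertible by (intro uniformly_bounded_below cont) blast+

  \<comment> \<open>Over the interval from \<open>-R\<close> to \<open>R\<close> the inverses are
    bounded by some \<open>1 / c\<close>, so a violation with the constant
    \<open>max 1 (1 / c)\<close> occurs outside it; the 1 ensures that it is also a violation with
    constant 1.\<close>
  have far: "\<exists>x. R \<le> \<bar>x\<bar> \<and> norm (inverse_op (S (pt x))) > exp (\<epsilon> * x\<^sup>2)" for R
  proof -
    have "compact (pt ` {-R..R})"
      unfolding pt_def Complex_eq by (intro compact_continuous_image continuous_intros compact_Icc)
    moreover have "0 < Im z \<and> Im z < 1" if "z \<in> pt ` {-R..R}" for z
      using that by (auto simp: pt_def)
    ultimately obtain c where c: "c > 0" "\<forall>z\<in>pt ` {-R..R}. \<forall>h. c * norm h \<le> norm (S z h)"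
      using low by blast
    have "max 1 (1 / c) > 0"
      by (simp add: less_max_iff_disj)
    from bad[OF this] obtain x where x: "norm (inverse_op (S (pt x))) > max 1 (1 / c) * exp (\<epsilon> * x\<^sup>2)" ..
    have e1: "1 \<le> exp (\<epsilon> * x\<^sup>2)"
      using \<epsilon> by simp
    have "R \<le> \<bar>x\<bar>"
    proof (rule ccontr)
      assume "\<not> R \<le> \<bar>x\<bar>"
      then have xR: "x \<in> {-R..R}"
        by auto
      have "norm (inverse_op (S (pt x))) \<le> 1 / c"
      proof (rule norm_blinfun_bound)
        fix y
        have "c * norm (inverse_op (S (pt x)) y) \<le> norm y"
          using bspec[OF c(2) imageI[OF xR], rule_format, of "inverse_op (S (pt x)) y"]
            inverse_op_left(2)[OF inv[of "pt x"], of y] by (simp add: pt_def)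
        then show "norm (inverse_op (S (pt x)) y) \<le> 1 / c * norm y"
          using c(1) by (simp add: field_simps)
      qed (use c in simp)
      also have "\<dots> \<le> max 1 (1 / c) * 1"
        by simp
      also have "\<dots> \<le> max 1 (1 / c) * exp (\<epsilon> * x\<^sup>2)"
        using e1 by (intro mult_left_mono) auto
      finally show False
        using x by simp
    qed
    moreover have "1 * exp (\<epsilon> * x\<^sup>2) \<le> max 1 (1 / c) * exp (\<epsilon> * x\<^sup>2)"
      by (intro mult_right_mono) auto
    ultimately show ?thesis
      using x by (intro exI[of _ x]) linarith
  qed

  obtain c1 where c1: "c1 > 0" "\<And>h. c1 * norm h \<le> norm (S (pt 0) h)"
    using low[of "{pt 0}"] by (fastforce simp: pt_def)
  define \<tau> where "\<tau> = 2 * trace_norm (A (pt 0))"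
  \<comment> \<open>The number of points depends only on the trace norm and the lower bound
    \<open>c1\<close> at \<open>\<i> / 2\<close>, as points and space are chosen afterwards. The
    factor 2 in \<open>2 * \<epsilon>\<close> comes from squaring
    \<open>exp (- \<epsilon> * n / 960)\<close>.\<close>
  obtain n :: nat where n: "\<tau> / (c1 / 2)\<^sup>2 * 960 / (2 * \<epsilon>) < n"
    using reals_Archimedean2 by blast
  \<comment> \<open>As \<open>R0 \<ge> 1\<close>, one gets \<open>\<epsilon> * (x k)^2 \<ge>
    \<epsilon> * \<bar>x k\<bar> \<ge> \<epsilon> * R0 \<ge> 120 + \<epsilon> * n\<close>.\<close>
  define R0 where "R0 = 1 + (120 + \<epsilon> * n) / \<epsilon>"
  have R0: "R0 \<ge> 1"
    using \<epsilon> by (simp add: R0_def)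
  obtain x :: "nat \<Rightarrow> real" where xx: "(\<forall>k. norm (inverse_op (S (pt (x k)))) > exp (\<epsilon> * (x k)\<^sup>2)) \<and>
    (\<forall>k. R0 \<le> \<bar>x k\<bar>) \<and> (\<forall>j k. j < k \<longrightarrow> 2 * \<bar>x j\<bar> \<le> \<bar>x k\<bar>)"
    using sparse_sequence[OF far, of R0] ..
  then have x: "\<And>k. norm (inverse_op (S (pt (x k)))) > exp (\<epsilon> * (x k)\<^sup>2)"
    "\<And>k. R0 \<le> \<bar>x k\<bar>" "\<And>j k. j < k \<Longrightarrow> 2 * \<bar>x j\<bar> \<le> \<bar>x k\<bar>"
    by simp_all
  have "\<forall>k. \<exists>g. norm g = 1 \<and> norm (S (pt (x k)) g) \<le> exp (- \<epsilon> * (x k)\<^sup>2)"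
  proof
    fix k
    have "\<exists>g. norm g = 1 \<and> norm (S (pt (x k)) g) \<le> 1 / exp (\<epsilon> * (x k)\<^sup>2)"
      by (rule inverse_large_imp_almost_kernel[OF inv x(1)]) (simp_all add: pt_def)
    then show "\<exists>g. norm g = 1 \<and> norm (S (pt (x k)) g) \<le> exp (- \<epsilon> * (x k)\<^sup>2)"
      by (simp add: exp_minus inverse_eq_divide)
  qed
  from choice[OF this] obtain g
    where g: "\<And>k. norm (g k) = 1" "\<And>k. norm (S (pt (x k)) (g k)) \<le> exp (- \<epsilon> * (x k)\<^sup>2)"
    by blast

  \<comment> \<open>Radius 3/8 keeps the closed discs at heights between 1/8 and 7/8, inside the
    strip of invertibility.\<close>
  define K where "K = insert (pt 0) (\<Union>k<n. cball (pt (x k)) (3/8))"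
  have K: "compact K"
    unfolding K_def by (intro compact_insert compact_UN) auto
  have strip: "0 < Im z \<and> Im z < 1" if "z \<in> K" for z
  proof -
    have "\<exists>y. norm (pt y - z) \<le> 3/8"
    proof (cases "z = pt 0")
      case True
      then show ?thesis
        by (intro exI[of _ 0]) simp
    next
      case False
      then show ?thesis
        using that by (auto simp: K_def dist_norm)
    qed
    then obtain y where "norm (pt y - z) \<le> 3/8"
      by blast
    then have "\<bar>Im (pt y - z)\<bar> \<le> 3/8"
      using abs_Im_le_cmod order_trans by blast
    then have "\<bar>1/2 - Im z\<bar> \<le> 3/8"
      by (simp add: pt_def)
    then show ?thesis
      by linarith
  qed
  obtain c where c: "c > 0" "\<And>z h. z \<in> K \<Longrightarrow> c * norm h \<le> norm (S z h)"
    using low[OF K strip] by blast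
  \<comment> \<open>With this choice compression loses at most half of either lower bound.\<close>
  define \<delta> where "\<delta> = min c c1 / 2"
  have \<delta>: "\<delta> > 0" "\<delta> \<le> c / 2" "\<delta> \<le> c1 / 2"
    using c c1 by (auto simp: \<delta>_def)
  have contK: "continuous_on K A" and tcK: "\<And>z. z \<in> K \<Longrightarrow> trace_class (A z)"
    using strip cont tc by blast+
  obtain X where XX: "finite X \<and> (\<forall>F. finite F \<longrightarrow> orthonormal F \<longrightarrow> (\<forall>x\<in>X. proj F x = x) \<longrightarrow>
      (\<forall>z\<in>K. \<forall>h. norm (A z h - proj F (A z h)) \<le> \<delta> * norm h))"
    using uniformly_compact[OF K contK tcK \<delta>(1)] ..
  note X = XX[THEN conjunct1] XX[THEN conjunct2, rule_format]
  obtain F where F: "finite F" "orthonormal F" and FX: "\<And>y. y \<in> X \<union> g ` {..<n} \<Longrightarrow> proj F y = y"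
    using gram_schmidt_exists[of "X \<union> g ` {..<n}"] X(1) by auto
  obtain e where e: "bij_betw e {..<card F} F"
    using ex_bij_betw_nat_finite[OF F(1)] by (auto simp: lessThan_atLeast0)
  define d where "d z = Determinant.det (compression_mat e (card F) (S z))" for z
  \<comment> \<open>For \<open>h\<close> in the span of \<open>F\<close>, the part of
    \<open>S z h\<close> outside the span comes from \<open>A z h\<close> alone and is small by the
    choice of \<open>X\<close>.\<close>
  have lowF: "(a - \<delta>) * norm h \<le> norm (proj F (S z h))"
    if "z \<in> K" "proj F h = h" "a * norm h \<le> norm (S z h)" for z h a
  proof -
    have "S z h = proj F (S z h) + (A z h - proj F (A z h))"
      using that(2) by (simp add: S_def blinfun.add_left proj_add)
    then have "norm (S z h) \<le> norm (proj F (S z h)) + norm (A z h - proj F (A z h))"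
      by (metis norm_triangle_ineq)
    moreover have "norm (A z h - proj F (A z h)) \<le> \<delta> * norm h"
      using X(2)[OF F _ that(1)] FX by simp
    ultimately show ?thesis
      using that(3) by (simp add: left_diff_distrib)
  qed
  \<comment> \<open>Used for two purposes: with \<open>a = c\<close> it only excludes zeros in the
    discs, so \<open>c\<close> may depend on the points; with \<open>a = c1\<close> at
    \<open>pt 0\<close> it gives the lower bound that must be independent of them.\<close>
  have ge: "exp (- (\<Sum>f\<in>F. 1 - (norm (proj F (S z f)))\<^sup>2) / (a / 2)\<^sup>2) \<le> (cmod (d z))\<^sup>2"
    if z: "z \<in> K" and a: "a > 0" "\<delta> \<le> a / 2" and low: "\<And>h. a * norm h \<le> norm (S z h)" for z a
    unfolding d_def
  proof (rule det_compression_ge_exp[OF F e])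
    show "clinear_op (S z)" "norm (S z) \<le> 1" "a / 2 > 0"
      using strip[OF z] clS nS a by auto
    fix h assume h: "proj F h = h"
    have "a / 2 * norm h \<le> (a - \<delta>) * norm h"
      using a by (intro mult_right_mono) auto
    then show "a / 2 * norm h \<le> norm (proj F (S z h))"
      using lowF[OF z h low] by linarith
  qed

  have "norm (d (\<i> / 2)) \<le> exp (- \<epsilon> * n / 960)"
  proof (rule sparse_small_values[where x = x])
    show "d holomorphic_on {z. 0 < Im z}"
      unfolding d_def
    proof (rule holomorphic_det_compression)
      show "(\<lambda>z. cinner (S z f) g) holomorphic_on {z. 0 < Im z}" for f g
        unfolding S_def blinfun.add_left cinner_add_left
        by (intro holomorphic_intros trace_holomorphic_cinner hol)
    qed
    show "norm (d z) \<le> 1" if "0 < Im z" for z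
      unfolding d_def by (rule det_compression_le_one[OF F e clS[OF that] nS[OF that]])
    show "1 \<le> \<bar>x k\<bar>" for k
      using x(2)[of k] R0 by linarith
    show "120 + \<epsilon> * n \<le> \<epsilon> * (x k)\<^sup>2" for k
    proof -
      have "(120 + \<epsilon> * n) / \<epsilon> \<le> \<bar>x k\<bar> * 1"
        using x(2)[of k] by (simp add: R0_def)
      also have "\<dots> \<le> \<bar>x k\<bar> * \<bar>x k\<bar>"
        using x(2)[of k] R0 by (intro mult_left_mono) auto
      finally show ?thesis
        using \<epsilon> by (simp add: divide_le_eq power2_eq_square mult.commute)
    qed
    show "2 * \<bar>x j\<bar> \<le> \<bar>x k\<bar>" if "j < k" for j k
      using x(3) that .
    show "d z \<noteq> 0" if "k < n" "z \<in> ball (Complex (x k) (1/2)) (3/8)" for k z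
    proof -
      have "z \<in> K"
      proof -
        have "z \<in> cball (pt (x k)) (3/8)"
          using that(2) by (simp add: pt_def)
        then show ?thesis
          unfolding K_def using that(1) by blast
      qed
      then have "0 < (cmod (d z))\<^sup>2"
        using ge[OF \<open>z \<in> K\<close> c(1) \<delta>(2) c(2)[OF \<open>z \<in> K\<close>]] exp_gt_zero less_le_trans by blast
      then show ?thesis
        by auto
    qed
    show "norm (d (Complex (x k) (1/2))) \<le> 2 * exp (- \<epsilon> * (x k)\<^sup>2)" if "k < n" for k
    proof -
      have "proj F (g k) = g k"
        using FX that by blast
      then have "norm (d (pt (x k))) \<le> 2 * norm (S (pt (x k)) (g k))"
        unfolding d_def using g(1)
        by (intro det_compression_le_norm_apply[OF F e] clS nS) (auto simp: pt_def)
      then show ?thesis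
        using g(2)[of k] by (simp add: pt_def)
    qed
  qed (rule \<epsilon>)
  then have "(norm (d (pt 0)))\<^sup>2 \<le> (exp (- \<epsilon> * n / 960))\<^sup>2"
    unfolding pt0 by (intro power_mono) auto
  also have "\<dots> = exp (2 * (- \<epsilon> * n / 960))"
    by (rule exp_double[symmetric])
  also have "\<dots> < exp (- \<tau> / (c1 / 2)\<^sup>2)"
  proof -
    have "\<tau> / (c1 / 2)\<^sup>2 * 960 < n * (2 * \<epsilon>)"
      using n \<epsilon> by (simp only: pos_divide_less_eq)
    moreover have "q * 960 < n * (2 * \<epsilon>) \<Longrightarrow> 2 * (- \<epsilon> * n / 960) < - q" for q
      by (simp add: field_simps)
    ultimately have "2 * (- \<epsilon> * n / 960) < - (\<tau> / (c1 / 2)\<^sup>2)"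
      by blast
    then show ?thesis
      by (simp only: exp_less_cancel_iff minus_divide_left)
  qed
  \<comment> \<open>The dimension drops out here: the sum of defects is at most
    \<open>\<tau>\<close> for every \<open>F\<close>.\<close>
  also have "\<dots> \<le> exp (- (\<Sum>f\<in>F. 1 - (norm (proj F (S (pt 0) f)))\<^sup>2) / (c1 / 2)\<^sup>2)"
    using sum_defect_le[OF tc F, of "pt 0"] by (simp add: \<tau>_def S_def pt_def divide_right_mono)
  also have "\<dots> \<le> (norm (d (pt 0)))\<^sup>2"
    by (rule ge) (use c1 \<delta>(3) in \<open>auto simp: K_def\<close>)
  finally show False by simp
qed

end
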